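(* Let $(g_t)_{t>0}$ be a family of completely monotone functions such that for every $t>0$, $$g_t(0)=1,\qquad g_t'(0)=-1,\qquad g_t''(0)<\infty .$$ Let $-A$ be the generator of a sectorially bounded holomorphic $C_0$-semigroup $(e^{-tA})_{t\ge0}$ on a complex Banach space $X$, and for every $\beta\ge 0$ let $$M_\beta:=\sup_{t>0}\|t^\beta A^\beta e^{-tA}\|.$$ Then for all $n\in\mathbb N$ and $t>0$, $$\|g_t^n(tA/n)x-e^{-tA}x\|\le \left(2M_0+\tfrac{3M_1}{2}\right)\frac{g_t''(0)-1}{n}\,t\,\|Ax\|,\qquad x\in\mathrm{dom}(A).$$ Moreover, for all $n\in\mathbb N$ and $t>0$, $$\|g_t^n(tA/n)-e^{-tA}\|\le K\,\frac{g_t''(0)-1}{n},$$ and, if $\alpha\in(0,1)$, $$\|g_t^n(tA/n)x-e^{-tA}x\|\le 4K\,\frac{g_t''(0)-1}{n}\,t^\alpha\|A^\alpha x\|,\qquad x\in\mathrm{dom}(A^\alpha),$$ where $K=3M_0+3M_1+M_2/2$.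
   Context: A function $g\in C^\infty(0,\infty)$, $g\ge 0$, is completely monotone if $(-1)^k g^{(k)}(z)\ge 0$ for all $k\in\mathbb N$, $z>0$; by Bernstein's theorem $g(z)=\int_{[0,\infty)}e^{-zs}\,\nu(ds)$, $z>0$, for a unique positive Borel measure $\nu$ on $[0,\infty)$. One writes $g^{(k)}(0):=\lim_{z\to0+}g^{(k)}(z)$ (possibly infinite). If $g$ is bounded and $-A$ generates a bounded $C_0$-semigroup, then $g(A)$ is defined by the Hille–Phillips calculus: $g(A)x=\int_{[0,\infty)}e^{-sA}x\,\nu(ds)$, $x\in X$. The operator $g_t^n(tA/n)$ is the one obtained by applying this to $z\mapsto (g_t(tz/n))^n$; it equals the $n$-th power of $g_t(tA/n)=\int_{[0,\infty)}e^{-s(t/n)A}\,\nu_t(ds)$, where $\nu_t$ is the representing measure of $g_t$. $A^\alpha$ is the usual fractional power of the sectorial operator $A$. A $C_0$-semigroup is a sectorially bounded holomorphic $C_0$-semigroup if it extends holomorphically to a sector $\Sigma_\theta=\{\lambda\in\mathbb C:|\arg\lambda|<\theta\}$ for some $\theta\in(0,\pi/2]$ and the extension is bounded and strongly continuous on $\overline{\Sigma}_\xi$ for every $0<\xi<\theta$; equivalently, $e^{-tA}(X)\subset\mathrm{dom}(A)$ for $t>0$, $\sup_{t\ge0}\|e^{-tA}\|<\infty$ and $\sup_{t>0}\|tAe^{-tA}\|<\infty$. For such semigroups $M_\beta<\infty$ for all $\beta\ge0$. *)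

theory Defs
  imports "HOL-Analysis.Analysis"
begin

section \<open>Complex Banach spaces and bounded complex-linear operators\<close>

class complex_banach = banach +
  fixes scaleC :: "complex \<Rightarrow> 'a \<Rightarrow> 'a"  (infixr \<open>*\<^sub>C\<close> 75)
  assumes scaleC_add_right: "a *\<^sub>C (x + y) = a *\<^sub>C x + a *\<^sub>C y"
    and scaleC_add_left: "(a + b) *\<^sub>C x = a *\<^sub>C x + b *\<^sub>C x"
    and scaleC_scaleC: "a *\<^sub>C (b *\<^sub>C x) = (a * b) *\<^sub>C x"
    and scaleR_scaleC: "r *\<^sub>R x = complex_of_real r *\<^sub>C x"
    and norm_scaleC: "norm (a *\<^sub>C x) = cmod a * norm x"

definition bounded_clinear :: "('a::complex_banach \<Rightarrow> 'a) \<Rightarrow> bool" where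
  "bounded_clinear f \<longleftrightarrow> bounded_linear f \<and> (\<forall>c x. f (c *\<^sub>C x) = c *\<^sub>C f x)"


section \<open>Semigroups and generators\<close>

definition C0_semigroup :: "(real \<Rightarrow> 'a \<Rightarrow> 'a::complex_banach) \<Rightarrow> bool" where
  "C0_semigroup T \<longleftrightarrow>
     (\<forall>t\<ge>0. bounded_clinear (T t)) \<and>
     (\<forall>x. T 0 x = x) \<and>
     (\<forall>s\<ge>0. \<forall>t\<ge>0. \<forall>x. T (s + t) x = T s (T t x)) \<and>
     (\<forall>x. ((\<lambda>t. T t x) \<longlongrightarrow> x) (at_right 0))"

text \<open>Unbounded operators are represented by their graphs, so that the domain of \<open>A\<close> is
  \<^term>\<open>Domain A\<close>, composition is relational composition (\<open>R O S\<close> applies \<open>R\<close> first), and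
  powers are relational powers.\<close>

definition op_app :: "('a \<times> 'b) set \<Rightarrow> 'a \<Rightarrow> 'b" where
  "op_app A x = (THE y. (x, y) \<in> A)"

definition op_uminus :: "('a \<times> 'b::uminus) set \<Rightarrow> ('a \<times> 'b) set" where
  "op_uminus A = {(x, - y) |x y. (x, y) \<in> A}"

definition generator :: "(real \<Rightarrow> 'a \<Rightarrow> 'a::real_normed_vector) \<Rightarrow> ('a \<times> 'a) set" where
  "generator T = {(x, y). ((\<lambda>h. (T h x - x) /\<^sub>R h) \<longlongrightarrow> y) (at_right 0)}"

text \<open>\<^const>\<open>Arg\<close> takes values in \<open>(- pi, pi]\<close> and is 0 at 0.\<close>

definition sector :: "real \<Rightarrow> complex set" where
  "sector \<theta> = {z. z \<noteq> 0 \<and> \<bar>Arg z\<bar> < \<theta>}"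

text \<open>Holomorphy is required in the strong operator topology; for operator-valued functions this is
  equivalent to holomorphy in the operator norm.\<close>

definition strongly_holomorphic_on :: "(complex \<Rightarrow> 'a \<Rightarrow> 'a::complex_banach) \<Rightarrow> complex set \<Rightarrow> bool" where
  "strongly_holomorphic_on U S \<longleftrightarrow>
     (\<forall>x. \<forall>z\<in>S. \<exists>D. ((\<lambda>w. inverse (w - z) *\<^sub>C (U w x - U z x)) \<longlongrightarrow> D) (at z within S))"

definition sectorially_bounded_holomorphic_semigroup ::
    "(real \<Rightarrow> 'a \<Rightarrow> 'a::complex_banach) \<Rightarrow> bool" where
  "sectorially_bounded_holomorphic_semigroup T \<longleftrightarrow>
     C0_semigroup T \<and>
     (\<exists>\<theta> U. 0 < \<theta> \<and> \<theta> \<le> pi / 2 \<and>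
        (\<forall>t\<ge>0. U (complex_of_real t) = T t) \<and>
        (\<forall>z\<in>sector \<theta>. bounded_clinear (U z)) \<and>
        strongly_holomorphic_on U (sector \<theta>) \<and>
        (\<forall>\<xi>. 0 < \<xi> \<and> \<xi> < \<theta> \<longrightarrow>
           (\<exists>C. \<forall>z\<in>closure (sector \<xi>). \<forall>x. norm (U z x) \<le> C * norm x) \<and>
           (\<forall>x. continuous_on (closure (sector \<xi>)) (\<lambda>z. U z x))))"


section \<open>Fractional powers\<close>

text \<open>For \<open>s > 0\<close> this is \<open>(s + A)\<^sup>-\<^sup>1\<close>: the equation \<open>(s + A) v = u\<close> means \<open>A v = u - s v\<close>.\<close>

definition neg_resolvent :: "('a \<times> 'a::real_vector) set \<Rightarrow> real \<Rightarrow> 'a \<Rightarrow> 'a" where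
  "neg_resolvent A s u = (THE v. (v, u - s *\<^sub>R v) \<in> A)"

text \<open>Balakrishnan's definition of \<open>A\<^sup>\<alpha>\<close> for \<open>0 < \<alpha> < 1\<close> and a densely defined sectorial operator:
  the closure of the operator
  \<open>x \<mapsto> (sin (\<pi> \<alpha>) / \<pi>) \<integral>\<^sub>0\<^sup>\<infinity> s\<^bsup>\<alpha>-1\<^esup> (s + A)\<^sup>-\<^sup>1 A x ds\<close> with domain \<open>dom(A)\<close>.\<close>

definition balakrishnan :: "('a \<times> 'a::banach) set \<Rightarrow> real \<Rightarrow> ('a \<times> 'a) set" where
  "balakrishnan A \<alpha> = closure
     {(x, (sin (pi * \<alpha>) / pi) *\<^sub>R w) |x w.
        \<exists>y. (x, y) \<in> A \<and> ((\<lambda>s. s powr (\<alpha> - 1) *\<^sub>R neg_resolvent A s y) has_integral w) {0<..}}"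

text \<open>General exponents \<open>\<beta> \<ge> 0\<close>: \<open>A\<^sup>\<beta> = A\<^sup>m A\<^bsup>\<beta>-m\<^esup>\<close> with \<open>m\<close> the integer part of \<open>\<beta>\<close>.\<close>

definition frac_power :: "('a \<times> 'a::banach) set \<Rightarrow> real \<Rightarrow> ('a \<times> 'a) set" where
  "frac_power A \<beta> =
     (if frac \<beta> = 0 then Id else balakrishnan A (frac \<beta>)) O (A ^^ nat \<lfloor>\<beta>\<rfloor>)"

lemma frac_power_of_nat: "frac_power A (real n) = A ^^ n"
  by (simp add: frac_power_def)


section \<open>Completely monotone functions\<close>

definition completely_monotone :: "(real \<Rightarrow> real) \<Rightarrow> bool" where
  "completely_monotone g \<longleftrightarrow>
     (\<forall>k. \<forall>z>0. (deriv ^^ k) g differentiable at z) \<and>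
     (\<forall>k. \<forall>z>0. 0 \<le> (- 1) ^ k * (deriv ^^ k) g z)"

definition deriv_at_zero :: "nat \<Rightarrow> (real \<Rightarrow> real) \<Rightarrow> ereal" where
  "deriv_at_zero k g = Lim (at_right 0) (\<lambda>z. ereal ((deriv ^^ k) g z))"

definition represents :: "real measure \<Rightarrow> (real \<Rightarrow> real) \<Rightarrow> bool" where
  "represents \<nu> g \<longleftrightarrow>
     sets \<nu> = sets (restrict_space borel {0..}) \<and>
     (\<forall>z>0. has_bochner_integral \<nu> (\<lambda>s. exp (- (z * s))) (g z))"

text \<open>For completely monotone \<open>g\<close> there is exactly one such measure, by Bernstein's theorem.\<close>

definition bernstein_measure :: "(real \<Rightarrow> real) \<Rightarrow> real measure" where
  "bernstein_measure g = (SOME \<nu>. represents \<nu> g)"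


section \<open>Hille--Phillips calculus\<close>

text \<open>The library predicate \<^const>\<open>has_bochner_integral\<close> demands a second countable target type. Here
  its definition is repeated verbatim without this restriction; since the approximants are simple
  functions converging in \<open>L\<^sup>1\<close>, \<open>f\<close> is almost everywhere separably valued, and this is the usual
  Bochner integral in an arbitrary Banach space.\<close>

definition bochner_integral_eq :: "'b measure \<Rightarrow> ('b \<Rightarrow> 'a::banach) \<Rightarrow> 'a \<Rightarrow> bool" where
  "bochner_integral_eq M f y \<longleftrightarrow>
     f \<in> borel_measurable M \<and>
     (\<exists>s. (\<forall>i. Bochner_Integration.simple_bochner_integrable M (s i)) \<and>
          (\<lambda>i. \<integral>\<^sup>+x. norm (f x - s i x) \<partial>M) \<longlonglongrightarrow> 0 \<and>
          (\<lambda>i. Bochner_Integration.simple_bochner_integral M (s i)) \<longlonglongrightarrow> y)"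

text \<open>The operator \<open>g(A)\<close>, where \<open>-A\<close> generates the bounded semigroup \<open>T\<close>.\<close>

definition hille_phillips :: "(real \<Rightarrow> real) \<Rightarrow> (real \<Rightarrow> 'a \<Rightarrow> 'a::complex_banach) \<Rightarrow> 'a \<Rightarrow> 'a" where
  "hille_phillips g T x = (THE y. bochner_integral_eq (bernstein_measure g) (\<lambda>s. T s x) y)"

end

theory Submission
  imports Defs "HOL-Probability.Probability" "HOL-Complex_Analysis.Complex_Analysis"
    "HOL-Real_Asymp.Real_Asymp"
begin

text \<open>
  Let \<open>q = (g\<^sub>t''(0) - 1) / n\<close>. The function \<open>h(z) = g\<^sub>t(t z / n)\<^sup>n\<close> is completely monotone. By Bernstein's
  theorem (\<open>bernstein_exists\<close>) it is the Laplace transform of a measure \<open>\<nu>\<close>, and the derivatives of \<open>h\<close> at 0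
  show that \<open>\<nu>\<close> is a probability measure with mean \<open>t\<close> and variance at most \<open>t\<^sup>2 q\<close>
  (\<open>scaled_power_measure\<close>). With the Taylor remainder
  \<open>Rem t s x = T(s) x - T(t) x + (s - t) A T(t) x\<close>, the exact mean gives
  \<open>h(A) x - T(t) x = \<integral> Rem t s x \<nu>(ds)\<close>. All three inequalities therefore follow from
  pointwise bounds \<open>norm (Rem t s x) \<le> c (s - t)\<^sup>2\<close> for \<open>s \<ge> 0\<close>, with error at most \<open>c t\<^sup>2 q\<close>.

  For \<open>x\<close> in the domain of \<open>A\<close> the second derivative of the orbit is at most \<open>M\<^sub>1 norm (A x) / v\<close> at \<open>v\<close>, which
  gives \<open>c = M\<^sub>1 norm (A x) / t\<close> (\<open>Rem_dom_le\<close>). For arbitrary \<open>x\<close> the orbit, its first and its second derivative are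
  bounded by \<open>M\<^sub>0\<close>, \<open>M\<^sub>1 / v\<close> and \<open>M\<^sub>2 / v\<^sup>2\<close> times \<open>norm x\<close>, and an elementary argument
  (\<open>taylor_rem_scale_invariant\<close>) gives \<open>c = K norm x / t\<^sup>2\<close>. For fractional powers, \<open>x\<close> is recovered from
  \<open>A\<^sup>\<alpha>x\<close> by integrating \<open>\<tau>\<^bsup>\<alpha>-1\<^esup> T(\<tau>) A\<^sup>\<alpha>x\<close>; the bound \<open>K\<close> for \<open>\<tau> \<le> t\<close> and the decay of
  \<open>Rem t s (T(\<tau>) z)\<close> for \<open>\<tau> > t\<close> give \<open>c = 4 K t\<^sup>\<alpha> norm (A\<^sup>\<alpha>x) / t\<^sup>2\<close> (\<open>Rem_balakrishnan_le\<close>).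

  Real functionals that attain the norm at a given vector (\<open>norming_functional\<close>) reduce Bochner integrals, Cauchy's estimate and the double integrals to the scalar case.
\<close>

section \<open>Norming functionals\<close>

definition sublinear :: "('a::real_vector \<Rightarrow> real) \<Rightarrow> bool" where
  "sublinear q \<longleftrightarrow> (\<forall>x y. q (x + y) \<le> q x + q y) \<and> (\<forall>a>0. \<forall>x. q (a *\<^sub>R x) = a * q x) \<and> q 0 = 0"

text \<open>The largest sublinear functional below \<open>q\<close> whose value at \<open>- y\<close> is at most \<open>- q y\<close>, when \<open>q\<close> is sublinear.\<close>

definition flatten :: "('a::real_vector \<Rightarrow> real) \<Rightarrow> 'a \<Rightarrow> 'a \<Rightarrow> real" where
  "flatten q y x = (INF a\<in>{0..}. q (x + a *\<^sub>R y) - a * q y)"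

lemma sublinear_add: "sublinear q \<Longrightarrow> q (x + y) \<le> q x + q y"
  and sublinear_scale: "sublinear q \<Longrightarrow> a > 0 \<Longrightarrow> q (a *\<^sub>R x) = a * q x"
  and sublinear_zero: "sublinear q \<Longrightarrow> q 0 = 0"
  by (auto simp: sublinear_def)

lemma sublinear_scale_nonneg: "sublinear q \<Longrightarrow> a \<ge> 0 \<Longrightarrow> q (a *\<^sub>R x) = a * q x"
  by (cases "a = 0") (auto simp: sublinear_zero sublinear_scale)

lemma sublinear_lower: "sublinear q \<Longrightarrow> - q (- x) \<le> q x"
  using sublinear_add[of q x "- x"] by (simp add: sublinear_zero)

lemma flatten_bdd_below:
  assumes q: "sublinear q"
  shows "bdd_below ((\<lambda>a. q (x + a *\<^sub>R y) - a * q y) ` {0..})"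
proof (rule bdd_belowI2[where m = "- q (- x)"])
  fix a :: real assume "a \<in> {0..}"
  then have "a * q y = q (a *\<^sub>R y)" by (simp add: sublinear_scale_nonneg[OF q])
  then show "- q (- x) \<le> q (x + a *\<^sub>R y) - a * q y"
    using sublinear_add[OF q, of "x + a *\<^sub>R y" "- x"] by simp
qed

lemma flatten_le: "sublinear q \<Longrightarrow> a \<ge> 0 \<Longrightarrow> flatten q y x \<le> q (x + a *\<^sub>R y) - a * q y"
  unfolding flatten_def by (rule cINF_lower[OF flatten_bdd_below]) auto

lemma flatten_ge:
  "(\<And>a. a \<ge> 0 \<Longrightarrow> c \<le> q (x + a *\<^sub>R y) - a * q y) \<Longrightarrow> c \<le> flatten q y x"
  unfolding flatten_def by (rule cINF_greatest) auto

lemma sublinear_flatten: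
  assumes q: "sublinear q"
  shows "sublinear (flatten q y)"
proof -
  have scale_le: "flatten q y (c *\<^sub>R x) \<le> c * flatten q y x" if c: "c > 0" for c x
  proof -
    have "flatten q y (c *\<^sub>R x) / c \<le> flatten q y x"
    proof (rule flatten_ge)
      fix a :: real assume "a \<ge> 0"
      then have "flatten q y (c *\<^sub>R x) \<le> q (c *\<^sub>R x + (c * a) *\<^sub>R y) - (c * a) * q y"
        using c by (intro flatten_le[OF q]) auto
      also have "c *\<^sub>R x + (c * a) *\<^sub>R y = c *\<^sub>R (x + a *\<^sub>R y)" by (simp add: scaleR_add_right)
      also have "q \<dots> - (c * a) * q y = (q (x + a *\<^sub>R y) - a * q y) * c"
        by (simp only: sublinear_scale[OF q c]) (simp add: algebra_simps)
      finally show "flatten q y (c *\<^sub>R x) / c \<le> q (x + a *\<^sub>R y) - a * q y"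
        using c by (simp only: pos_divide_le_eq)
    qed
    then show ?thesis using c by (simp add: field_simps)
  qed
  have scale: "flatten q y (c *\<^sub>R x) = c * flatten q y x" if c: "c > 0" for c x
  proof (rule antisym[OF scale_le[OF c]])
    show "c * flatten q y x \<le> flatten q y (c *\<^sub>R x)"
      using scale_le[of "1 / c" "c *\<^sub>R x"] c by (simp add: field_simps)
  qed
  have add: "flatten q y (u + v) \<le> flatten q y u + flatten q y v" for u v
  proof -
    have "flatten q y (u + v) - flatten q y v \<le> flatten q y u"
    proof (rule flatten_ge)
      fix a :: real assume a: "a \<ge> 0"
      have "flatten q y (u + v) - (q (u + a *\<^sub>R y) - a * q y) \<le> flatten q y v"
      proof (rule flatten_ge)
        fix b :: real assume b: "b \<ge> 0"
        have "flatten q y (u + v) \<le> q ((u + v) + (a + b) *\<^sub>R y) - (a + b) * q y"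
          using a b by (intro flatten_le[OF q]) auto
        also have "(u + v) + (a + b) *\<^sub>R y = (u + a *\<^sub>R y) + (v + b *\<^sub>R y)"
          by (simp add: scaleR_add_left)
        also have "q \<dots> \<le> q (u + a *\<^sub>R y) + q (v + b *\<^sub>R y)" by (rule sublinear_add[OF q])
        finally show "flatten q y (u + v) - (q (u + a *\<^sub>R y) - a * q y) \<le> q (v + b *\<^sub>R y) - b * q y"
          by (simp add: algebra_simps)
      qed
      then show "flatten q y (u + v) - flatten q y v \<le> q (u + a *\<^sub>R y) - a * q y" by linarith
    qed
    then show ?thesis by linarith
  qed
  have "flatten q y 0 = 0"
    using scale[of 2 0] by simp
  then show ?thesis using add scale by (simp add: sublinear_def)
qed

text \<open>A form of the Hahn--Banach theorem. Zorn's lemma provides a minimal sublinear functional below \<open>p\<close>, and a minimal one equals all its flattenings, which forces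
  additivity.\<close>

lemma linear_below_sublinear:
  fixes p :: "'a::real_vector \<Rightarrow> real"
  assumes p: "sublinear p"
  shows "\<exists>\<phi>. linear \<phi> \<and> (\<forall>x. \<phi> x \<le> p x)"
proof -
  define S where "S = {q. sublinear q \<and> (\<forall>x. q x \<le> p x)}"
  define P where "P = (\<lambda>f g :: 'a \<Rightarrow> real. \<forall>x. g x \<le> f x)"
  have po: "partial_order_on S (relation_of P S)"
    by (rule partial_order_on_relation_ofI)
       (auto simp: P_def fun_eq_iff intro: order_trans antisym)
  have "\<exists>m\<in>S. \<forall>a\<in>S. P m a \<longrightarrow> a = m"
  proof (rule predicate_Zorn[OF po])
    fix C assume C: "C \<in> Chains (relation_of P S)"
    have CS: "C \<subseteq> S" using C by (auto simp: Chains_def relation_of_def)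
    have total: "P f g \<or> P g f" if "f \<in> C" "g \<in> C" for f g
      using C that by (auto simp: Chains_def relation_of_def)
    show "\<exists>u\<in>S. \<forall>a\<in>C. P a u"
    proof (cases "C = {}")
      case True
      then show ?thesis using p by (auto simp: S_def intro!: bexI[of _ p])
    next
      case False
      define u where "u x = (INF q\<in>C. q x)" for x
      have bdd: "bdd_below ((\<lambda>q. q x) ` C)" for x
      proof (rule bdd_belowI2[where m = "- p (- x)"])
        fix q assume "q \<in> C"
        then have "sublinear q" "q (- x) \<le> p (- x)" using CS by (auto simp: S_def)
        then show "- p (- x) \<le> q x" using sublinear_lower[of q x] by simp
      qed
      have u_le: "u x \<le> q x" if "q \<in> C" for q x
        unfolding u_def by (rule cINF_lower[OF bdd that])
      have u_ge: "c \<le> u x" if "\<And>q. q \<in> C \<Longrightarrow> c \<le> q x" for c x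
        unfolding u_def using False that by (intro cINF_greatest) auto
      have sub: "sublinear q" if "q \<in> C" for q using that CS by (auto simp: S_def)
      have add: "u (x + y) \<le> u x + u y" for x y
      proof -
        have "u (x + y) - u y \<le> u x"
        proof (rule u_ge)
          fix q assume q: "q \<in> C"
          have "u (x + y) - q x \<le> u y"
          proof (rule u_ge)
            fix r assume r: "r \<in> C"
            obtain m where m: "m \<in> C" "\<And>z. m z \<le> q z" "\<And>z. m z \<le> r z"
              using total[OF q r] q r by (auto simp: P_def)
            have "u (x + y) \<le> m (x + y)" by (rule u_le[OF m(1)])
            also have "\<dots> \<le> m x + m y" by (rule sublinear_add[OF sub[OF m(1)]])
            finally show "u (x + y) - q x \<le> r y" using m(2)[of x] m(3)[of y] by linarith
          qed
          then show "u (x + y) - u y \<le> q x" by linarith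
        qed
        then show ?thesis by linarith
      qed
      have scale_le: "u (a *\<^sub>R x) \<le> a * u x" if a: "a > 0" for a x
      proof -
        have "u (a *\<^sub>R x) / a \<le> u x"
        proof (rule u_ge)
          fix q assume q: "q \<in> C"
          show "u (a *\<^sub>R x) / a \<le> q x"
            using u_le[OF q, of "a *\<^sub>R x"] a by (simp add: sublinear_scale[OF sub[OF q]] field_simps)
        qed
        then show ?thesis using a by (simp add: field_simps)
      qed
      have scale: "u (a *\<^sub>R x) = a * u x" if a: "a > 0" for a x
        using scale_le[OF a, of x] scale_le[of "1 / a" "a *\<^sub>R x"] a by (simp add: field_simps)
      have "u 0 = 0" using scale[of 2 0] by simp
      then have "sublinear u" using add scale by (simp add: sublinear_def)
      moreover obtain q where q: "q \<in> C" using False by auto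
      then have "u x \<le> p x" for x using u_le[OF q, of x] subsetD[OF CS q] by (auto simp: S_def intro: order_trans)
      ultimately have "u \<in> S" by (simp add: S_def)
      then show ?thesis using u_le by (auto simp: P_def)
    qed
  qed
  then obtain m where mS: "m \<in> S" and mmin: "\<And>q. q \<in> S \<Longrightarrow> P m q \<Longrightarrow> q = m" by blast
  then have m: "sublinear m" "\<And>x. m x \<le> p x" by (auto simp: S_def)
  have min: "q = m" if "sublinear q" "\<And>x. q x \<le> m x" for q
    using that m(2) by (intro mmin) (auto simp: S_def P_def intro: order_trans)
  have add: "m (x + y) = m x + m y" for x y
  proof (rule antisym[OF sublinear_add[OF m(1)]])
    have "flatten m y = m"
      using flatten_le[OF m(1), of 0 y] by (intro min sublinear_flatten m) auto
    then show "m x + m y \<le> m (x + y)"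
      using flatten_le[OF m(1), of 1 y x] by simp
  qed
  have neg: "m (- x) = - m x" for x
    using add[of x "- x"] by (simp add: sublinear_zero[OF m(1)])
  have "m (a *\<^sub>R x) = a * m x" for a x
  proof (cases "a \<ge> 0")
    case True
    then show ?thesis by (rule sublinear_scale_nonneg[OF m(1)])
  next
    case False
    then have "m ((- a) *\<^sub>R x) = (- a) * m x" by (intro sublinear_scale_nonneg[OF m(1)]) auto
    then show ?thesis using neg[of "a *\<^sub>R x"] by simp
  qed
  with add m(2) show ?thesis by (intro exI[of _ m]) (auto intro!: linearI)
qed

text \<open>Flattening the norm along \<open>y\<close> before passing to a linear minorant forces the value \<open>norm y\<close>
  at \<open>y\<close>. This result reduces norm estimates for vector-valued integrals and derivatives to
  real-valued ones.\<close>

theorem norming_functional: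
  fixes y :: "'a::real_normed_vector"
  obtains \<phi> :: "'a \<Rightarrow> real"
  where "bounded_linear \<phi>" "\<And>x. \<bar>\<phi> x\<bar> \<le> norm x" "\<phi> y = norm y"
proof -
  have n: "sublinear (norm :: 'a \<Rightarrow> real)"
    by (auto simp: sublinear_def norm_triangle_ineq)
  obtain \<phi> where \<phi>: "linear \<phi>" "\<And>x. \<phi> x \<le> flatten norm y x"
    using linear_below_sublinear[OF sublinear_flatten[OF n]] by blast
  have le: "\<phi> x \<le> norm x" for x
    using \<phi>(2)[of x] flatten_le[OF n, of 0 y x] by simp
  have abs: "\<bar>\<phi> x\<bar> \<le> norm x" for x
    using le[of x] le[of "- x"] linear_neg[OF \<phi>(1), of x] by simp
  have "\<phi> (- y) \<le> - norm y"
    using \<phi>(2)[of "- y"] flatten_le[OF n, of 1 y "- y"] by simp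
  then have "\<phi> y = norm y" using le[of y] linear_neg[OF \<phi>(1), of y] by simp
  moreover have "bounded_linear \<phi>"
    using \<phi>(1) abs by (intro bounded_linear_intro[where K = 1]) (auto simp: linear_add linear_cmul)
  ultimately show ?thesis using that abs by blast
qed

section \<open>Bochner integrals against measures on the half-line\<close>

text \<open>Functionals map an approximating sequence of simple functions to an approximating sequence, and
  the real-valued integral is that of the library. Uniqueness of the integral and norm bounds for it
  follow from norming functionals.\<close>

lemma bochner_integral_eq_functional:
  fixes f :: "'b \<Rightarrow> 'a::banach" and \<phi> :: "'a \<Rightarrow> real"
  assumes f: "bochner_integral_eq M f y" and lin: "bounded_linear \<phi>" and le: "\<And>x. \<bar>\<phi> x\<bar> \<le> norm x"
  shows "has_bochner_integral M (\<lambda>x. \<phi> (f x)) (\<phi> y)"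
proof -
  interpret bounded_linear \<phi> by (rule lin)
  from f obtain s where meas: "f \<in> borel_measurable M"
    and s: "\<And>i. Bochner_Integration.simple_bochner_integrable M (s i)"
    and L1: "(\<lambda>i. \<integral>\<^sup>+x. norm (f x - s i x) \<partial>M) \<longlonglongrightarrow> 0"
    and lim: "(\<lambda>i. Bochner_Integration.simple_bochner_integral M (s i)) \<longlonglongrightarrow> y"
    by (auto simp: bochner_integral_eq_def)
  show ?thesis
  proof (rule has_bochner_integral.intros[where s = "\<lambda>i x. \<phi> (s i x)"])
    show "(\<lambda>x. \<phi> (f x)) \<in> borel_measurable M"
      using measurable_compose[OF meas borel_measurable_continuous_onI]
        linear_continuous_on[OF lin, of UNIV] by blast
    show "Bochner_Integration.simple_bochner_integrable M (\<lambda>x. \<phi> (s i x))" for i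
      using simple_bochner_integrable_compose2[of "\<lambda>x y. \<phi> x" M "s i" "s i"] s[of i] by (simp add: zero)
    show "(\<lambda>i. \<integral>\<^sup>+ x. ennreal (norm (\<phi> (f x) - \<phi> (s i x))) \<partial>M) \<longlonglongrightarrow> 0"
      by (rule tendsto_sandwich[OF _ _ tendsto_const L1])
         (use le in \<open>auto simp: diff[symmetric] intro!: always_eventually nn_integral_mono\<close>)
    show "(\<lambda>i. Bochner_Integration.simple_bochner_integral M (\<lambda>x. \<phi> (s i x))) \<longlonglongrightarrow> \<phi> y"
      using tendsto[OF lim] by (simp add: simple_bochner_integral_linear[OF linear_axioms s])
  qed
qed

lemma bochner_integral_eq_unique:
  assumes "bochner_integral_eq M f y" "bochner_integral_eq M f z"
  shows "y = z"
proof -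
  obtain \<phi> :: "'b \<Rightarrow> real" where \<phi>: "bounded_linear \<phi>" "\<And>x. \<bar>\<phi> x\<bar> \<le> norm x" "\<phi> (y - z) = norm (y - z)"
    by (rule norming_functional[of "y - z"]) blast
  have "\<phi> y = \<phi> z"
    using assms[THEN bochner_integral_eq_functional, OF \<phi>(1,2)] by (rule has_bochner_integral_eq)
  then show ?thesis using \<phi>(3) by (simp add: linear_diff[OF bounded_linear.linear[OF \<phi>(1)]])
qed

text \<open>The integrand is sampled at the grid points \<open>k / (i + 1)\<close> below \<open>i + 1\<close>; dominated convergence gives
  convergence in \<open>L\<^sup>1\<close>, and the integrals of the samples form a Cauchy sequence.\<close>

lemma bochner_integral_eq_exists:
  fixes f :: "real \<Rightarrow> 'a::banach"
  assumes fin: "finite_measure M" and sets: "sets M = sets (restrict_space borel {0..})"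
    and cont: "continuous_on {0..} f" and bd: "\<And>x. x \<ge> 0 \<Longrightarrow> norm (f x) \<le> B"
  shows "\<exists>y. bochner_integral_eq M f y"
proof -
  interpret finite_measure M by (rule fin)
  have space: "space M = {0..}" using sets_eq_imp_space_eq[OF sets] by (simp add: space_restrict_space)
  have id: "(\<lambda>x. x) \<in> borel_measurable M"
    unfolding measurable_cong_sets[OF sets refl] by (intro measurable_restrict_space1) simp
  note [measurable] = id
  have fmeas: "f \<in> borel_measurable M"
    unfolding measurable_cong_sets[OF sets refl] by (rule borel_measurable_continuous_on_restrict[OF cont])
  have B: "B \<ge> 0" using order_trans[OF norm_ge_zero bd[of 0]] by simp
  define k where "k i x = (if x < real (Suc i) then nat \<lfloor>x * real (Suc i)\<rfloor> else 0)" for i and x :: real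
  define s where "s i x = f (real (k i x) / real (Suc i))" for i x
  have kmeas: "k i \<in> measurable M (count_space UNIV)" for i
    unfolding k_def by measurable
  have kfin: "finite (k i ` space M)" for i
  proof (rule finite_subset)
    show "k i ` space M \<subseteq> {..nat \<lfloor>real (Suc i) * real (Suc i)\<rfloor>}"
      by (auto simp: k_def space intro!: nat_mono floor_mono mult_right_mono)
  qed simp
  have ksimple: "simple_function M (k i)" for i
    unfolding simple_function_def using kfin measurable_sets[OF kmeas] by auto
  have ssimple: "simple_function M (s i)" for i
    using simple_function_compose1[OF ksimple[of i], of "\<lambda>j. f (real j / real (Suc i))"]
    by (simp add: s_def[abs_def] del: of_nat_Suc)
  have sbi: "Bochner_Integration.simple_bochner_integrable M (s i)" for i
    using ssimple emeasure_finite by (intro simple_bochner_integrable.intros) auto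
  have nmeas: "(\<lambda>x. norm (f x - s i x)) \<in> borel_measurable M" for i
    unfolding s_def
  proof (rule measurable_compose_countable'[OF _ kmeas])
    fix j
    have "continuous_on UNIV (\<lambda>z. norm (z - f (real j / real (Suc i))))" by (intro continuous_intros)
    then show "(\<lambda>x. norm (f x - f (real j / real (Suc i)))) \<in> borel_measurable M"
      using measurable_compose[OF fmeas borel_measurable_continuous_onI] by blast
  qed simp
  have sbd: "norm (s i x) \<le> B" for i x unfolding s_def by (rule bd) simp
  have pt: "(\<lambda>i. norm (f x - s i x)) \<longlonglongrightarrow> 0" if x: "x \<ge> 0" for x
  proof -
    have "(\<lambda>i. real (k i x) / real (Suc i)) \<longlonglongrightarrow> x"
    proof (rule LIM_zero_cancel, rule Lim_null_comparison)
      show "(\<lambda>i. 1 / real (Suc i)) \<longlonglongrightarrow> 0" by (rule lim_1_over_n[THEN LIMSEQ_Suc])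
      obtain N where N: "x < real N" using reals_Archimedean2 by blast
      show "\<forall>\<^sub>F i in sequentially. norm (real (k i x) / real (Suc i) - x) \<le> 1 / real (Suc i)"
        using eventually_ge_at_top[of N]
      proof eventually_elim
        case (elim i)
        have "real (k i x) = real_of_int \<lfloor>x * real (Suc i)\<rfloor>" using elim N x by (simp add: k_def)
        then have "\<bar>real (k i x) - x * real (Suc i)\<bar> \<le> 1" by linarith
        moreover have "real (k i x) / real (Suc i) - x = (real (k i x) - x * real (Suc i)) / real (Suc i)"
          by (simp add: diff_divide_distrib del: of_nat_Suc)
        ultimately show ?case by (simp only: real_norm_def abs_divide abs_of_nat) (intro divide_right_mono, auto)
      qed
    qed
    from continuous_on_tendsto_compose[OF cont this] have "(\<lambda>i. s i x) \<longlonglongrightarrow> f x"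
      using x by (simp add: s_def[abs_def] del: of_nat_Suc)
    then show ?thesis using tendsto_norm_zero[OF LIM_zero] by (simp add: norm_minus_commute)
  qed
  have L1: "(\<lambda>i. \<integral>\<^sup>+x. norm (f x - s i x) \<partial>M) \<longlonglongrightarrow> 0"
  proof -
    have "(\<lambda>i. \<integral>\<^sup>+x. ennreal (norm (f x - s i x)) \<partial>M) \<longlonglongrightarrow> (\<integral>\<^sup>+x. 0 \<partial>M)"
    proof (rule nn_integral_dominated_convergence[where w = "\<lambda>_. ennreal (2 * B)"])
      show "AE x in M. ennreal (norm (f x - s i x)) \<le> ennreal (2 * B)" for i
      proof (rule AE_I2, rule ennreal_leI)
        fix x assume "x \<in> space M"
        then show "norm (f x - s i x) \<le> 2 * B"
          using norm_triangle_ineq4[of "f x" "s i x"] bd[of x] sbd[of i x] by (simp add: space)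
      qed
      show "(\<integral>\<^sup>+ x. ennreal (2 * B) \<partial>M) < \<infinity>"
        by (simp add: emeasure_eq_measure ennreal_mult_less_top)
      show "AE x in M. (\<lambda>i. ennreal (norm (f x - s i x))) \<longlonglongrightarrow> 0"
        using pt by (intro AE_I2) (auto simp: space ennreal_0[symmetric] simp del: ennreal_0 intro!: tendsto_ennrealI)
    qed (use nmeas in auto)
    then show ?thesis by simp
  qed
  have bounded: "ennreal (norm (Bochner_Integration.simple_bochner_integral M (s i) - Bochner_Integration.simple_bochner_integral M (s j)))
      \<le> (\<integral>\<^sup>+x. norm (f x - s i x) \<partial>M) + (\<integral>\<^sup>+x. norm (f x - s j x) \<partial>M)" for i j
  proof -
    have "ennreal (norm (Bochner_Integration.simple_bochner_integral M (s i) - Bochner_Integration.simple_bochner_integral M (s j)))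
        = norm (Bochner_Integration.simple_bochner_integral M (\<lambda>x. s i x - s j x))"
      using sbi by (subst simple_bochner_integral_diff) auto
    also have "\<dots> \<le> Bochner_Integration.simple_bochner_integral M (\<lambda>x. norm (s i x - s j x))"
      using simple_bochner_integrable_compose2[of "(-)" M "s i" "s j"] sbi
      by (auto intro!: simple_bochner_integral_norm_bound)
    also have "\<dots> = (\<integral>\<^sup>+x. norm (s i x - s j x) \<partial>M)"
      using simple_bochner_integrable_compose2[of "\<lambda>x y. norm (x - y)" M "s i" "s j"] sbi
      by (auto intro!: simple_bochner_integral_eq_nn_integral)
    also have "\<dots> \<le> (\<integral>\<^sup>+x. ennreal (norm (f x - s i x)) + ennreal (norm (f x - s j x)) \<partial>M)"
    proof (rule nn_integral_mono)
      fix x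
      have "norm (s i x - s j x) \<le> norm (f x - s i x) + norm (f x - s j x)"
        using norm_triangle_ineq4[of "f x - s j x" "f x - s i x"] by simp
      then show "ennreal (norm (s i x - s j x)) \<le> ennreal (norm (f x - s i x)) + ennreal (norm (f x - s j x))"
        by (simp flip: ennreal_plus)
    qed
    also have "\<dots> = (\<integral>\<^sup>+x. norm (f x - s i x) \<partial>M) + (\<integral>\<^sup>+x. norm (f x - s j x) \<partial>M)"
      using nmeas by (intro nn_integral_add) auto
    finally show ?thesis .
  qed
  have "Cauchy (\<lambda>i. Bochner_Integration.simple_bochner_integral M (s i))"
  proof (rule metric_CauchyI)
    fix e :: real assume e: "0 < e"
    then have "\<forall>\<^sub>F i in sequentially. (\<integral>\<^sup>+x. norm (f x - s i x) \<partial>M) < ennreal (e / 2)"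
      by (intro order_tendstoD(2)[OF L1]) auto
    then obtain N where N: "\<And>i. i \<ge> N \<Longrightarrow> (\<integral>\<^sup>+x. norm (f x - s i x) \<partial>M) < ennreal (e / 2)"
      by (auto simp: eventually_sequentially)
    have "dist (Bochner_Integration.simple_bochner_integral M (s i)) (Bochner_Integration.simple_bochner_integral M (s j)) < e"
      if "i \<ge> N" "j \<ge> N" for i j
    proof -
      have "ennreal (norm (Bochner_Integration.simple_bochner_integral M (s i) - Bochner_Integration.simple_bochner_integral M (s j)))
          < ennreal (e / 2) + ennreal (e / 2)"
        using bounded[of i j] add_strict_mono[OF N[OF that(1)] N[OF that(2)]] by (rule le_less_trans)
      also have "\<dots> = ennreal e" using e by (simp flip: ennreal_plus)
      finally show ?thesis using e by (simp add: dist_norm ennreal_less_iff)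
    qed
    then show "\<exists>N. \<forall>i\<ge>N. \<forall>j\<ge>N. dist (Bochner_Integration.simple_bochner_integral M (s i)) (Bochner_Integration.simple_bochner_integral M (s j)) < e"
      by blast
  qed
  then obtain y where "(\<lambda>i. Bochner_Integration.simple_bochner_integral M (s i)) \<longlonglongrightarrow> y"
    using Cauchy_convergent_iff convergent_def by blast
  with fmeas sbi L1 show ?thesis by (auto simp: bochner_integral_eq_def)
qed

text \<open>The first order term integrates to zero because \<open>m\<close> is the mean, so only the remainder contributes
  to the distance between the integral and \<open>a\<close>.\<close>

lemma bochner_integral_norm_le:
  fixes f :: "real \<Rightarrow> 'a::banach"
  assumes f: "bochner_integral_eq M f y" and prob: "prob_space M"
    and mean: "has_bochner_integral M (\<lambda>s. s) m"
    and b: "integrable M b" "\<And>s. s \<in> space M \<Longrightarrow> norm (f s - a - (s - m) *\<^sub>R d) \<le> b s"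
  shows "norm (y - a) \<le> (LINT s|M. b s)"
proof -
  interpret prob_space M by (rule prob)
  obtain \<phi> :: "'a \<Rightarrow> real" where \<phi>: "bounded_linear \<phi>" "\<And>x. \<bar>\<phi> x\<bar> \<le> norm x" "\<phi> (y - a) = norm (y - a)"
    by (rule norming_functional[of "y - a"]) blast
  interpret \<phi>: bounded_linear \<phi> by (rule \<phi>(1))
  have 1: "has_bochner_integral M (\<lambda>s. \<phi> (f s)) (\<phi> y)"
    by (rule bochner_integral_eq_functional[OF f \<phi>(1,2)])
  have "has_bochner_integral M (\<lambda>s. \<phi> a + (s - m) * \<phi> d) (\<phi> a + (m - m) * \<phi> d)"
    by (intro has_bochner_integral_add has_bochner_integral_mult_left has_bochner_integral_diff mean)
       (auto simp: has_bochner_integral_iff prob_space)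
  from has_bochner_integral_diff[OF 1 this]
  have 2: "has_bochner_integral M (\<lambda>s. \<phi> (f s - a - (s - m) *\<^sub>R d)) (\<phi> (y - a))"
    by (simp add: \<phi>.diff \<phi>.add \<phi>.scaleR diff_diff_eq)
  have "\<phi> (y - a) = (LINT s|M. \<phi> (f s - a - (s - m) *\<^sub>R d))"
    using 2 by (simp add: has_bochner_integral_iff)
  also have "\<dots> \<le> (LINT s|M. b s)"
  proof (rule integral_mono)
    show "integrable M (\<lambda>s. \<phi> (f s - a - (s - m) *\<^sub>R d))" using 2 by (simp add: has_bochner_integral_iff)
    fix s assume "s \<in> space M"
    then show "\<phi> (f s - a - (s - m) *\<^sub>R d) \<le> b s"
      using \<phi>(2)[of "f s - a - (s - m) *\<^sub>R d"] b(2)[of s] by linarith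
  qed (rule b(1))
  finally show ?thesis using \<phi>(3) by simp
qed

section \<open>Completely monotone functions\<close>

lemma completely_monotone_deriv:
  "completely_monotone g \<Longrightarrow> z > 0 \<Longrightarrow>
     ((deriv ^^ k) g has_real_derivative (deriv ^^ Suc k) g z) (at z)"
  by (simp add: completely_monotone_def DERIV_deriv_iff_real_differentiable)

lemma completely_monotone_sign:
  "completely_monotone g \<Longrightarrow> z > 0 \<Longrightarrow> 0 \<le> (- 1) ^ k * (deriv ^^ k) g z"
  by (simp add: completely_monotone_def)

text \<open>Complete monotonicity up to order \<open>k\<close>, peeled off one derivative at a time. In this form closure
  under products is an induction based on \<open>- (f * g)' = (- f') * g + (- g') * f\<close>.\<close>

primrec cm_upto :: "nat \<Rightarrow> (real \<Rightarrow> real) \<Rightarrow> bool" where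
  "cm_upto 0 f \<longleftrightarrow> (\<forall>z>0. f z \<ge> 0)"
| "cm_upto (Suc k) f \<longleftrightarrow> (\<forall>z>0. f z \<ge> 0) \<and>
     (\<exists>f'. (\<forall>z>0. (f has_real_derivative f' z) (at z)) \<and> cm_upto k (\<lambda>z. - f' z))"

lemma cm_upto_nonneg: "cm_upto k f \<Longrightarrow> z > 0 \<Longrightarrow> f z \<ge> 0"
  by (cases k) auto

lemma cm_upto_SucE:
  assumes "cm_upto (Suc k) f"
  obtains f' where "\<And>z. z > 0 \<Longrightarrow> (f has_real_derivative f' z) (at z)" "cm_upto k (\<lambda>z. - f' z)"
  using assms unfolding cm_upto.simps by blast

lemma cm_upto_SucI:
  assumes "\<And>z. z > 0 \<Longrightarrow> f z \<ge> 0" "\<And>z. z > 0 \<Longrightarrow> (f has_real_derivative f' z) (at z)"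
    "cm_upto k (\<lambda>z. - f' z)"
  shows "cm_upto (Suc k) f"
  using assms unfolding cm_upto.simps by blast

declare cm_upto.simps(2) [simp del]

lemma cm_upto_mono: "cm_upto (Suc k) f \<Longrightarrow> cm_upto k f"
proof (induction k arbitrary: f)
  case 0
  then show ?case using cm_upto_nonneg by simp
next
  case (Suc k)
  from Suc.prems obtain f' where "\<And>z. z > 0 \<Longrightarrow> (f has_real_derivative f' z) (at z)" "cm_upto (Suc k) (\<lambda>z. - f' z)"
    by (rule cm_upto_SucE) (rule that)
  with Suc.IH cm_upto_nonneg[OF Suc.prems] show ?case by (intro cm_upto_SucI)
qed

lemma cm_upto_cong:
  assumes "cm_upto k f" and eq: "\<And>z. z > 0 \<Longrightarrow> f z = g z"
  shows "cm_upto k g"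
proof (cases k)
  case 0
  with assms show ?thesis by simp
next
  case (Suc j)
  obtain f' where f': "\<And>z. z > 0 \<Longrightarrow> (f has_real_derivative f' z) (at z)" "cm_upto j (\<lambda>z. - f' z)"
    using assms(1)[unfolded Suc] by (rule cm_upto_SucE) (rule that)
  have "(g has_real_derivative f' z) (at z)" if "z > 0" for z
    using has_field_derivative_transform_within_open[OF f'(1)[OF that], of "{0<..}" g] eq that by simp
  moreover have "g z \<ge> 0" if "z > 0" for z using cm_upto_nonneg[OF assms(1) that] eq[OF that] by simp
  ultimately show ?thesis unfolding Suc using f'(2) by (intro cm_upto_SucI)
qed

lemma cm_upto_add: "cm_upto k f \<Longrightarrow> cm_upto k g \<Longrightarrow> cm_upto k (\<lambda>z. f z + g z)"
proof (induction k arbitrary: f g)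
  case (Suc k)
  obtain f' where f': "\<And>z. z > 0 \<Longrightarrow> (f has_real_derivative f' z) (at z)" "cm_upto k (\<lambda>z. - f' z)"
    using Suc.prems(1) by (rule cm_upto_SucE) (rule that)
  obtain g' where g': "\<And>z. z > 0 \<Longrightarrow> (g has_real_derivative g' z) (at z)" "cm_upto k (\<lambda>z. - g' z)"
    using Suc.prems(2) by (rule cm_upto_SucE) (rule that)
  show ?case
  proof (rule cm_upto_SucI)
    show "((\<lambda>z. f z + g z) has_real_derivative (f' z + g' z)) (at z)" if "z > 0" for z
      using that by (intro DERIV_add f'(1) g'(1))
    show "f z + g z \<ge> 0" if "z > 0" for z
      using cm_upto_nonneg[OF Suc.prems(1) that] cm_upto_nonneg[OF Suc.prems(2) that] by simp
    show "cm_upto k (\<lambda>z. - (f' z + g' z))" using Suc.IH[OF f'(2) g'(2)] by simp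
  qed
qed simp

lemma cm_upto_mult: "cm_upto k f \<Longrightarrow> cm_upto k g \<Longrightarrow> cm_upto k (\<lambda>z. f z * g z)"
proof (induction k arbitrary: f g)
  case (Suc k)
  obtain f' where f': "\<And>z. z > 0 \<Longrightarrow> (f has_real_derivative f' z) (at z)" "cm_upto k (\<lambda>z. - f' z)"
    using Suc.prems(1) by (rule cm_upto_SucE) (rule that)
  obtain g' where g': "\<And>z. z > 0 \<Longrightarrow> (g has_real_derivative g' z) (at z)" "cm_upto k (\<lambda>z. - g' z)"
    using Suc.prems(2) by (rule cm_upto_SucE) (rule that)
  show ?case
  proof (rule cm_upto_SucI)
    show "((\<lambda>z. f z * g z) has_real_derivative (f' z * g z + g' z * f z)) (at z)" if "z > 0" for z
      using that by (intro DERIV_mult f'(1) g'(1))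
    show "f z * g z \<ge> 0" if "z > 0" for z
      using cm_upto_nonneg[OF Suc.prems(1) that] cm_upto_nonneg[OF Suc.prems(2) that] by simp
    have "cm_upto k (\<lambda>z. (- f' z) * g z + (- g' z) * f z)"
      by (rule cm_upto_add[OF Suc.IH[OF f'(2) cm_upto_mono[OF Suc.prems(2)]]
                              Suc.IH[OF g'(2) cm_upto_mono[OF Suc.prems(1)]]])
    then show "cm_upto k (\<lambda>z. - (f' z * g z + g' z * f z))" by simp
  qed
qed simp

lemma cm_upto_const: "c \<ge> 0 \<Longrightarrow> cm_upto k (\<lambda>z. c)"
  by (induction k arbitrary: c) (auto intro!: cm_upto_SucI[where f' = "\<lambda>z. 0"])

lemma cm_upto_scale: "cm_upto k f \<Longrightarrow> c > 0 \<Longrightarrow> cm_upto k (\<lambda>z. f (c * z))"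
proof (induction k arbitrary: f)
  case (Suc k)
  obtain f' where f': "\<And>z. z > 0 \<Longrightarrow> (f has_real_derivative f' z) (at z)" "cm_upto k (\<lambda>z. - f' z)"
    using Suc.prems(1) by (rule cm_upto_SucE) (rule that)
  show ?case
  proof (rule cm_upto_SucI)
    show "((\<lambda>z. f (c * z)) has_real_derivative (f' (c * z) * c)) (at z)" if "z > 0" for z
      using that Suc.prems(2) by (intro DERIV_chain2[OF f'(1)]) (auto intro!: derivative_eq_intros)
    show "f (c * z) \<ge> 0" if "z > 0" for z
      using cm_upto_nonneg[OF Suc.prems(1), of "c * z"] Suc.prems(2) that by simp
    have "cm_upto k (\<lambda>z. (- f' (c * z)) * c)"
      using Suc.prems(2) by (intro cm_upto_mult[OF Suc.IH[OF f'(2)] cm_upto_const]) auto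
    then show "cm_upto k (\<lambda>z. - (f' (c * z) * c))" by simp
  qed
qed simp

lemma completely_monotone_imp_cm_upto:
  assumes "completely_monotone f"
  shows "cm_upto k f"
proof -
  have "cm_upto k (\<lambda>z. (- 1) ^ j * (deriv ^^ j) f z)" for j
  proof (induction k arbitrary: j)
    case 0
    then show ?case using completely_monotone_sign[OF assms] by simp
  next
    case (Suc k)
    show ?case
    proof (rule cm_upto_SucI)
      show "((\<lambda>z. (- 1) ^ j * (deriv ^^ j) f z) has_real_derivative ((- 1) ^ j * (deriv ^^ Suc j) f z)) (at z)"
        if "z > 0" for z
        using that by (intro DERIV_cmult completely_monotone_deriv[OF assms])
      show "cm_upto k (\<lambda>z. - ((- 1) ^ j * (deriv ^^ Suc j) f z))"
        using Suc.IH[of "Suc j"] by simp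
    qed (rule completely_monotone_sign[OF assms])
  qed
  from this[of 0] show ?thesis by simp
qed

lemma cm_upto_imp_completely_monotone:
  assumes "\<And>k. cm_upto k f"
  shows "completely_monotone f"
proof -
  have *: "\<forall>k. cm_upto k (\<lambda>z. (- 1) ^ j * (deriv ^^ j) f z)" for j
  proof (induction j)
    case (Suc j)
    show ?case
    proof
      fix k
      obtain f' where f': "\<And>z. z > 0 \<Longrightarrow> ((\<lambda>z. (- 1) ^ j * (deriv ^^ j) f z) has_real_derivative f' z) (at z)"
        "cm_upto k (\<lambda>z. - f' z)" using Suc[rule_format, of "Suc k"] by (rule cm_upto_SucE) (rule that)
      show "cm_upto k (\<lambda>z. (- 1) ^ Suc j * (deriv ^^ Suc j) f z)"
      proof (rule cm_upto_cong[OF f'(2)])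
        fix z :: real assume z: "z > 0"
        have "((\<lambda>z. (- 1) ^ j * ((- 1) ^ j * (deriv ^^ j) f z)) has_real_derivative ((- 1) ^ j * f' z)) (at z)"
          by (intro DERIV_cmult f'(1) z)
        then have "((deriv ^^ j) f has_real_derivative ((- 1) ^ j * f' z)) (at z)"
          by (simp flip: mult.assoc power_add add: mult_2[symmetric])
        then have "deriv ((deriv ^^ j) f) z = (- 1) ^ j * f' z" by (rule DERIV_imp_deriv)
        then show "- f' z = (- 1) ^ Suc j * (deriv ^^ Suc j) f z"
          by (simp flip: mult.assoc power_add add: mult_2[symmetric])
      qed
    qed
  qed (use assms in simp)
  have "(deriv ^^ j) f differentiable at z" if z: "z > 0" for j z
  proof -
    obtain f' where f': "\<And>z. z > 0 \<Longrightarrow> ((\<lambda>z. (- 1) ^ j * (deriv ^^ j) f z) has_real_derivative f' z) (at z)"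
      using *[rule_format, of "Suc 0" j] by (rule cm_upto_SucE) (rule that)
    have "((\<lambda>z. (- 1) ^ j * ((- 1) ^ j * (deriv ^^ j) f z)) has_real_derivative ((- 1) ^ j * f' z)) (at z)"
      by (intro DERIV_cmult f' z)
    then have "((deriv ^^ j) f has_real_derivative ((- 1) ^ j * f' z)) (at z)"
      by (simp flip: mult.assoc power_add add: mult_2[symmetric])
    then show ?thesis using real_differentiable_def by blast
  qed
  then show ?thesis
    using cm_upto_nonneg[OF *[rule_format]] by (auto simp: completely_monotone_def)
qed

lemma completely_monotone_scaled_power:
  assumes g: "completely_monotone g" and c: "c > 0"
  shows "completely_monotone (\<lambda>z. g (c * z) ^ n)"
proof (rule cm_upto_imp_completely_monotone)
  fix k
  have "cm_upto k (\<lambda>z. g (c * z))"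
    by (intro cm_upto_scale completely_monotone_imp_cm_upto g c)
  then show "cm_upto k (\<lambda>z. g (c * z) ^ n)"
    by (induction n) (simp_all add: cm_upto_const cm_upto_mult)
qed


section \<open>Bernstein's theorem\<close>

text \<open>The remainder of order \<open>n\<close> in the Maclaurin expansion of \<open>d 0\<close>, where \<open>d k\<close> is its \<open>k\<close>-th derivative.\<close>

definition maclaurin_rem :: "(nat \<Rightarrow> real \<Rightarrow> real) \<Rightarrow> nat \<Rightarrow> real \<Rightarrow> real" where
  "maclaurin_rem d n w = d 0 w - (\<Sum>k<n. d k 0 / fact k * w ^ k)"

lemma maclaurin_rem_deriv:
  assumes "(d 0 has_real_derivative d (Suc 0) w) (at w)"
  shows "(maclaurin_rem d (Suc n) has_real_derivative maclaurin_rem (\<lambda>k. d (Suc k)) n w) (at w)"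
proof -
  have "((\<lambda>w. d 0 w - (\<Sum>k<Suc n. d k 0 / fact k * w ^ k)) has_real_derivative
      d (Suc 0) w - (\<Sum>k<Suc n. d k 0 / fact k * (real k * w ^ (k - Suc 0)))) (at w)"
    by (intro DERIV_diff DERIV_sum DERIV_cmult DERIV_pow assms)
  also have "(\<Sum>k<Suc n. d k 0 / fact k * (real k * w ^ (k - Suc 0))) = (\<Sum>k<n. d (Suc k) 0 / fact k * w ^ k)"
    by (subst sum.lessThan_Suc_shift) (auto intro!: sum.cong simp: field_simps simp del: of_nat_Suc)
  finally show ?thesis unfolding maclaurin_rem_def[abs_def] .
qed

text \<open>If all derivatives are nonnegative then \<open>R\<^sub>n(w) / w\<^sup>n\<close> is nondecreasing. This is proved by induction on
  \<open>n\<close>, because \<open>R\<^sub>n\<^sub>+\<^sub>1\<close> is the primitive vanishing at 0 of the \<open>n\<close>-th remainder of the derivative. It is the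
  source of the convergence of the Taylor series on the full interval.\<close>

lemma maclaurin_rem_bounds:
  assumes d: "\<And>k w. 0 \<le> w \<Longrightarrow> w < l \<Longrightarrow> (d k has_real_derivative d (Suc k) w) (at w)"
    and nn: "\<And>k w. 0 \<le> w \<Longrightarrow> w < l \<Longrightarrow> d k w \<ge> 0"
    and u: "0 \<le> u" "u < l" and \<theta>: "0 \<le> \<theta>" "\<theta> \<le> 1"
  shows "0 \<le> maclaurin_rem d n u \<and> maclaurin_rem d n (\<theta> * u) \<le> \<theta> ^ n * maclaurin_rem d n u"
  using d nn u
proof (induction n arbitrary: d u)
  case 0
  have \<theta>u: "\<theta> * u \<le> u" "0 \<le> \<theta> * u" using mult_right_mono[OF \<theta>(2) 0(3)] \<theta>(1) 0(3) by auto
  have "d 0 (\<theta> * u) \<le> d 0 u"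
  proof (rule deriv_nonneg_imp_mono[where g = "d 0" and g' = "d (Suc 0)"])
    fix w assume "w \<in> {\<theta> * u..u}"
    then have w: "0 \<le> w" "w < l" using \<theta>u 0(4) by auto
    show "(d 0 has_real_derivative d (Suc 0) w) (at w)" by (rule 0(1)[OF w])
    show "0 \<le> d (Suc 0) w" by (rule 0(2)[OF w])
  qed (rule \<theta>u)
  then show ?case using 0(2)[OF 0(3,4), of 0] by (simp add: maclaurin_rem_def)
next
  case (Suc n)
  let ?R = "maclaurin_rem d (Suc n)" and ?q = "maclaurin_rem (\<lambda>k. d (Suc k)) n"
  have IH: "0 \<le> ?q w \<and> ?q (\<theta> * w) \<le> \<theta> ^ n * ?q w" if "0 \<le> w" "w < l" for w
    using that Suc.prems(1,2) by (intro Suc.IH) auto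
  have R: "(?R has_real_derivative ?q w) (at w)" if "0 \<le> w" "w < l" for w
    using Suc.prems(1)[OF that, of 0] by (intro maclaurin_rem_deriv) simp
  have R0: "?R 0 = 0"
    by (simp add: maclaurin_rem_def sum.lessThan_Suc_shift del: sum.lessThan_Suc)
  have le: "\<theta> * w \<le> w" "0 \<le> \<theta> * w" if "0 \<le> w" for w
    using mult_right_mono[OF \<theta>(2) that] \<theta> that by auto
  have "?R 0 \<le> ?R u"
  proof (rule deriv_nonneg_imp_mono[where g = ?R and g' = ?q])
    fix w assume "w \<in> {0..u}"
    then have w: "0 \<le> w" "w < l" using Suc.prems(4) by auto
    show "(?R has_real_derivative ?q w) (at w)" by (rule R[OF w])
    show "0 \<le> ?q w" using IH[OF w] by blast
  qed (rule Suc.prems(3))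
  moreover have "\<theta> ^ Suc n * ?R 0 - ?R (\<theta> * 0) \<le> \<theta> ^ Suc n * ?R u - ?R (\<theta> * u)"
  proof (rule DERIV_nonneg_imp_nondecreasing[OF Suc.prems(3)])
    fix w assume w: "0 \<le> w" "w \<le> u"
    then have wl: "w < l" "\<theta> * w < l" using Suc.prems(4) le[OF w(1)] by auto
    have "((\<lambda>w. \<theta> ^ Suc n * ?R w - ?R (\<theta> * w)) has_real_derivative
        (\<theta> ^ Suc n * ?q w - ?q (\<theta> * w) * \<theta>)) (at w)"
      using w wl le[OF w(1)]
      by (intro DERIV_diff DERIV_cmult R DERIV_chain2[OF R]) (auto intro!: derivative_eq_intros)
    moreover have "\<theta> ^ Suc n * ?q w - ?q (\<theta> * w) * \<theta> \<ge> 0"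
      using mult_left_mono[OF conjunct2[OF IH[OF w(1) wl(1)]] \<theta>(1)] by (simp add: mult_ac)
    ultimately show "\<exists>y. ((\<lambda>w. \<theta> ^ Suc n * ?R w - ?R (\<theta> * w)) has_real_derivative y) (at w) \<and> 0 \<le> y"
      by blast
  qed
  ultimately show ?case by (simp add: R0)
qed

lemma maclaurin_sums:
  assumes d: "\<And>k w. 0 \<le> w \<Longrightarrow> w < l \<Longrightarrow> (d k has_real_derivative d (Suc k) w) (at w)"
    and nn: "\<And>k w. 0 \<le> w \<Longrightarrow> w < l \<Longrightarrow> d k w \<ge> (0::real)"
    and w: "0 \<le> w" "w < l"
  shows "(\<lambda>k. d k 0 / fact k * w ^ k) sums d 0 w"
proof -
  define u where "u = (w + l) / 2"
  have u: "0 < u" "u < l" "w < u" using w by (auto simp: u_def)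
  define \<theta> where "\<theta> = w / u"
  have \<theta>: "0 \<le> \<theta>" "\<theta> < 1" "\<theta> * u = w" using u w by (auto simp: \<theta>_def)
  have "(\<lambda>n. maclaurin_rem d n w) \<longlonglongrightarrow> 0"
  proof (rule tendsto_sandwich)
    have "0 \<le> maclaurin_rem d n w" for n
      using maclaurin_rem_bounds[of l d w 0 n, OF d nn w] by simp
    then show "\<forall>\<^sub>F n in sequentially. 0 \<le> maclaurin_rem d n w" by simp
    have "maclaurin_rem d n w \<le> \<theta> ^ n * d 0 u" for n
    proof -
      have "maclaurin_rem d n w \<le> \<theta> ^ n * maclaurin_rem d n u"
        using maclaurin_rem_bounds[of l d u \<theta> n, OF d nn] u \<theta> by auto
      also have "(\<Sum>k<n. d k 0 / fact k * u ^ k) \<ge> 0"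
        using u nn[of 0] by (intro sum_nonneg mult_nonneg_nonneg divide_nonneg_nonneg) auto
      then have "\<theta> ^ n * maclaurin_rem d n u \<le> \<theta> ^ n * d 0 u"
        using \<theta> by (intro mult_left_mono) (auto simp: maclaurin_rem_def)
      finally show ?thesis .
    qed
    then show "\<forall>\<^sub>F n in sequentially. maclaurin_rem d n w \<le> \<theta> ^ n * d 0 u" by simp
    show "(\<lambda>n. \<theta> ^ n * d 0 u) \<longlonglongrightarrow> 0"
      using \<theta> by (auto intro!: tendsto_mult_left_zero LIMSEQ_realpow_zero)
  qed simp
  then have "(\<lambda>n. d 0 w - maclaurin_rem d n w) \<longlonglongrightarrow> d 0 w - 0" by (intro tendsto_intros)
  then show ?thesis by (simp add: sums_def maclaurin_rem_def)
qed

context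
  fixes h :: "real \<Rightarrow> real"
  assumes cm: "completely_monotone h" and h0: "(h \<longlongrightarrow> 1) (at_right 0)"
begin

lemma cm_has_deriv: "z > 0 \<Longrightarrow> (h has_real_derivative deriv h z) (at z)"
  using completely_monotone_deriv[OF cm, of z 0] by simp

lemma cm_antimono: assumes "0 < x" "x \<le> y" shows "h y \<le> h x"
proof (rule DERIV_nonpos_imp_nonincreasing[OF assms(2)])
  fix w assume "x \<le> w" "w \<le> y"
  with assms have "w > 0" by simp
  then show "\<exists>D. (h has_real_derivative D) (at w) \<and> D \<le> 0"
    using cm_has_deriv[of w] completely_monotone_sign[OF cm, of w 1] by (intro exI[of _ "deriv h w"]) auto
qed

lemma cm_le_1: assumes "x > 0" shows "h x \<le> 1"
proof (rule tendsto_lowerbound[OF h0])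
  show "\<forall>\<^sub>F z in at_right 0. h x \<le> h z"
    using eventually_at_right_real[OF assms] by eventually_elim (use cm_antimono in auto)
qed simp

text \<open>Expanding \<open>h\<close> about \<open>l\<close> gives \<open>h(l - w) = \<Sum>k. c\<^sub>k w\<^sup>k\<close> with nonnegative \<open>c\<^sub>k\<close>. For \<open>w = l exp(- z / l)\<close> the series is
  the Laplace transform, at \<open>z\<close>, of the measure with mass \<open>c\<^sub>k l\<^sup>k\<close> at \<open>k / l\<close>, whose total mass is \<open>h(0+) = 1\<close>.
  As \<open>l\<close> grows, \<open>l (1 - exp(- z / l))\<close> tends to \<open>z\<close>. The maximum with 0 makes the integrand a bounded
  continuous function on the whole line.\<close>

lemma bernstein_approximant:
  assumes l: "l > 0"
  shows "\<exists>\<mu>. real_distribution \<mu> \<and> emeasure \<mu> {..<0} = 0 \<and>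
    (\<forall>z>0. (LINT x|\<mu>. exp (- (z * max 0 x))) = h (l * (1 - exp (- z / l))))"
proof -
  define d where "d k w = (- 1) ^ k * (deriv ^^ k) h (l - w)" for k w
  have d: "(d k has_real_derivative d (Suc k) w) (at w)" if "w < l" for k w
  proof -
    have "((\<lambda>w. (- 1) ^ k * (deriv ^^ k) h (l - w)) has_real_derivative
        (- 1) ^ k * ((deriv ^^ Suc k) h (l - w) * (- 1))) (at w)"
      using that
      by (intro DERIV_cmult DERIV_chain2[OF completely_monotone_deriv[OF cm]])
         (auto intro!: derivative_eq_intros)
    then show ?thesis by (simp add: d_def[abs_def])
  qed
  have nn: "d k w \<ge> 0" if "w < l" for k w
    unfolding d_def using that by (intro completely_monotone_sign[OF cm]) auto
  define c where "c k = d k 0 / fact k" for k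
  have c: "c k \<ge> 0" for k unfolding c_def using nn[of 0] l by simp
  have sums: "(\<lambda>k. c k * w ^ k) sums h (l - w)" if "0 \<le> w" "w < l" for w
    using maclaurin_sums[of l d w] d nn that by (simp add: c_def d_def)
  define p where "p k = c k * l ^ k" for k
  have p: "p k \<ge> 0" for k using c[of k] l by (simp add: p_def)
  have partial: "(\<Sum>k<n. p k) \<le> 1" for n
  proof -
    have "((\<lambda>w. \<Sum>k<n. c k * w ^ k) \<longlongrightarrow> (\<Sum>k<n. c k * l ^ k)) (at_left l)"
      by (intro tendsto_intros)
    moreover have "\<forall>\<^sub>F w in at_left l. (\<Sum>k<n. c k * w ^ k) \<le> 1"
      using eventually_at_left_real[OF l]
    proof eventually_elim
      case (elim w)
      then have "(\<Sum>k<n. c k * w ^ k) \<le> h (l - w)"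
        using sums[of w] c by (subst sums_unique[OF sums]) (auto intro!: sum_le_suminf sums_summable)
      also have "\<dots> \<le> 1" using elim by (intro cm_le_1) auto
      finally show ?case .
    qed
    ultimately show ?thesis unfolding p_def by (rule tendsto_upperbound) simp
  qed
  have summ: "summable p" by (rule summableI_nonneg_bounded[OF p partial])
  have sum_le: "suminf p \<le> 1" by (rule suminf_le_const[OF summ partial])
  have "suminf p \<ge> 1"
  proof (rule tendsto_upperbound[OF h0])
    show "\<forall>\<^sub>F z in at_right 0. h z \<le> suminf p"
      using eventually_at_right_real[OF l]
    proof eventually_elim
      case (elim z)
      have "h (l - (l - z)) = (\<Sum>k. c k * (l - z) ^ k)"
        using elim by (intro sums_unique sums) auto
      also have "\<dots> \<le> suminf p"
        using elim sums[of "l - z"] c summ unfolding p_def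
        by (intro suminf_le mult_left_mono power_mono) (auto intro: sums_summable)
      finally show ?case by simp
    qed
  qed simp
  with sum_le have p1: "suminf p = 1" by simp
  define P where "P = embed_pmf p"
  have pmf: "pmf P k = p k" for k
    unfolding P_def
  proof (rule pmf_embed_pmf)
    show "(\<integral>\<^sup>+x. ennreal (p x) \<partial>count_space UNIV) = 1"
      using p summ by (simp add: nn_integral_count_space_nat suminf_ennreal2 p1)
  qed (rule p)
  define \<mu> where "\<mu> = distr (measure_pmf P) borel (\<lambda>k. real k / l)"
  have "real_distribution \<mu>"
    unfolding \<mu>_def by (intro prob_space.real_distribution_distr[OF prob_space_measure_pmf]) simp
  moreover have "emeasure \<mu> {..<0} = 0"
  proof -
    have "(\<lambda>k. real k / l) -` {..<0} = {}" using l by (auto simp: field_simps not_less)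
    then show ?thesis unfolding \<mu>_def by (subst emeasure_distr) auto
  qed
  moreover have "(LINT x|\<mu>. exp (- (z * max 0 x))) = h (l * (1 - exp (- z / l)))" if z: "z > 0" for z
  proof -
    define w where "w = l * exp (- z / l)"
    have w: "0 \<le> w" "w < l" using l z by (auto simp: w_def)
    have eq: "p k * exp (- (z * max 0 (real k / l))) = c k * w ^ k" for k
      using l by (simp add: p_def w_def power_mult_distrib exp_of_nat_mult[symmetric] max_def)
    have "(\<integral>\<^sup>+k. ennreal (exp (- (z * max 0 (real k / l)))) \<partial>measure_pmf P)
        = (\<Sum>k. ennreal (c k * w ^ k))"
      using p by (simp add: nn_integral_measure_pmf nn_integral_count_space_nat pmf
          eq[symmetric] ennreal_mult)
    also have "\<dots> = ennreal (h (l - w))"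
      using sums[OF w] c w by (intro suminf_ennreal_eq) auto
    finally have "(LINT k|measure_pmf P. exp (- (z * max 0 (real k / l)))) = h (l - w)"
      using w completely_monotone_sign[OF cm, of "l - w" 0] by (intro integral_eq_nn_integral[THEN trans]) auto
    then show ?thesis
      unfolding \<mu>_def by (subst integral_distr) (auto simp: w_def algebra_simps)
  qed
  ultimately show ?thesis by blast
qed

text \<open>The approximating measures are tight, because their Laplace transforms are bounded below by \<open>h\<close>,
  which is close to 1 near 0. A weak limit of a subsequence represents \<open>h\<close>.\<close>

lemma bernstein_exists: "\<exists>\<nu>. represents \<nu> h"
proof -
  define l where "l n = real (Suc n)" for n
  have l: "l n > 0" for n by (simp add: l_def)
  obtain \<mu> where \<mu>: "\<And>n. real_distribution (\<mu> n)" "\<And>n. emeasure (\<mu> n) {..<0} = 0"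
    and lap: "\<And>n z. z > 0 \<Longrightarrow> (LINT x|\<mu> n. exp (- (z * max 0 x))) = h (l n * (1 - exp (- z / l n)))"
    using bernstein_approximant[OF l] by metis
  have lap_ge: "h z \<le> (LINT x|\<mu> n. exp (- (z * max 0 x)))" if "z > 0" for n z
  proof -
    have "1 - z / l n \<le> exp (- (z / l n))" using exp_ge_add_one_self[of "- (z / l n)"] by simp
    then have "l n * (1 - exp (- z / l n)) \<le> z" using l[of n] by (simp add: field_simps)
    moreover have "l n * (1 - exp (- z / l n)) > 0" using l[of n] that by simp
    ultimately show ?thesis using lap[OF that] cm_antimono by simp
  qed
  have tight: "tight \<mu>"
    unfolding tight_def
  proof (intro conjI allI impI \<mu>(1))
    fix e :: real assume e: "e > 0"
    have "\<forall>\<^sub>F z in at_right 0. h z > 1 - e / 2" using h0 e by (intro order_tendstoD(1)) auto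
    then have "\<forall>\<^sub>F z in at_right 0. h z > 1 - e / 2 \<and> z > 0"
      using eventually_at_right_less by (rule eventually_conj)
    then obtain z where z: "h z > 1 - e / 2" "z > 0"
      using eventually_happens'[of "at_right (0::real)"] by auto
    have "1 - e < measure (\<mu> n) {-1<..1 / z}" for n
    proof -
      interpret real_distribution "\<mu> n" by (rule \<mu>(1))
      have half: "exp (-1) \<le> (1 / 2 :: real)"
        using exp_ge_add_one_self[of "1::real"] by (simp add: exp_minus field_simps)
      have "h z \<le> (LINT x|\<mu> n. exp (- (z * max 0 x)))" by (rule lap_ge[OF z(2)])
      \<comment> \<open>At least half of the mass beyond \<open>1 / z\<close> is missing from the transform at \<open>z\<close>, as \<open>exp (- 1) \<le> 1 / 2\<close>.\<close>
      also have "\<dots> \<le> (LINT x|\<mu> n. indicator {..1 / z} x + (1 / 2 :: real) * indicator {1 / z<..} x)"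
      proof (rule integral_mono)
        show "integrable (\<mu> n) (\<lambda>x. exp (- (z * max 0 x)))"
          using z by (intro integrable_const_bound[where B = 1]) (auto simp: mult_nonneg_nonneg)
        show "integrable (\<mu> n) (\<lambda>x. indicator {..1 / z} x + (1 / 2 :: real) * indicator {1 / z<..} x)"
          by (intro integrable_const_bound[where B = 1]) (auto simp: indicator_def)
        fix x
        have "exp (- (z * x)) \<le> 1 / 2" if "1 / z < x"
        proof -
          have "exp (- (z * x)) \<le> exp (-1)" using that z by (simp add: field_simps)
          then show ?thesis using half by (rule order_trans)
        qed
        moreover have "0 \<le> x" if "1 / z < x"
          using less_trans[OF divide_pos_pos[OF zero_less_one z(2)] that] by simp
        ultimately show "exp (- (z * max 0 x)) \<le> indicator {..1 / z} x + (1 / 2 :: real) * indicator {1 / z<..} x"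
          using z by (auto simp: indicator_def max_def mult_nonneg_nonneg)
      qed
      also have "\<dots> = prob {..1 / z} + 1 / 2 * prob {1 / z<..}"
      proof -
        have "integrable (\<mu> n) (indicator {..1 / z} :: real \<Rightarrow> real)"
          "integrable (\<mu> n) (indicator {1 / z<..} :: real \<Rightarrow> real)"
          by (auto intro!: integrable_real_indicator simp: emeasure_eq_measure)
        then show ?thesis by (subst Bochner_Integration.integral_add) auto
      qed
      also have "prob {1 / z<..} = 1 - prob {..1 / z}"
        using prob_compl[of "{..1 / z}"] by (simp add: Compl_atMost[symmetric] Compl_eq_Diff_UNIV)
      finally have "1 - e < prob {..1 / z}" using z(1) by (simp add: field_simps)
      also have "prob {..1 / z} \<le> prob ({..<0} \<union> {-1<..1 / z})"
        by (intro finite_measure_mono) auto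
      also have "\<dots> \<le> prob {..<0} + prob {-1<..1 / z}"
        by (intro measure_Un_le) auto
      also have "prob {..<0} = 0" using \<mu>(2)[of n] by (simp add: measure_def)
      finally show ?thesis by simp
    qed
    moreover have "-1 < 1 / z" using z by (simp add: less_divide_eq)
    ultimately show "\<exists>a b. a < b \<and> (\<forall>n. 1 - e < measure (\<mu> n) {a<..b})" by blast
  qed
  obtain r M where r: "strict_mono (r :: nat \<Rightarrow> nat)" and M: "real_distribution M"
    and conv: "weak_conv_m (\<mu> \<circ> id \<circ> r) M"
    using tight_imp_convergent_subsubsequence[OF tight strict_mono_id] by blast
  interpret M: real_distribution M by (rule M)
  have lim: "(\<lambda>n. LINT x|\<mu> (r n). f x) \<longlonglongrightarrow> (LINT x|M. f x)"
    if "\<And>x. isCont f x" "\<And>x. norm (f x) \<le> B" for f :: "real \<Rightarrow> real" and B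
    using weak_conv_imp_integral_bdd_continuous_conv[of "\<mu> \<circ> id \<circ> r" M f B] \<mu>(1) M conv that by simp
  have lapM: "(LINT x|M. exp (- (z * max 0 x))) = h z" if z: "z > 0" for z
  proof (rule LIMSEQ_unique[OF lim])
    have "((\<lambda>l. l * (1 - exp (- z / l))) \<longlongrightarrow> z) at_top" by real_asymp
    moreover have "filterlim (\<lambda>n. l (r n)) at_top sequentially"
      unfolding l_def using filterlim_subseq[OF r]
      by (intro filterlim_compose[OF filterlim_real_sequentially] filterlim_compose[OF filterlim_Suc])
    ultimately have "(\<lambda>n. l (r n) * (1 - exp (- z / l (r n)))) \<longlonglongrightarrow> z"
      by (rule filterlim_compose)
    moreover have "isCont h z" using cm_has_deriv[OF z] by (rule DERIV_isCont)
    ultimately have "(\<lambda>n. h (l (r n) * (1 - exp (- z / l (r n))))) \<longlonglongrightarrow> h z"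
      using isCont_tendsto_compose by blast
    then show "(\<lambda>n. LINT x|\<mu> (r n). exp (- (z * max 0 x))) \<longlonglongrightarrow> h z"
      by (simp add: lap[OF z])
    show "isCont (\<lambda>x. exp (- (z * max 0 x))) x" for x by (intro continuous_intros)
    show "norm (exp (- (z * max 0 x))) \<le> 1" for x using z by (simp add: mult_nonneg_nonneg)
  qed
  have AE: "AE x in M. x \<ge> 0"
  proof -
    define q where "q x = min 1 (max 0 (- x))" for x :: real
    have cont: "isCont q x" for x unfolding q_def by (intro continuous_intros)
    have qM: "q \<in> borel_measurable M"
      unfolding q_def by measurable
    have "(LINT x|\<mu> (r n). q x) = (LINT x|\<mu> (r n). 0)" for n
    proof (rule integral_cong_AE)
      interpret real_distribution "\<mu> (r n)" by (rule \<mu>(1))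
      show "AE x in \<mu> (r n). q x = 0"
        using \<mu>(2)[of "r n"] by (intro AE_I[where N = "{..<0}"]) (auto simp: q_def not_le)
      show "q \<in> borel_measurable (\<mu> (r n))" unfolding q_def by measurable
    qed simp
    then have "(LINT x|M. q x) = 0"
      using lim[of q 1] cont by (auto simp: q_def LIMSEQ_const_iff)
    moreover have "integrable M q"
      by (intro M.integrable_const_bound[where B = 1] qM) (simp add: q_def)
    ultimately have "AE x in M. q x = 0"
      by (subst (asm) integral_nonneg_eq_0_iff_AE) (auto simp: q_def)
    then show ?thesis by eventually_elim (auto simp: q_def min_def max_def split: if_splits)
  qed
  have "represents (restrict_space M {0..}) h"
    unfolding represents_def
  proof (intro conjI allI impI)
    show "sets (restrict_space M {0..}) = sets (restrict_space borel {0..})"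
      by (intro sets_restrict_space_cong) simp
    fix z :: real assume z: "z > 0"
    have "has_bochner_integral M (\<lambda>x. exp (- (z * max 0 x))) (h z)"
      using z by (auto simp: has_bochner_integral_iff lapM mult_nonneg_nonneg
          intro!: M.integrable_const_bound[where B = 1])
    moreover have "AE x in M. exp (- (z * max 0 x)) = indicator {0..} x *\<^sub>R exp (- (z * x))"
      using AE by eventually_elim auto
    ultimately have "has_bochner_integral M (\<lambda>x. indicator {0..} x *\<^sub>R exp (- (z * x))) (h z)"
      by (subst has_bochner_integral_cong_AE[symmetric]) auto
    then show "has_bochner_integral (restrict_space M {0..}) (\<lambda>s. exp (- (z * s))) (h z)"
      by (subst has_bochner_integral_restrict_space) auto
  qed
  then show ?thesis by blast
qed

end

section \<open>Moments of a representing measure\<close>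

text \<open>\<open>(- 1)\<^sup>k g\<^sup>(\<^sup>k\<^sup>)\<close> is nonnegative and nonincreasing, so the limit at 0 exists in the extended reals.\<close>

lemma completely_monotone_limit:
  assumes g: "completely_monotone g"
  shows "((\<lambda>z. ereal ((deriv ^^ k) g z)) \<longlongrightarrow> deriv_at_zero k g) (at_right 0)"
    and "even k \<Longrightarrow> deriv_at_zero k g \<ge> 0"
proof -
  define f where "f z = (- 1) ^ k * (deriv ^^ k) g z" for z
  define S where "S = (SUP z\<in>{0<..}. ereal (f z))"
  have mono: "f y \<le> f x" if "0 < x" "x \<le> y" for x y
  proof (rule DERIV_nonpos_imp_nonincreasing[OF that(2)])
    fix z assume "x \<le> z" "z \<le> y"
    then have z: "z > 0" using that by simp
    have "(f has_real_derivative ((- 1) ^ k * (deriv ^^ Suc k) g z)) (at z)"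
      unfolding f_def[abs_def] by (intro DERIV_cmult completely_monotone_deriv[OF g z])
    moreover have "(- 1) ^ k * (deriv ^^ Suc k) g z \<le> 0"
      using completely_monotone_sign[OF g z, of "Suc k"] by simp
    ultimately show "\<exists>D. (f has_real_derivative D) (at z) \<and> D \<le> 0" by blast
  qed
  have f: "((\<lambda>z. ereal (f z)) \<longlongrightarrow> S) (at_right 0)"
  proof (rule order_tendstoI)
    fix a assume "a < S"
    then obtain z where z: "z > 0" "a < ereal (f z)" by (auto simp: S_def less_SUP_iff)
    show "\<forall>\<^sub>F x in at_right 0. a < ereal (f x)"
      using eventually_at_right_real[OF z(1)]
    proof eventually_elim
      case (elim x)
      then have "ereal (f z) \<le> ereal (f x)" using mono by simp
      with z(2) show ?case by (rule less_le_trans)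
    qed
  next
    fix a assume a: "S < a"
    show "\<forall>\<^sub>F x in at_right 0. ereal (f x) < a"
      using eventually_at_right_less
    proof eventually_elim
      case (elim x)
      then have "ereal (f x) \<le> S" unfolding S_def by (intro SUP_upper) auto
      then show ?case using a by (rule le_less_trans)
    qed
  qed
  have S: "S \<ge> 0"
  proof -
    have "0 \<le> ereal (f 1)" unfolding f_def using completely_monotone_sign[OF g, of 1 k] by simp
    also have "\<dots> \<le> S" unfolding S_def by (intro SUP_upper) auto
    finally show ?thesis .
  qed
  have "\<exists>L. ((\<lambda>z. ereal ((deriv ^^ k) g z)) \<longlongrightarrow> L) (at_right 0) \<and> (even k \<longrightarrow> L \<ge> 0)"
  proof (cases "even k")
    case True
    then show ?thesis using f S by (intro exI[of _ S]) (simp add: f_def)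
  next
    case False
    then show ?thesis using tendsto_uminus_ereal[OF f] by (intro exI[of _ "- S"]) (simp add: f_def)
  qed
  then obtain L where L: "((\<lambda>z. ereal ((deriv ^^ k) g z)) \<longlongrightarrow> L) (at_right 0)" "even k \<longrightarrow> L \<ge> 0"
    by blast
  then have "deriv_at_zero k g = L" unfolding deriv_at_zero_def by (intro tendsto_Lim) auto
  with L show "((\<lambda>z. ereal ((deriv ^^ k) g z)) \<longlongrightarrow> deriv_at_zero k g) (at_right 0)"
    "even k \<Longrightarrow> deriv_at_zero k g \<ge> 0" by auto
qed

text \<open>Fatou's lemma, stated for real-valued integrands.\<close>

lemma integrable_limit:
  fixes u :: "nat \<Rightarrow> 'b \<Rightarrow> real"
  assumes u: "\<And>n. has_bochner_integral M (u n) (I n)" and nn: "\<And>n x. x \<in> space M \<Longrightarrow> 0 \<le> u n x"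
    and lim: "\<And>x. x \<in> space M \<Longrightarrow> (\<lambda>n. u n x) \<longlonglongrightarrow> v x" and I: "I \<longlonglongrightarrow> L"
  shows "integrable M v" "(LINT x|M. v x) \<le> L"
proof -
  have [measurable]: "u n \<in> borel_measurable M" for n using u by (rule borel_measurable_has_bochner_integral)
  have [measurable]: "v \<in> borel_measurable M" by (rule borel_measurable_LIMSEQ_real[OF lim]) auto
  have vnn: "0 \<le> v x" if "x \<in> space M" for x
    by (rule LIMSEQ_le_const[OF lim[OF that]]) (use nn[OF that] in auto)
  have L: "L \<ge> 0"
  proof (rule LIMSEQ_le_const[OF I])
    have "0 \<le> I n" for n
    proof -
      have "0 \<le> (LINT x|M. u n x)" by (rule integral_nonneg_AE) (simp add: nn)
      then show ?thesis using u[of n] by (simp add: has_bochner_integral_iff)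
    qed
    then show "\<exists>N. \<forall>n\<ge>N. 0 \<le> I n" by blast
  qed
  have "(\<integral>\<^sup>+x. ennreal (v x) \<partial>M) = (\<integral>\<^sup>+x. liminf (\<lambda>n. ennreal (u n x)) \<partial>M)"
    by (intro nn_integral_cong lim_imp_Liminf[symmetric] tendsto_ennrealI lim) auto
  also have "\<dots> \<le> liminf (\<lambda>n. \<integral>\<^sup>+x. ennreal (u n x) \<partial>M)" by (rule nn_integral_liminf) auto
  also have "(\<lambda>n. \<integral>\<^sup>+x. ennreal (u n x) \<partial>M) = (\<lambda>n. ennreal (I n))"
    using u nn by (simp add: has_bochner_integral_iff nn_integral_eq_integral)
  also have "liminf (\<lambda>n. ennreal (I n)) = ennreal L"
    by (intro lim_imp_Liminf tendsto_ennrealI I) auto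
  finally have le: "(\<integral>\<^sup>+x. ennreal (v x) \<partial>M) \<le> ennreal L" .
  have norm: "(\<integral>\<^sup>+x. ennreal (norm (v x)) \<partial>M) = (\<integral>\<^sup>+x. ennreal (v x) \<partial>M)"
    by (intro nn_integral_cong) (simp add: vnn)
  show int: "integrable M v"
  proof (rule integrableI_bounded)
    show "(\<integral>\<^sup>+x. ennreal (norm (v x)) \<partial>M) < \<infinity>" unfolding norm using le by (rule le_less_trans) simp
  qed auto
  have "ennreal (LINT x|M. v x) \<le> ennreal L"
    using le int vnn by (subst nn_integral_eq_integral[symmetric]) auto
  then show "(LINT x|M. v x) \<le> L" using L by (simp add: ennreal_le_iff)
qed

text \<open>The derivatives of the Laplace transform at 0 are the moments up to sign. The mean must be exact, but
  for the variance an upper bound is enough, and Fatou's lemma provides it.\<close>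

lemma representing_measure_moments:
  fixes h h1 h2 :: "real \<Rightarrow> real"
  assumes rep: "represents \<nu> h"
    and h1: "\<And>z. z > 0 \<Longrightarrow> (h has_real_derivative h1 z) (at z)"
    and h2: "\<And>z. z > 0 \<Longrightarrow> (h1 has_real_derivative h2 z) (at z)"
    and lim: "(h \<longlongrightarrow> 1) (at_right 0)" "(h1 \<longlongrightarrow> - m) (at_right 0)" "(h2 \<longlongrightarrow> v) (at_right 0)"
  shows "prob_space \<nu>" "has_bochner_integral \<nu> (\<lambda>s. s) m"
    "integrable \<nu> (\<lambda>s. (s - m)\<^sup>2)" "(LINT s|\<nu>. (s - m)\<^sup>2) \<le> v - m\<^sup>2"
proof -
  have space: "space \<nu> = {0..}"
    using rep sets_eq_imp_space_eq[of \<nu> "restrict_space borel {0..}"]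
    by (simp add: represents_def space_restrict_space)
  have lap: "has_bochner_integral \<nu> (\<lambda>s. exp (- (z * s))) (h z)" if "z > 0" for z
    using rep that by (simp add: represents_def)
  have id_meas: "(\<lambda>s. s) \<in> borel_measurable \<nu>"
    using rep by (subst measurable_cong_sets[of \<nu> "restrict_space borel {0..}" borel borel])
      (auto simp: represents_def intro!: measurable_restrict_space1)
  define d where "d n = inverse (real (Suc n))" for n
  have d: "d n > 0" for n by (simp add: d_def)
  have dlim: "filterlim d (at_right 0) sequentially"
    unfolding filterlim_at d_def using LIMSEQ_inverse_real_of_nat by auto
  have seq: "(\<lambda>n. f (d n)) \<longlonglongrightarrow> l" if "(f \<longlongrightarrow> l) (at_right 0)" for f :: "real \<Rightarrow> real" and l
    using filterlim_compose[OF that dlim] .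
  \<comment> \<open>Fatou along \<open>d n\<close> gives finite mass, and then constants are dominating functions.\<close>
  have e_lim: "(\<lambda>n. exp (- (d n * s))) \<longlonglongrightarrow> 1" for s
    by (rule seq) (auto intro!: tendsto_eq_intros)
  have int1: "integrable \<nu> (\<lambda>s. 1 :: real)"
    by (rule integrable_limit(1)[OF lap[OF d] _ e_lim seq[OF lim(1)]]) auto
  have "(\<lambda>n. LINT s|\<nu>. exp (- (d n * s))) \<longlonglongrightarrow> (LINT s|\<nu>. 1)"
  proof (rule integral_dominated_convergence[where w = "\<lambda>_. 1"])
    show "AE s in \<nu>. (\<lambda>n. exp (- (d n * s))) \<longlonglongrightarrow> 1" by (rule AE_I2) (rule e_lim)
    show "AE s in \<nu>. norm (exp (- (d n * s))) \<le> 1" for n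
      by (rule AE_I2) (use d[of n] in \<open>auto simp: space\<close>)
    show "(\<lambda>s. exp (- (d n * s))) \<in> borel_measurable \<nu>" for n
      by (rule borel_measurable_has_bochner_integral[OF lap[OF d]])
  qed (use int1 in simp_all)
  moreover have "(LINT s|\<nu>. exp (- (d n * s))) = h (d n)" for n
    using lap[OF d] by (rule has_bochner_integral_integral_eq)
  ultimately have one: "(LINT s|\<nu>. 1) = (1 :: real)"
    using LIMSEQ_unique[OF _ seq[OF lim(1)]] by simp
  have fin: "finite_measure \<nu>"
  proof (rule finite_measureI)
    have "(\<integral>\<^sup>+s. ennreal (norm (1 :: real)) \<partial>\<nu>) < \<infinity>" using int1 unfolding integrable_iff_bounded by blast
    then show "emeasure \<nu> (space \<nu>) \<noteq> \<infinity>" by simp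
  qed
  interpret finite_measure \<nu> by (rule fin)
  show prob: "prob_space \<nu>"
    using one by (intro prob_spaceI) (simp add: emeasure_eq_measure)
  interpret prob_space \<nu> by (rule prob)
  have const: "has_bochner_integral \<nu> (\<lambda>s. c) c" for c :: real
    by (simp add: has_bochner_integral_iff prob_space)
  \<comment> \<open>Fatou for the difference quotients of \<open>exp (- z s)\<close> at 0 gives integrability of \<open>s\<close>, and
    the quotients are dominated by \<open>s\<close>.\<close>
  have f_int: "has_bochner_integral \<nu> (\<lambda>s. (1 - exp (- (d n * s))) / d n) ((1 - h (d n)) / d n)" for n
    by (intro has_bochner_integral_divide_zero has_bochner_integral_diff const lap d)
  have f_lim: "(\<lambda>n. (1 - exp (- (d n * s))) / d n) \<longlonglongrightarrow> s" for s
  proof (rule seq, rule lhopital_right_0)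
    show "((\<lambda>x. 1 - exp (- (x * s))) \<longlongrightarrow> 0) (at_right 0)" by (auto intro!: tendsto_eq_intros)
    show "\<forall>\<^sub>F x in at_right 0. ((\<lambda>x. 1 - exp (- (x * s))) has_real_derivative s * exp (- (x * s))) (at x)"
      by (auto intro!: always_eventually derivative_eq_intros)
    show "((\<lambda>x. s * exp (- (x * s)) / 1) \<longlongrightarrow> s) (at_right 0)" by (auto intro!: tendsto_eq_intros)
  qed (auto intro!: always_eventually derivative_eq_intros simp: eventually_at_filter)
  have h_lim1: "((\<lambda>z. (1 - h z) / z) \<longlongrightarrow> m) (at_right 0)"
  proof (rule lhopital_right_0)
    show "((\<lambda>z. 1 - h z) \<longlongrightarrow> 0) (at_right 0)" using lim(1) by (auto intro!: tendsto_eq_intros)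
    show "\<forall>\<^sub>F x in at_right 0. ((\<lambda>x. 1 - h x) has_real_derivative - h1 x) (at x)"
      using eventually_at_right_less[of 0]
      by eventually_elim (rule DERIV_diff[OF DERIV_const h1, THEN DERIV_cong], auto)
    show "((\<lambda>x. - h1 x / 1) \<longlongrightarrow> m) (at_right 0)"
      using tendsto_minus[OF lim(2)] by simp
  qed (auto intro!: always_eventually simp: eventually_at_filter)
  have f_nn: "0 \<le> (1 - exp (- (d n * s))) / d n" if "s \<in> space \<nu>" for n s
    using that d[of n] by (simp add: space)
  have int_s: "integrable \<nu> (\<lambda>s. s)"
    by (rule integrable_limit(1)[OF f_int f_nn f_lim seq[OF h_lim1]])
  have "(\<lambda>n. LINT s|\<nu>. (1 - exp (- (d n * s))) / d n) \<longlonglongrightarrow> (LINT s|\<nu>. s)"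
  proof (rule integral_dominated_convergence[where w = "\<lambda>s. s"])
    show "AE s in \<nu>. (\<lambda>n. (1 - exp (- (d n * s))) / d n) \<longlonglongrightarrow> s" by (rule AE_I2) (rule f_lim)
    show "AE s in \<nu>. norm ((1 - exp (- (d n * s))) / d n) \<le> s" for n
    proof (rule AE_I2)
      fix s assume s: "s \<in> space \<nu>"
      have "1 - exp (- (d n * s)) \<le> d n * s" using exp_ge_add_one_self[of "- (d n * s)"] by simp
      then have "(1 - exp (- (d n * s))) / d n \<le> s" using d[of n] by (simp add: pos_divide_le_eq mult.commute)
      then show "norm ((1 - exp (- (d n * s))) / d n) \<le> s" using f_nn[OF s, of n] by simp
    qed
    show "(\<lambda>s. (1 - exp (- (d n * s))) / d n) \<in> borel_measurable \<nu>" for n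
      by (rule borel_measurable_has_bochner_integral[OF f_int])
  qed (rule id_meas int_s)+
  moreover have "(LINT s|\<nu>. (1 - exp (- (d n * s))) / d n) = (1 - h (d n)) / d n" for n
    using f_int by (rule has_bochner_integral_integral_eq)
  ultimately have "(\<lambda>n. (1 - h (d n)) / d n) \<longlonglongrightarrow> (LINT s|\<nu>. s)" by (simp only:)
  then have mean: "(LINT s|\<nu>. s) = m" using seq[OF h_lim1] by (rule LIMSEQ_unique)
  show m: "has_bochner_integral \<nu> (\<lambda>s. s) m"
    using int_s mean by (simp add: has_bochner_integral_iff)
  \<comment> \<open>The second order quotients converge to \<open>s\<^sup>2 / 2\<close> and to \<open>v / 2\<close> by the same l'Hospital argument,
    which is why it is stated for a general function \<open>f\<close>.\<close>
  have g_int: "has_bochner_integral \<nu> (\<lambda>s. (exp (- (d n * s)) - 1 + d n * s) / (d n)\<^sup>2)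
      ((h (d n) - 1 + d n * m) / (d n)\<^sup>2)" for n
    by (intro has_bochner_integral_divide_zero has_bochner_integral_diff has_bochner_integral_add
          has_bochner_integral_mult_right const lap d m)
  have g_nn: "0 \<le> (exp (- (d n * s)) - 1 + d n * s) / (d n)\<^sup>2" for n s
    using exp_ge_add_one_self[of "- (d n * s)"] by simp
  have sq: "((\<lambda>z. (f z - 1 + z * c) / z\<^sup>2) \<longlongrightarrow> w / 2) (at_right 0)"
    if f: "\<And>z. z > 0 \<Longrightarrow> (f has_real_derivative f1 z) (at z)" "\<And>z. z > 0 \<Longrightarrow> (f1 has_real_derivative f2 z) (at z)"
      "(f \<longlongrightarrow> 1) (at_right 0)" "(f1 \<longlongrightarrow> - c) (at_right 0)" "(f2 \<longlongrightarrow> w) (at_right 0)"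
    for f f1 f2 :: "real \<Rightarrow> real" and c w
  proof (rule lhopital_right_0)
    have "((\<lambda>z. f z - 1 + z * c) \<longlongrightarrow> 1 - 1 + 0 * c) (at_right 0)"
      by (intro tendsto_intros f(3))
    then show "((\<lambda>z. f z - 1 + z * c) \<longlongrightarrow> 0) (at_right 0)" by simp
    show "\<forall>\<^sub>F z in at_right 0. ((\<lambda>z. f z - 1 + z * c) has_real_derivative (f1 z + c)) (at z)"
      using eventually_at_right_less[of 0]
    proof eventually_elim
      case (elim z)
      have "((\<lambda>z. f z - 1 + z * c) has_real_derivative (f1 z - 0 + 1 * c)) (at z)"
        by (intro DERIV_add DERIV_diff f(1) elim DERIV_const DERIV_cmult_right DERIV_ident)
      then show ?case by simp
    qed
    show "\<forall>\<^sub>F z in at_right 0. ((\<lambda>z. z\<^sup>2) has_real_derivative (2 * z)) (at (z::real))"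
      by (auto intro!: always_eventually derivative_eq_intros)
    show "((\<lambda>z. (f1 z + c) / (2 * z)) \<longlongrightarrow> w / 2) (at_right 0)"
    proof (rule lhopital_right_0)
      have "((\<lambda>z. f1 z + c) \<longlongrightarrow> - c + c) (at_right 0)" by (intro tendsto_intros f(4))
      then show "((\<lambda>z. f1 z + c) \<longlongrightarrow> 0) (at_right 0)" by simp
      show "\<forall>\<^sub>F z in at_right 0. ((\<lambda>z. f1 z + c) has_real_derivative f2 z) (at z)"
        using eventually_at_right_less[of 0]
        by eventually_elim (rule DERIV_add[OF f(2) DERIV_const, THEN DERIV_cong], auto)
      show "\<forall>\<^sub>F z in at_right 0. ((\<lambda>z. 2 * z) has_real_derivative 2) (at (z::real))"
        by (auto intro!: always_eventually derivative_eq_intros)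
      show "((\<lambda>z. f2 z / 2) \<longlongrightarrow> w / 2) (at_right 0)" using f(5) by (intro tendsto_intros) auto
    qed (auto simp: eventually_at_filter intro!: tendsto_eq_intros)
  qed (auto simp: eventually_at_filter intro!: tendsto_eq_intros)
  have g_lim: "(\<lambda>n. (exp (- (d n * s)) - 1 + d n * s) / (d n)\<^sup>2) \<longlonglongrightarrow> s\<^sup>2 / 2" for s
  proof (rule seq, rule sq)
    show "((\<lambda>z. exp (- (z * s))) has_real_derivative (- s * exp (- (z * s)))) (at z)" for z
      by (auto intro!: derivative_eq_intros)
    show "((\<lambda>z. - s * exp (- (z * s))) has_real_derivative (s\<^sup>2 * exp (- (z * s)))) (at z)" for z
      by (auto intro!: derivative_eq_intros simp: power2_eq_square)
  qed (auto intro!: tendsto_eq_intros)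
  have h_lim2: "((\<lambda>z. (h z - 1 + z * m) / z\<^sup>2) \<longlongrightarrow> v / 2) (at_right 0)"
    by (rule sq[OF h1 h2 lim])
  have int_s2: "integrable \<nu> (\<lambda>s. s\<^sup>2 / 2)"
    by (rule integrable_limit(1)[OF g_int g_nn g_lim seq[OF h_lim2]])
  have le_s2: "(LINT s|\<nu>. s\<^sup>2 / 2) \<le> v / 2"
    by (rule integrable_limit(2)[OF g_int g_nn g_lim seq[OF h_lim2]])
  have expand: "(s - m)\<^sup>2 = 2 * (s\<^sup>2 / 2) - 2 * m * s + m\<^sup>2" for s
    by (simp add: power2_eq_square algebra_simps)
  show "integrable \<nu> (\<lambda>s. (s - m)\<^sup>2)"
    unfolding expand using int_s2 int_s by (intro Bochner_Integration.integrable_add Bochner_Integration.integrable_diff integrable_mult_right) auto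
  have "has_bochner_integral \<nu> (\<lambda>s. (s - m)\<^sup>2) (2 * (LINT s|\<nu>. s\<^sup>2 / 2) - 2 * m * m + m\<^sup>2)"
    unfolding expand using int_s2
    by (intro has_bochner_integral_diff has_bochner_integral_add has_bochner_integral_mult_right const m)
       (auto simp: has_bochner_integral_iff)
  then have "(LINT s|\<nu>. (s - m)\<^sup>2) = 2 * (LINT s|\<nu>. s\<^sup>2 / 2) - 2 * m * m + m\<^sup>2"
    by (rule has_bochner_integral_integral_eq)
  then show "(LINT s|\<nu>. (s - m)\<^sup>2) \<le> v - m\<^sup>2"
    using le_s2 by (simp add: power2_eq_square)
qed

text \<open>By the product rule, \<open>h(z) = g(t z / n)\<^sup>n\<close> has \<open>h'(0+) = - t\<close> and \<open>h''(0+) = t\<^sup>2 + t\<^sup>2 q\<close>. The representing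
  measure of \<open>h\<close> is the law of a sum of \<open>n\<close> independent variables of mean \<open>t / n\<close>, and its variance is at
  most \<open>t\<^sup>2 q\<close>.\<close>

lemma scaled_power_measure:
  assumes g: "completely_monotone g"
    and g0: "deriv_at_zero 0 g = 1" "deriv_at_zero 1 g = - 1" "deriv_at_zero 2 g < \<infinity>"
    and n: "n \<ge> 1" and t: "t > 0"
  defines "q \<equiv> (real_of_ereal (deriv_at_zero 2 g) - 1) / real n"
    and "\<nu> \<equiv> bernstein_measure (\<lambda>z. g (t * z / real n) ^ n)"
  shows "sets \<nu> = sets (restrict_space borel {0..})" "prob_space \<nu>" "has_bochner_integral \<nu> (\<lambda>s. s) t"
    "integrable \<nu> (\<lambda>s. (s - t)\<^sup>2)" "(LINT s|\<nu>. (s - t)\<^sup>2) \<le> t\<^sup>2 * q"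
proof -
  define c where "c = t / real n"
  have c: "c > 0" "real n * c = t" using t n by (auto simp: c_def)
  obtain w where w: "deriv_at_zero 2 g = ereal w"
    using completely_monotone_limit(2)[OF g, of 2] g0(3) by (cases "deriv_at_zero 2 g") auto
  define g1 where "g1 = deriv g"
  define g2 where "g2 = deriv g1"
  have L0: "(g \<longlongrightarrow> 1) (at_right 0)"
    using completely_monotone_limit(1)[OF g, of 0] g0(1) by (simp add: one_ereal_def)
  have L1: "(g1 \<longlongrightarrow> - 1) (at_right 0)"
    using completely_monotone_limit(1)[OF g, of 1] g0(2) by (simp add: one_ereal_def g1_def)
  have L2: "(g2 \<longlongrightarrow> w) (at_right 0)"
    using completely_monotone_limit(1)[OF g, of 2] w by (simp add: numeral_2_eq_2 g1_def g2_def)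
  have D1: "(g has_real_derivative g1 z) (at z)" if "z > 0" for z
    using completely_monotone_deriv[OF g that, of 0] by (simp add: g1_def)
  have D2: "(g1 has_real_derivative g2 z) (at z)" if "z > 0" for z
    using completely_monotone_deriv[OF g that, of 1] by (simp add: g1_def g2_def)
  define h where "h z = g (c * z) ^ n" for z
  define h1 where "h1 z = real n * g (c * z) ^ (n - 1) * (g1 (c * z) * c)" for z
  define h2 where "h2 z = real n * (real (n - 1) * g (c * z) ^ (n - 1 - 1) * (g1 (c * z) * c)) * (g1 (c * z) * c)
      + real n * g (c * z) ^ (n - 1) * (g2 (c * z) * c * c)" for z
  have h_eq: "(\<lambda>z. g (t * z / real n) ^ n) = h" by (simp add: h_def c_def fun_eq_iff)
  have G: "((\<lambda>z. g (c * z)) has_real_derivative g1 (c * z) * c) (at z)"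
    "((\<lambda>z. g1 (c * z)) has_real_derivative g2 (c * z) * c) (at z)" if "z > 0" for z
    using that c(1) by (auto intro!: DERIV_chain2[OF D1] DERIV_chain2[OF D2] derivative_eq_intros)
  have P: "((\<lambda>z. g (c * z) ^ k) has_real_derivative real k * g (c * z) ^ (k - 1) * (g1 (c * z) * c)) (at z)"
    if "z > 0" for z k
    using DERIV_power[OF G(1)[OF that], of k] by (simp add: mult_ac)
  have H1: "(h has_real_derivative h1 z) (at z)" if "z > 0" for z
    unfolding h_def[abs_def] h1_def by (rule P[OF that])
  have H2: "(h1 has_real_derivative h2 z) (at z)" if "z > 0" for z
    unfolding h1_def[abs_def] h2_def
    by (rule DERIV_mult[OF DERIV_cmult[OF P[OF that]] DERIV_cmult_right[OF G(2)[OF that]], THEN DERIV_cong])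
       (simp add: mult_ac)
  have flim: "filterlim (\<lambda>z. c * z) (at_right 0) (at_right 0)"
    unfolding filterlim_at using c(1)
    by (auto intro!: tendsto_eq_intros simp: eventually_at_filter)
  note S = filterlim_compose[OF L0 flim] filterlim_compose[OF L1 flim] filterlim_compose[OF L2 flim]
  have HL0: "(h \<longlongrightarrow> 1) (at_right 0)"
    unfolding h_def[abs_def] using tendsto_power[OF S(1), of n] by simp
  have HL1: "(h1 \<longlongrightarrow> - t) (at_right 0)"
  proof -
    have "(h1 \<longlongrightarrow> real n * 1 ^ (n - 1) * (- 1 * c)) (at_right 0)"
      unfolding h1_def[abs_def] by (intro tendsto_intros S)
    then show ?thesis using c(2) by simp
  qed
  have HL2: "(h2 \<longlongrightarrow> t\<^sup>2 + t\<^sup>2 * q) (at_right 0)"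
  proof -
    have lim: "(h2 \<longlongrightarrow> real n * (real (n - 1) * 1 ^ (n - 1 - 1) * (- 1 * c)) * (- 1 * c)
        + real n * 1 ^ (n - 1) * (w * c * c)) (at_right 0)"
      unfolding h2_def[abs_def] by (intro tendsto_intros S)
    have "real (n - 1) = real n - 1" using n by simp
    then have "real n * (real (n - 1) * 1 ^ (n - 1 - 1) * (- 1 * c)) * (- 1 * c) + real n * 1 ^ (n - 1) * (w * c * c)
        = (real n * c)\<^sup>2 + (real n * c) * c * (w - 1)"
      by (simp add: power2_eq_square algebra_simps)
    also have "\<dots> = t\<^sup>2 + t\<^sup>2 * q"
      unfolding c(2) q_def w using n by (simp add: c_def power2_eq_square)
    finally show ?thesis using lim by simp
  qed
  have cm_h: "completely_monotone h"
    unfolding h_def[abs_def] by (rule completely_monotone_scaled_power[OF g c(1)])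
  have rep: "represents \<nu> h"
    unfolding \<nu>_def h_eq bernstein_measure_def by (rule someI_ex[OF bernstein_exists[OF cm_h HL0]])
  show "sets \<nu> = sets (restrict_space borel {0..})" using rep by (simp add: represents_def)
  note M = representing_measure_moments[OF rep H1 H2 HL0 HL1 HL2]
  show "prob_space \<nu>" by (rule M(1))
  show "has_bochner_integral \<nu> (\<lambda>s. s) t" by (rule M(2))
  show "integrable \<nu> (\<lambda>s. (s - t)\<^sup>2)" by (rule M(3))
  show "(LINT s|\<nu>. (s - t)\<^sup>2) \<le> t\<^sup>2 * q" using M(4) by simp
qed

section \<open>Bounded holomorphic semigroups\<close>

text \<open>Cauchy's estimate for vector-valued functions. A norming functional for the derivative is
  complexified in the standard way, \<open>\<phi>(x) - \<i> \<phi>(\<i> x)\<close>, which costs the factor 2; the estimate serves to show that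
  suprema over \<open>t\<close> are finite.\<close>

lemma norm_deriv_le_of_bounded_holomorphic:
  fixes u :: "complex \<Rightarrow> 'a::complex_banach"
  assumes r: "r > 0"
    and hol: "\<And>z. z \<in> cball t r \<Longrightarrow>
          \<exists>D. ((\<lambda>w. inverse (w - z) *\<^sub>C (u w - u z)) \<longlongrightarrow> D) (at z within cball t r)"
    and bound: "\<And>z. z \<in> cball t r \<Longrightarrow> norm (u z) \<le> B"
    and D: "((\<lambda>w. inverse (w - t) *\<^sub>C (u w - u t)) \<longlongrightarrow> D) (at t within cball t r)"
  shows "norm D \<le> 2 * B / r"
proof -
  obtain \<phi> :: "'a \<Rightarrow> real" where \<phi>: "bounded_linear \<phi>" "\<And>x. \<bar>\<phi> x\<bar> \<le> norm x" "\<phi> D = norm D"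
    by (rule norming_functional[of D]) blast
  interpret \<phi>: bounded_linear \<phi> by (rule \<phi>(1))
  define \<psi> where "\<psi> x = Complex (\<phi> x) (- \<phi> (\<i> *\<^sub>C x))" for x
  have scaleR_eq: "c *\<^sub>C x = Re c *\<^sub>R x + Im c *\<^sub>R (\<i> *\<^sub>C x)" for c and x :: 'a
  proof -
    have "c *\<^sub>C x = (of_real (Re c) + of_real (Im c) * \<i>) *\<^sub>C x"
      by (simp add: complex_eq[symmetric] mult.commute)
    then show ?thesis by (simp only: scaleC_add_left scaleC_scaleC[symmetric] scaleR_scaleC)
  qed
  have i_i: "\<i> *\<^sub>C \<i> *\<^sub>C x = - x" for x :: 'a
    using scaleR_scaleC[of "-1" x] by (simp add: scaleC_scaleC)
  have \<psi>_diff: "\<psi> (x - y) = \<psi> x - \<psi> y" for x y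
  proof -
    have "\<i> *\<^sub>C (x - y) = \<i> *\<^sub>C x - \<i> *\<^sub>C y"
      using scaleC_add_right[of \<i> "x - y" y] by simp
    then show ?thesis by (simp add: \<psi>_def \<phi>.diff complex_eq_iff)
  qed
  have \<psi>_scale: "\<psi> (c *\<^sub>C x) = c * \<psi> x" for c x
  proof -
    have 1: "\<phi> (c *\<^sub>C x) = Re c * \<phi> x + Im c * \<phi> (\<i> *\<^sub>C x)"
      by (subst scaleR_eq) (simp add: \<phi>.add \<phi>.scaleR)
    have "\<i> *\<^sub>C c *\<^sub>C x = c *\<^sub>C \<i> *\<^sub>C x" by (simp add: scaleC_scaleC mult.commute)
    then have "\<phi> (\<i> *\<^sub>C c *\<^sub>C x) = Re c * \<phi> (\<i> *\<^sub>C x) + Im c * \<phi> (- x)"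
      using scaleR_eq[of c "\<i> *\<^sub>C x"] by (simp add: \<phi>.diff \<phi>.scaleR \<phi>.neg i_i)
    with 1 show ?thesis by (simp add: \<psi>_def complex_eq_iff \<phi>.neg algebra_simps)
  qed
  have \<psi>_norm: "norm (\<psi> x) \<le> 2 * norm x" for x
  proof -
    have "norm (\<psi> x) \<le> \<bar>\<phi> x\<bar> + \<bar>\<phi> (\<i> *\<^sub>C x)\<bar>" using cmod_le[of "\<psi> x"] by (simp add: \<psi>_def)
    also have "\<dots> \<le> norm x + norm (\<i> *\<^sub>C x)" by (intro add_mono \<phi>(2))
    finally show ?thesis by (simp add: norm_scaleC)
  qed
  have \<psi>_lim: "((\<psi> \<circ> v) \<longlongrightarrow> \<psi> l) F" if "(v \<longlongrightarrow> l) F" for v l and F :: "complex filter"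
  proof -
    have "((\<lambda>w. \<psi> (v w) - \<psi> l) \<longlongrightarrow> 0) F"
    proof (rule Lim_null_comparison)
      show "\<forall>\<^sub>F w in F. norm (\<psi> (v w) - \<psi> l) \<le> 2 * norm (v w - l)"
        using \<psi>_norm by (auto simp: \<psi>_diff[symmetric])
      show "((\<lambda>w. 2 * norm (v w - l)) \<longlongrightarrow> 0) F"
        using that by (auto intro!: tendsto_eq_intros tendsto_norm_zero simp: LIM_zero_iff)
    qed
    then show ?thesis by (simp add: LIM_zero_iff o_def)
  qed
  have deriv: "((\<psi> \<circ> u) has_field_derivative \<psi> E) (at z within cball t r)"
    if "((\<lambda>w. inverse (w - z) *\<^sub>C (u w - u z)) \<longlongrightarrow> E) (at z within cball t r)" for z E
    using \<psi>_lim[OF that]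
    by (simp add: has_field_derivative_iff \<psi>_scale \<psi>_diff o_def divide_inverse mult.commute)
  have holo: "(\<psi> \<circ> u) holomorphic_on cball t r"
    unfolding holomorphic_on_def field_differentiable_def using hol deriv by blast
  have "norm ((deriv ^^ 1) (\<psi> \<circ> u) t) \<le> fact 1 * (2 * B) / r ^ 1"
  proof (rule Cauchy_inequality)
    show "(\<psi> \<circ> u) holomorphic_on ball t r" by (rule holomorphic_on_subset[OF holo]) auto
    show "continuous_on (cball t r) (\<psi> \<circ> u)" by (rule holomorphic_on_imp_continuous_on[OF holo])
    fix z assume "norm (t - z) = r"
    then have "norm (u z) \<le> B" by (intro bound) (simp add: dist_norm)
    then show "norm ((\<psi> \<circ> u) z) \<le> 2 * B" using \<psi>_norm[of "u z"] by simp
  qed fact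
  moreover have "deriv (\<psi> \<circ> u) t = \<psi> D"
    using deriv[OF D] r at_within_interior[of t "cball t r"] by (intro DERIV_imp_deriv) simp
  ultimately have "norm (\<psi> D) \<le> 2 * B / r" by simp
  moreover have "norm D \<le> norm (\<psi> D)"
    using complex_Re_le_cmod[of "\<psi> D"] by (simp add: \<psi>_def \<phi>(3))
  ultimately show ?thesis by linarith
qed

lemma cball_in_sector:
  assumes "\<xi> > 0"
  obtains \<rho> where "\<rho> > 0" "\<rho> < 1" "\<And>t. t > 0 \<Longrightarrow> cball (of_real t) (\<rho> * t) \<subseteq> sector \<xi>"
proof -
  have "isCont Arg 1" by (rule continuous_at_Arg) auto
  then obtain d where d: "d > 0" "\<And>z. dist z 1 < d \<Longrightarrow> \<bar>Arg z\<bar> < \<xi>"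
    using assms by (auto simp: continuous_at_eps_delta dist_real_def)
  define \<rho> where "\<rho> = min (1 / 2) (d / 2)"
  have \<rho>: "\<rho> > 0" "\<rho> < 1" "\<rho> < d" using d(1) by (auto simp: \<rho>_def)
  have "cball (of_real t) (\<rho> * t) \<subseteq> sector \<xi>" if t: "t > 0" for t
  proof
    fix z :: complex assume z: "z \<in> cball (of_real t) (\<rho> * t)"
    have "z / of_real t - 1 = (z - of_real t) / of_real t" using t by (simp add: field_simps)
    then have "norm (z / of_real t - 1) \<le> \<rho>"
      using z t by (simp add: norm_divide dist_norm norm_minus_commute field_simps)
    moreover from this have "z \<noteq> 0" using \<rho> by auto
    ultimately show "z \<in> sector \<xi>"
      using d(2)[of "z / of_real t"] t \<rho> by (simp add: sector_def dist_norm)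
  qed
  with \<rho> show ?thesis using that by blast
qed

lemma has_vector_derivative_iff_tendsto:
  "(f has_vector_derivative D) (at x within S) \<longleftrightarrow>
     ((\<lambda>y. (f y - f x) /\<^sub>R (y - x)) \<longlongrightarrow> D) (at x within S)"
proof -
  have eq: "norm ((f y - f x) /\<^sub>R (y - x) - D) = norm ((1 / norm (y - x)) *\<^sub>R (f y - (f x + (y - x) *\<^sub>R D)))"
    if "y \<noteq> x" for y
  proof -
    have "(f y - f x) /\<^sub>R (y - x) - D = inverse (y - x) *\<^sub>R (f y - (f x + (y - x) *\<^sub>R D))"
      using that by (simp add: scaleR_diff_right scaleR_add_right)
    then show ?thesis by (simp add: divide_inverse)
  qed
  have "((\<lambda>y. (f y - f x) /\<^sub>R (y - x) - D) \<longlongrightarrow> 0) (at x within S) \<longleftrightarrow>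
      ((\<lambda>y. (1 / norm (y - x)) *\<^sub>R (f y - (f x + (y - x) *\<^sub>R D))) \<longlongrightarrow> 0) (at x within S)"
    by (subst (1 2) tendsto_norm_zero_iff[symmetric], rule tendsto_cong)
       (use eq in \<open>auto simp: eventually_at_filter\<close>)
  then show ?thesis
    by (simp add: has_vector_derivative_def has_derivative_within LIM_zero_iff
          bounded_linear_scaleR_left)
qed

locale bounded_holomorphic_semigroup =
  fixes T :: "real \<Rightarrow> 'a \<Rightarrow> 'a::complex_banach" and A :: "('a \<times> 'a) set"
  assumes holomorphic_T: "sectorially_bounded_holomorphic_semigroup T"
    and generator_T: "generator T = op_uminus A"
begin

lemma C0: "C0_semigroup T"
  using holomorphic_T by (simp add: sectorially_bounded_holomorphic_semigroup_def)

lemma T_linear: "t \<ge> 0 \<Longrightarrow> bounded_linear (T t)"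
  using C0 by (auto simp: C0_semigroup_def bounded_clinear_def)

lemma T_plus: "t \<ge> 0 \<Longrightarrow> T t (x + y) = T t x + T t y"
  and T_minus: "t \<ge> 0 \<Longrightarrow> T t (x - y) = T t x - T t y"
  and T_scale: "t \<ge> 0 \<Longrightarrow> T t (c *\<^sub>R x) = c *\<^sub>R T t x"
  using T_linear by (simp_all add: linear_simps)

lemma T_0 [simp]: "T 0 x = x"
  using C0 by (auto simp: C0_semigroup_def)

lemma T_T: "s \<ge> 0 \<Longrightarrow> t \<ge> 0 \<Longrightarrow> T s (T t x) = T (s + t) x"
  using C0 by (auto simp: C0_semigroup_def)

text \<open>The holomorphic extension restricted to discs whose radius is proportional to their centre.
  Such discs lie in a fixed smaller sector, where the extension is bounded.\<close>

lemma extension: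
  obtains U C \<rho> where "\<And>t. t \<ge> 0 \<Longrightarrow> U (complex_of_real t) = T t"
    "C \<ge> 0" "\<rho> > 0" "\<rho> < 1"
    "\<And>t z x. t \<ge> 0 \<Longrightarrow> z \<in> cball (of_real t) (\<rho> * t) \<Longrightarrow> norm (U z x) \<le> C * norm x"
    "\<And>t x z. t > 0 \<Longrightarrow> z \<in> cball (of_real t) (\<rho> * t) \<Longrightarrow>
      \<exists>D. ((\<lambda>w. inverse (w - z) *\<^sub>C (U w x - U z x)) \<longlongrightarrow> D) (at z within cball (of_real t) (\<rho> * t))"
    "\<And>x. continuous_on {0..} (\<lambda>t. T t x)"
proof -
  obtain \<theta> U where th: "0 < \<theta>" and U: "\<And>t. t \<ge> 0 \<Longrightarrow> U (complex_of_real t) = T t"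
    and hol: "strongly_holomorphic_on U (sector \<theta>)"
    and bd: "\<And>\<xi>. 0 < \<xi> \<Longrightarrow> \<xi> < \<theta> \<Longrightarrow> \<exists>C. \<forall>z\<in>closure (sector \<xi>). \<forall>x. norm (U z x) \<le> C * norm x"
    and ct: "\<And>\<xi> x. 0 < \<xi> \<Longrightarrow> \<xi> < \<theta> \<Longrightarrow> continuous_on (closure (sector \<xi>)) (\<lambda>z. U z x)"
    using holomorphic_T unfolding sectorially_bounded_holomorphic_semigroup_def by blast
  define \<xi> where "\<xi> = \<theta> / 2"
  have xi: "0 < \<xi>" "\<xi> < \<theta>" using th by (auto simp: \<xi>_def)
  obtain C where C: "\<And>z x. z \<in> closure (sector \<xi>) \<Longrightarrow> norm (U z x) \<le> C * norm x"
    using bd[OF xi] by blast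
  obtain \<rho> where \<rho>: "\<rho> > 0" "\<rho> < 1" "\<And>t. t > 0 \<Longrightarrow> cball (of_real t) (\<rho> * t) \<subseteq> sector \<xi>"
    using cball_in_sector[OF xi(1)] by blast
  have pos: "of_real t \<in> sector \<xi>" if "t > 0" for t :: real
    using \<rho>(1) \<rho>(3)[OF that] that by auto
  have real_cl: "of_real t \<in> closure (sector \<xi>)" if "t \<ge> 0" for t :: real
  proof -
    have "(of_real :: real \<Rightarrow> complex) ` closure {0<..} \<subseteq> closure (of_real ` {0<..})"
      by (rule image_closure_subset[OF _ closed_closure closure_subset]) (auto intro!: continuous_intros)
    also have "\<dots> \<subseteq> closure (sector \<xi>)" by (rule closure_mono) (use pos in auto)
    finally show ?thesis using that by (auto simp: closure_greaterThan)
  qed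
  have sub: "cball (of_real t) (\<rho> * t) \<subseteq> closure (sector \<xi>)" if "t \<ge> 0" for t
    using \<rho>(3)[of t] closure_subset[of "sector \<xi>"] that real_cl[of 0]
    by (cases "t = 0") auto
  have bd: "norm (U z x) \<le> max C 0 * norm x" if "z \<in> closure (sector \<xi>)" for z x
    using C[OF that, of x] mult_right_mono[of C "max C 0" "norm x"] by simp
  have D: "\<exists>D. ((\<lambda>w. inverse (w - z) *\<^sub>C (U w x - U z x)) \<longlongrightarrow> D) (at z within cball (of_real t) (\<rho> * t))"
    if "t > 0" "z \<in> cball (of_real t) (\<rho> * t)" for t x z
  proof -
    have sub': "cball (of_real t) (\<rho> * t) \<subseteq> sector \<theta>"
      using \<rho>(3)[OF that(1)] xi by (force simp: sector_def)
    then show ?thesis using hol that(2) tendsto_within_subset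
      unfolding strongly_holomorphic_on_def by blast
  qed
  have cont: "continuous_on {0..} (\<lambda>t. T t x)" for x
  proof -
    have "continuous_on {0..} ((\<lambda>z. U z x) \<circ> of_real)"
      by (intro continuous_on_compose continuous_on_subset[OF ct[OF xi]])
         (use real_cl in \<open>auto intro!: continuous_intros\<close>)
    then show ?thesis by (rule continuous_on_eq) (simp add: U)
  qed
  show ?thesis
    by (rule that[of U "max C 0" \<rho>, OF U _ \<rho>(1,2) bd D cont]) (use sub in \<open>auto simp del: mem_cball\<close>)
qed

lemma T_continuous: "continuous_on {0..} (\<lambda>t. T t x)"
proof (rule extension)
  assume "\<And>x. continuous_on {0..} (\<lambda>t. T t x)"
  then show ?thesis .
qed

lemma T_bounded: "\<exists>C\<ge>0. \<forall>t\<ge>0. \<forall>x. norm (T t x) \<le> C * norm x"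
proof (rule extension)
  fix U C \<rho> assume 1: "\<And>t. t \<ge> 0 \<Longrightarrow> U (complex_of_real t) = T t" "C \<ge> 0" "\<rho> > (0::real)"
    and 2: "\<And>t z x. t \<ge> 0 \<Longrightarrow> z \<in> cball (of_real t) (\<rho> * t) \<Longrightarrow> norm (U z x) \<le> C * norm x"
  have "norm (T t x) \<le> C * norm x" if "t \<ge> 0" for t x
    using 2[of t "of_real t" x] 1 that by auto
  with 1(2) show ?thesis by blast
qed

lemma A_iff: "(x, y) \<in> A \<longleftrightarrow> ((\<lambda>h. (T h x - x) /\<^sub>R h) \<longlongrightarrow> - y) (at_right 0)"
proof -
  have "(x, y) \<in> A \<longleftrightarrow> (x, - y) \<in> op_uminus A" by (auto simp: op_uminus_def)
  also have "\<dots> \<longleftrightarrow> (x, - y) \<in> Defs.generator T" by (simp add: generator_T)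
  finally show ?thesis by (simp add: generator_def)
qed

lemma A_unique: assumes "(x, y) \<in> A" "(x, z) \<in> A" shows "y = z"
  using tendsto_unique[OF trivial_limit_at_right_real assms[unfolded A_iff]] by simp

lemma op_app_A: "(x, y) \<in> A \<Longrightarrow> op_app A x = y"
  unfolding op_app_def by (rule the_equality) (auto dest: A_unique)

lemma A_add: "(x, y) \<in> A \<Longrightarrow> (x', y') \<in> A \<Longrightarrow> (x + x', y + y') \<in> A"
proof -
  assume "(x, y) \<in> A" "(x', y') \<in> A"
  then have "((\<lambda>h. (T h x - x) /\<^sub>R h + (T h x' - x') /\<^sub>R h) \<longlongrightarrow> - y + - y') (at_right 0)"
    unfolding A_iff by (rule tendsto_add)
  then have "((\<lambda>h. (T h (x + x') - (x + x')) /\<^sub>R h) \<longlongrightarrow> - y + - y') (at_right 0)"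
    by (rule Lim_transform_eventually)
       (simp add: eventually_at_filter T_plus scaleR_add_right scaleR_diff_right)
  then show ?thesis by (simp add: A_iff)
qed

lemma A_scale: "(x, y) \<in> A \<Longrightarrow> (c *\<^sub>R x, c *\<^sub>R y) \<in> A"
proof -
  assume "(x, y) \<in> A"
  then have "((\<lambda>h. c *\<^sub>R ((T h x - x) /\<^sub>R h)) \<longlongrightarrow> c *\<^sub>R (- y)) (at_right 0)"
    unfolding A_iff by (intro tendsto_intros)
  then have "((\<lambda>h. (T h (c *\<^sub>R x) - c *\<^sub>R x) /\<^sub>R h) \<longlongrightarrow> c *\<^sub>R (- y)) (at_right 0)"
    by (rule Lim_transform_eventually)
       (simp add: eventually_at_filter T_scale scaleR_diff_right mult.commute)
  then show ?thesis by (simp add: A_iff)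
qed

lemma A_T: "(x, y) \<in> A \<Longrightarrow> t \<ge> 0 \<Longrightarrow> (T t x, T t y) \<in> A"
proof -
  assume xy: "(x, y) \<in> A" and t: "t \<ge> 0"
  interpret Tt: bounded_linear "T t" by (rule T_linear[OF t])
  from xy have "((\<lambda>h. T t ((T h x - x) /\<^sub>R h)) \<longlongrightarrow> T t (- y)) (at_right 0)"
    unfolding A_iff by (rule Tt.tendsto)
  then have "((\<lambda>h. (T h (T t x) - T t x) /\<^sub>R h) \<longlongrightarrow> T t (- y)) (at_right 0)"
    by (rule Lim_transform_eventually)
       (use t in \<open>simp add: eventually_at_filter T_minus T_scale T_T add.commute\<close>)
  then show ?thesis by (simp add: A_iff Tt.neg)
qed

text \<open>\<open>AT t\<close> and \<open>A2T t\<close> are the bounded operators \<open>A T(t)\<close> and \<open>A\<^sup>2 T(t)\<close> for \<open>t > 0\<close>. Writing the second one as the square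
  of \<open>A T(t/2)\<close> makes its boundedness and its algebra immediate.\<close>

definition AT :: "real \<Rightarrow> 'a \<Rightarrow> 'a" where
  "AT t x = op_app A (T t x)"

definition A2T :: "real \<Rightarrow> 'a \<Rightarrow> 'a" where
  "A2T t x = AT (t / 2) (AT (t / 2) x)"

text \<open>The derivative of an orbit exists by holomorphy and is \<open>- A T(t) x\<close>; Cauchy's estimate on a disc of
  radius proportional to \<open>t\<close> bounds it by a multiple of \<open>1 / t\<close>.\<close>

lemma T_smoothing:
  "\<exists>C\<ge>0. \<forall>t>0. \<forall>x. (T t x, AT t x) \<in> A \<and> ((\<lambda>t. T t x) has_vector_derivative - AT t x) (at t)
      \<and> norm (AT t x) \<le> C / t * norm x"
proof (rule extension)
  fix U C \<rho> assume U: "\<And>t. t \<ge> 0 \<Longrightarrow> U (complex_of_real t) = T t"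
    and C: "C \<ge> 0" and \<rho>: "\<rho> > 0" "\<rho> < 1"
    and bd: "\<And>t z x. t \<ge> 0 \<Longrightarrow> z \<in> cball (of_real t) (\<rho> * t) \<Longrightarrow> norm (U z x) \<le> C * norm x"
    and hol: "\<And>t x z. t > 0 \<Longrightarrow> z \<in> cball (of_real t) (\<rho> * t) \<Longrightarrow>
      \<exists>D. ((\<lambda>w. inverse (w - z) *\<^sub>C (U w x - U z x)) \<longlongrightarrow> D) (at z within cball (of_real t) (\<rho> * t))"
  have main: "(T t x, AT t x) \<in> A \<and> ((\<lambda>t. T t x) has_vector_derivative - AT t x) (at t)
      \<and> norm (AT t x) \<le> 2 * C / \<rho> / t * norm x" if t: "t > 0" for t x
  proof -
    have r: "\<rho> * t > 0" using \<rho> t by simp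
    obtain D where D: "((\<lambda>w. inverse (w - of_real t) *\<^sub>C (U w x - U (of_real t) x)) \<longlongrightarrow> D)
        (at (of_real t) within cball (of_real t) (\<rho> * t))"
      using hol[OF t, of "of_real t" x] r by auto
    have "norm D \<le> 2 * (C * norm x) / (\<rho> * t)"
      using t by (intro norm_deriv_le_of_bounded_holomorphic[where u = "\<lambda>z. U z x", OF r hol[OF t] bd D]) auto
    then have nD: "norm D \<le> 2 * C / \<rho> / t * norm x" by (simp add: mult_ac)
    have D': "((\<lambda>w. inverse (w - of_real t) *\<^sub>C (U w x - U (of_real t) x)) \<longlongrightarrow> D) (at (of_real t))"
      using D r at_within_interior[of "of_real t" "cball (complex_of_real t) (\<rho> * t)"] by simp
    have "filterlim complex_of_real (at (complex_of_real t)) (at t)"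
      by (auto simp: filterlim_at eventually_at_filter intro!: tendsto_intros)
    from filterlim_compose[OF D' this] have "((\<lambda>y. inverse (of_real y - of_real t) *\<^sub>C (U (of_real y) x - U (of_real t) x)) \<longlongrightarrow> D) (at t)" .
    moreover have "\<forall>\<^sub>F y in at t. inverse (of_real y - of_real t) *\<^sub>C (U (of_real y) x - U (of_real t) x)
        = (T y x - T t x) /\<^sub>R (y - t)"
    proof -
      have "\<forall>\<^sub>F y in at t. y > 0" using order_tendstoD(1)[OF tendsto_ident_at t] .
      then show ?thesis
        by eventually_elim (use t in \<open>simp add: U scaleR_scaleC\<close>)
    qed
    ultimately have lim: "((\<lambda>y. (T y x - T t x) /\<^sub>R (y - t)) \<longlongrightarrow> D) (at t)"
      by (rule Lim_transform_eventually)
    then have der: "((\<lambda>t. T t x) has_vector_derivative D) (at t)"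
      by (simp add: has_vector_derivative_iff_tendsto)
    have "((\<lambda>h. (T (t + h) x - T t x) /\<^sub>R h) \<longlongrightarrow> D) (at 0)"
      using LIM_offset_zero[OF lim] by simp
    then have "((\<lambda>h. (T (t + h) x - T t x) /\<^sub>R h) \<longlongrightarrow> D) (at_right 0)"
      by (rule tendsto_within_subset) auto
    then have "((\<lambda>h. (T h (T t x) - T t x) /\<^sub>R h) \<longlongrightarrow> D) (at_right 0)"
      by (rule Lim_transform_eventually) (use t in \<open>auto simp: eventually_at_filter T_T add.commute\<close>)
    then have "(T t x, - D) \<in> A" by (simp add: A_iff)
    moreover from this have "AT t x = - D" by (simp add: AT_def op_app_A)
    ultimately show ?thesis using der nD by simp
  qed
  show ?thesis
    by (intro exI[of _ "2 * C / \<rho>"] conjI[OF divide_nonneg_pos] allI impI main) (use C \<rho> in auto)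
qed

lemma AT_in: "t > 0 \<Longrightarrow> (T t x, AT t x) \<in> A"
  using T_smoothing by auto

lemma T_deriv: "t > 0 \<Longrightarrow> ((\<lambda>t. T t x) has_vector_derivative - AT t x) (at t)"
  using T_smoothing by auto

lemma AT_linear: assumes t: "t > 0" shows "bounded_linear (AT t)"
proof -
  obtain C where C: "\<And>t x. t > 0 \<Longrightarrow> norm (AT t x) \<le> C / t * norm x" using T_smoothing by blast
  interpret Tt: bounded_linear "T t" using t by (intro T_linear) auto
  show ?thesis
  proof (rule bounded_linear_intro[where K = "C / t"])
    fix x y show "AT t (x + y) = AT t x + AT t y"
      using A_add[OF AT_in[OF t, of x] AT_in[OF t, of y]] by (simp add: AT_def Tt.add op_app_A)
  next
    fix c x show "AT t (c *\<^sub>R x) = c *\<^sub>R AT t x"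
      using A_scale[OF AT_in[OF t, of x], of c] by (simp add: AT_def Tt.scaleR op_app_A)
  next
    fix x show "norm (AT t x) \<le> norm x * (C / t)" using C[OF t, of x] by (simp only: mult.commute)
  qed
qed

lemma AT_dom: "(x, y) \<in> A \<Longrightarrow> t \<ge> 0 \<Longrightarrow> AT t x = T t y"
  unfolding AT_def by (rule op_app_A) (rule A_T)

lemma T_AT: "s \<ge> 0 \<Longrightarrow> t > 0 \<Longrightarrow> T s (AT t x) = AT (s + t) x"
  using A_T[OF AT_in[of t x], of s] by (simp add: AT_def op_app_A T_T)

lemma AT_T: "s \<ge> 0 \<Longrightarrow> t > 0 \<Longrightarrow> AT t (T s x) = AT (s + t) x"
  by (simp add: AT_def T_T add.commute)

lemma AT_AT: assumes "s > 0" "t > 0" shows "AT s (AT t x) = A2T (s + t) x"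
proof -
  have *: "AT s (AT t x) = AT r (AT (s + t - r) x)" if "0 < r" "r < s" "s > 0" "t > 0" for r s t
  proof -
    have "AT s (AT t x) = AT r (T (s - r) (AT t x))" using AT_T[of "s - r" r "AT t x"] that by simp
    also have "T (s - r) (AT t x) = AT (s + t - r) x"
      using T_AT[of "s - r" t x] that by (simp add: add_diff_eq add.commute)
    finally show ?thesis .
  qed
  \<comment> \<open>\<open>A T(r) A T(s + t - r)\<close> does not depend on \<open>r\<close>; compare \<open>r = s\<close> and \<open>r = (s + t) / 2\<close> with a smaller value.\<close>
  define r where "r = min s ((s + t) / 2) / 2"
  have r: "0 < r" "r < s" "r < (s + t) / 2" using assms by (auto simp: r_def min_def)
  have "AT s (AT t x) = AT r (AT (s + t - r) x)" by (rule *[OF r(1,2) assms])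
  also have "\<dots> = A2T (s + t) x"
    using *[OF r(1,3), of "(s + t) / 2"] assms by (simp add: A2T_def)
  finally show ?thesis .
qed

lemma A2T_in: "t > 0 \<Longrightarrow> (AT t x, A2T t x) \<in> A"
  using A_T[OF AT_in, of "t / 2" "t / 2" x] AT_in[of "t / 2" "AT (t / 2) x"] T_AT[of "t/2" "t/2" x]
  by (simp add: A2T_def)

lemma A_sq_T: "t > 0 \<Longrightarrow> (T t x, A2T t x) \<in> A ^^ 2"
  using AT_in[of t x] A2T_in[of t x] by (auto simp: numeral_2_eq_2)

lemma op_app_A_sq: "t > 0 \<Longrightarrow> op_app (A ^^ 2) (T t x) = A2T t x"
proof -
  assume t: "t > 0"
  have "y = A2T t x" if "(T t x, y) \<in> A ^^ 2" for y
  proof -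
    from that obtain z where "(T t x, z) \<in> A" "(z, y) \<in> A" by (auto simp: numeral_2_eq_2)
    then show ?thesis using AT_in[OF t] A2T_in[OF t] A_unique by blast
  qed
  then show ?thesis unfolding op_app_def using A_sq_T[OF t] by blast
qed

lemma AT_deriv: assumes t: "t > 0" shows "((\<lambda>t. AT t x) has_vector_derivative - A2T t x) (at t)"
proof -
  have "((\<lambda>s. T s (AT (t / 2) x)) has_vector_derivative - AT (t / 2) (AT (t / 2) x)) (at (t / 2))"
    using t by (intro T_deriv) auto
  then have "(((\<lambda>s. T s (AT (t / 2) x)) \<circ> (\<lambda>s. s - t / 2)) has_vector_derivative 1 *\<^sub>R (- AT (t / 2) (AT (t / 2) x))) (at t)"
    using t by (intro vector_diff_chain_at) (auto intro!: derivative_eq_intros)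
  then show ?thesis
    by (rule has_vector_derivative_transform_within_open[where S = "{t/2<..}", THEN has_vector_derivative_eq_rhs])
       (use t in \<open>auto simp: T_AT A2T_def\<close>)
qed

lemma A2T_bounded: "\<exists>C\<ge>0. \<forall>t>0. \<forall>x. norm (A2T t x) \<le> C / t^2 * norm x"
proof -
  obtain C where C: "C \<ge> 0" "\<And>t x. t > 0 \<Longrightarrow> norm (AT t x) \<le> C / t * norm x" using T_smoothing by blast
  have "norm (A2T t x) \<le> (4 * C^2) / t^2 * norm x" if t: "t > 0" for t x
  proof -
    have "norm (A2T t x) \<le> C / (t / 2) * norm (AT (t / 2) x)"
      unfolding A2T_def using t by (intro C(2)) auto
    also have "\<dots> \<le> C / (t / 2) * (C / (t / 2) * norm x)"
      using t C by (intro mult_left_mono C(2)) auto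
    finally show ?thesis by (simp add: power2_eq_square)
  qed
  then show ?thesis by (intro exI[of _ "4 * C^2"]) auto
qed

lemma A2T_linear: "t > 0 \<Longrightarrow> bounded_linear (A2T t)"
  unfolding A2T_def[abs_def] by (intro bounded_linear_compose[OF AT_linear AT_linear]) auto

text \<open>For \<open>\<beta> = 0, 1, 2\<close> the supremum is over a bounded set, so that it is an upper bound for the norms.\<close>

definition M :: "real \<Rightarrow> real" where
  "M \<beta> = (SUP t\<in>{0<..}. onorm (\<lambda>x. t powr \<beta> *\<^sub>R op_app (frac_power A \<beta>) (T t x)))"

lemma SUP_onorm:
  fixes F :: "real \<Rightarrow> 'a \<Rightarrow> 'a"
  assumes lin: "\<And>t. t > 0 \<Longrightarrow> bounded_linear (F t)"
    and bd: "\<And>t x. t > 0 \<Longrightarrow> norm (F t x) \<le> C * norm x" and C: "C \<ge> 0"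
  shows "0 \<le> (SUP t\<in>{0<..}. onorm (F t))"
    and "t > 0 \<Longrightarrow> norm (F t x) \<le> (SUP t\<in>{0<..}. onorm (F t)) * norm x"
proof -
  have bdd: "bdd_above ((\<lambda>t. onorm (F t)) ` {0<..})"
    by (rule bdd_aboveI2[where M = C]) (use bd C in \<open>auto intro!: onorm_bound\<close>)
  have le: "onorm (F t) \<le> (SUP t\<in>{0<..}. onorm (F t))" if "t > 0" for t
    using that by (intro cSUP_upper[OF _ bdd]) auto
  show "0 \<le> (SUP t\<in>{0<..}. onorm (F t))"
    using le[of 1] onorm_pos_le[OF lin[of 1]] by simp
  assume t: "t > 0"
  have "norm (F t x) \<le> onorm (F t) * norm x" by (rule onorm[OF lin[OF t]])
  also have "\<dots> \<le> (SUP t\<in>{0<..}. onorm (F t)) * norm x" by (intro mult_right_mono le t) auto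
  finally show "norm (F t x) \<le> (SUP t\<in>{0<..}. onorm (F t)) * norm x" .
qed

lemma M0_eq: "M 0 = (SUP t\<in>{0<..}. onorm (T t))"
  and M1_eq: "M 1 = (SUP t\<in>{0<..}. onorm (\<lambda>x. t *\<^sub>R AT t x))"
  and M2_eq: "M 2 = (SUP t\<in>{0<..}. onorm (\<lambda>x. t\<^sup>2 *\<^sub>R A2T t x))"
proof -
  have id: "op_app Id x = x" for x :: 'a by (simp add: op_app_def)
  show "M 0 = (SUP t\<in>{0<..}. onorm (T t))"
    unfolding M_def using frac_power_of_nat[of A 0] by (intro SUP_cong) (auto simp: id)
  show "M 1 = (SUP t\<in>{0<..}. onorm (\<lambda>x. t *\<^sub>R AT t x))"
    unfolding M_def using frac_power_of_nat[of A 1] by (intro SUP_cong) (auto simp: AT_def)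
  show "M 2 = (SUP t\<in>{0<..}. onorm (\<lambda>x. t\<^sup>2 *\<^sub>R A2T t x))"
    unfolding M_def using frac_power_of_nat[of A 2] by (intro SUP_cong) (auto simp: op_app_A_sq)
qed

lemma M0_nonneg: "M 0 \<ge> 0" and T_le_pos: "t > 0 \<Longrightarrow> norm (T t x) \<le> M 0 * norm x"
proof -
  obtain C where "C \<ge> 0" "\<And>t x. t \<ge> 0 \<Longrightarrow> norm (T t x) \<le> C * norm x" using T_bounded by blast
  then show "M 0 \<ge> 0" "t > 0 \<Longrightarrow> norm (T t x) \<le> M 0 * norm x"
    unfolding M0_eq using SUP_onorm[of T C] T_linear by auto
qed

lemma M1_nonneg: "M 1 \<ge> 0" and AT_le: "t > 0 \<Longrightarrow> norm (AT t x) \<le> M 1 / t * norm x"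
proof -
  obtain C where C: "C \<ge> 0" "\<And>t x. t > 0 \<Longrightarrow> norm (AT t x) \<le> C / t * norm x" using T_smoothing by blast
  have *: "norm (t *\<^sub>R AT t x) \<le> C * norm x" if "t > 0" for t x
    using C(2)[OF that, of x] that by (simp add: field_simps)
  have lin: "bounded_linear (\<lambda>x. t *\<^sub>R AT t x)" if "t > 0" for t
    by (intro bounded_linear_compose[OF bounded_linear_scaleR_right AT_linear] that)
  show "M 1 \<ge> 0" unfolding M1_eq using * by (intro SUP_onorm(1)[OF lin _ C(1)]) auto
  assume t: "t > 0"
  have "norm (t *\<^sub>R AT t x) \<le> M 1 * norm x"
    unfolding M1_eq using * t by (intro SUP_onorm(2)[OF lin _ C(1)]) auto
  then show "norm (AT t x) \<le> M 1 / t * norm x" using t by (simp add: field_simps)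
qed

lemma M2_nonneg: "M 2 \<ge> 0" and A2T_le: "t > 0 \<Longrightarrow> norm (A2T t x) \<le> M 2 / t\<^sup>2 * norm x"
proof -
  obtain C where C: "C \<ge> 0" "\<And>t x. t > 0 \<Longrightarrow> norm (A2T t x) \<le> C / t\<^sup>2 * norm x" using A2T_bounded by blast
  have *: "norm (t\<^sup>2 *\<^sub>R A2T t x) \<le> C * norm x" if "t > 0" for t x
    using C(2)[OF that, of x] that by (simp add: field_simps)
  have lin: "bounded_linear (\<lambda>x. t\<^sup>2 *\<^sub>R A2T t x)" if "t > 0" for t
    by (intro bounded_linear_compose[OF bounded_linear_scaleR_right A2T_linear] that)
  show "M 2 \<ge> 0" unfolding M2_eq using * by (intro SUP_onorm(1)[OF lin _ C(1)]) auto
  assume t: "t > 0"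
  have "norm (t\<^sup>2 *\<^sub>R A2T t x) \<le> M 2 * norm x"
    unfolding M2_eq using * t by (intro SUP_onorm(2)[OF lin _ C(1)]) auto
  then show "norm (A2T t x) \<le> M 2 / t\<^sup>2 * norm x" using t by (simp add: field_simps)
qed

lemma T_tendsto: "t \<ge> 0 \<Longrightarrow> ((\<lambda>s. T s x) \<longlongrightarrow> T t x) (at t within {0..})"
  using T_continuous by (auto simp: continuous_on_def)

lemma T_tendsto_0: "((\<lambda>s. T s x) \<longlongrightarrow> x) (at_right 0)"
  using tendsto_within_subset[OF T_tendsto[of 0 x], of "{0<..}"] by force

lemma T_le: assumes "t \<ge> 0" shows "norm (T t x) \<le> M 0 * norm x"
proof (cases "t = 0")
  case True
  have "norm x \<le> M 0 * norm x"
    by (rule tendsto_upperbound[OF tendsto_norm[OF T_tendsto_0]])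
       (auto simp: eventually_at_filter T_le_pos)
  then show ?thesis using True by simp
next
  case False then show ?thesis using assms T_le_pos by simp
qed

end

section \<open>Second order Taylor remainders\<close>

lemma increment_le:
  fixes f :: "real \<Rightarrow> 'b::real_normed_vector"
  assumes ab: "0 < a" "a \<le> b"
    and f: "\<And>v. v > 0 \<Longrightarrow> (f has_vector_derivative f' v) (at v)"
    and p: "\<And>v. v > 0 \<Longrightarrow> (p has_real_derivative p' v) (at v)"
    and le: "\<And>v. a < v \<Longrightarrow> v < b \<Longrightarrow> norm (f' v) \<le> p' v"
  shows "norm (f b - f a) \<le> p b - p a"
proof (cases "a = b")
  case False
  have p': "(p has_vector_derivative p' v) (at v)" if "v > 0" for v
    using p[OF that] by (simp add: has_real_derivative_iff_has_vector_derivative)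
  show ?thesis
  proof (rule differentiable_bound_general[where f' = f' and \<phi>' = p'])
    show "continuous_on {a..b} f" "continuous_on {a..b} p"
      using ab
      by (auto intro!: continuous_at_imp_continuous_on
            intro: has_vector_derivative_continuous[OF f] has_vector_derivative_continuous[OF p'])
  qed (use ab False f p' le in auto)
qed simp

definition taylor_rem :: "(real \<Rightarrow> 'b::real_normed_vector) \<Rightarrow> (real \<Rightarrow> 'b) \<Rightarrow> real \<Rightarrow> real \<Rightarrow> 'b" where
  "taylor_rem f f' t s = f s - f t - (s - t) *\<^sub>R f' t"

context
  fixes f f1 f2 :: "real \<Rightarrow> 'b::real_normed_vector" and t s :: real
  assumes f: "\<And>v. v > 0 \<Longrightarrow> (f has_vector_derivative f1 v) (at v)"
    and f1: "\<And>v. v > 0 \<Longrightarrow> (f1 has_vector_derivative f2 v) (at v)"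
    and t: "t > 0" and s: "s > 0"
begin

lemma taylor_rem_deriv:
  "v > 0 \<Longrightarrow> (taylor_rem f f1 t has_vector_derivative (f1 v - f1 t)) (at v)"
  unfolding taylor_rem_def[abs_def] by (auto intro!: derivative_eq_intros f)

lemma taylor_rem_right:
  assumes "t \<le> s" and p: "\<And>v. v > 0 \<Longrightarrow> (p has_real_derivative p' v) (at v)"
    and le: "\<And>v. t < v \<Longrightarrow> v < s \<Longrightarrow> norm (f1 v - f1 t) \<le> p' v"
  shows "norm (taylor_rem f f1 t s) \<le> p s - p t"
  using increment_le[OF t assms(1) taylor_rem_deriv p le] by (simp add: taylor_rem_def)

lemma taylor_rem_left:
  assumes "s \<le> t" and p: "\<And>v. v > 0 \<Longrightarrow> (p has_real_derivative p' v) (at v)"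
    and le: "\<And>v. s < v \<Longrightarrow> v < t \<Longrightarrow> norm (f1 v - f1 t) \<le> p' v"
  shows "norm (taylor_rem f f1 t s) \<le> p t - p s"
  using increment_le[OF s assms(1) taylor_rem_deriv p le] by (simp add: taylor_rem_def norm_minus_commute)

lemma taylor_rem_const:
  assumes b: "\<And>v. v > 0 \<Longrightarrow> norm (f2 v) \<le> m"
  shows "norm (taylor_rem f f1 t s) \<le> m / 2 * (s - t)\<^sup>2"
proof (cases "t \<le> s")
  case True
  have "norm (f1 v - f1 t) \<le> m * v - m * t" if "t < v" for v
    using b t that
    by (intro increment_le[OF t _ f1, where p' = "\<lambda>_. m"]) (auto intro!: derivative_eq_intros)
  then have "norm (taylor_rem f f1 t s) \<le> m / 2 * (s - t)\<^sup>2 - m / 2 * (t - t)\<^sup>2"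
    by (intro taylor_rem_right[OF True, where p' = "\<lambda>v. m * v - m * t"])
       (auto intro!: derivative_eq_intros simp: field_simps)
  then show ?thesis by simp
next
  case False
  have "norm (f1 v - f1 t) \<le> m * t - m * v" if "0 < v" "v < t" for v
    unfolding norm_minus_commute[of "f1 v"] using b that
    by (intro increment_le[OF that(1) _ f1, where p' = "\<lambda>_. m"]) (auto intro!: derivative_eq_intros)
  then have "norm (taylor_rem f f1 t s) \<le> - (m / 2 * (t - t)\<^sup>2) - (- (m / 2 * (t - s)\<^sup>2))"
    using s False
    by (intro taylor_rem_left[where p' = "\<lambda>v. m * t - m * v"])
       (auto intro!: derivative_eq_intros simp: field_simps)
  then show ?thesis by (simp add: power2_commute)
qed

text \<open>The logarithmic bounds are weakened to polynomial ones by \<open>ln x \<le> x - 1\<close>; this loses nothing in the worst case,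
  \<open>s\<close> near 0, where both bounds tend to \<open>m t\<close>.\<close>

lemma taylor_rem_inverse:
  assumes b: "\<And>v. v > 0 \<Longrightarrow> norm (f2 v) \<le> m / v"
  shows "norm (taylor_rem f f1 t s) \<le> m * ((s - t)\<^sup>2 / t)"
proof -
  have m: "m \<ge> 0" using order_trans[OF norm_ge_zero b[of 1]] by simp
  show ?thesis
  proof (cases "t \<le> s")
    case True
    have "norm (f1 v - f1 t) \<le> m * (v - t) / t" if "t < v" for v
    proof -
      have "norm (f1 v - f1 t) \<le> m * ln v - m * ln t"
        using b t that
        by (intro increment_le[OF t _ f1, where p' = "\<lambda>v. m / v"]) (auto intro!: derivative_eq_intros)
      also have "\<dots> = m * ln (v / t)" using t that by (simp add: ln_div algebra_simps)
      also have "\<dots> \<le> m * (v / t - 1)"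
        using t that m by (intro mult_left_mono ln_le_minus_one) auto
      finally show ?thesis using t by (simp add: field_simps)
    qed
    then have "norm (taylor_rem f f1 t s) \<le> m / (2 * t) * (s - t)\<^sup>2 - m / (2 * t) * (t - t)\<^sup>2"
      by (intro taylor_rem_right[OF True, where p' = "\<lambda>v. m * (v - t) / t"])
         (use t in \<open>auto intro!: derivative_eq_intros simp: field_simps\<close>)
    also have "\<dots> \<le> m / t * (s - t)\<^sup>2"
      using m t by (auto intro!: mult_right_mono divide_left_mono)
    finally show ?thesis by (simp add: algebra_simps)
  next
    case False
    have "norm (f1 v - f1 t) \<le> m * (ln t - ln v)" if "0 < v" "v < t" for v
    proof -
      have "norm (f1 t - f1 v) \<le> m * ln t - m * ln v"
        using b t that
        by (intro increment_le[OF that(1) _ f1, where p' = "\<lambda>v. m / v"]) (auto intro!: derivative_eq_intros)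
      then show ?thesis by (simp add: norm_minus_commute algebra_simps)
    qed
    then have "norm (taylor_rem f f1 t s) \<le> m * (t * ln t - t * ln t + t) - m * (s * ln t - s * ln s + s)"
      using s False
      by (intro taylor_rem_left[where p' = "\<lambda>v. m * (ln t - ln v)"]) (auto intro!: derivative_eq_intros)
    also have "\<dots> = m * (t - s + s * ln (s / t))"
      using s t by (simp add: ln_div algebra_simps)
    also have "\<dots> \<le> m * (t - s + s * (s / t - 1))"
      using s t m by (intro mult_left_mono add_left_mono ln_le_minus_one) auto
    also have "\<dots> = m * ((s - t)\<^sup>2 / t)"
      using t by (simp add: field_simps power2_eq_square)
    finally show ?thesis .
  qed
qed

text \<open>For \<open>s > t\<close> the bound on \<open>f2\<close> alone gives the leading constant \<open>m2 / 2\<close>. For \<open>s < t\<close> the weight \<open>1 / v\<^sup>2\<close> exceeds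
  \<open>1 / t\<^sup>2\<close>, and the excess is absorbed into the bound on \<open>f1\<close> while \<open>s \<ge> t / 5\<close>. For smaller \<open>s\<close> the remainder is
  estimated term by term; \<open>(s - t)\<^sup>2 / t\<^sup>2\<close> is then at least \<open>16 / 25\<close>.\<close>

lemma taylor_rem_scale_invariant:
  assumes b0: "\<And>v. v > 0 \<Longrightarrow> norm (f v) \<le> m0"
    and b1: "\<And>v. v > 0 \<Longrightarrow> norm (f1 v) \<le> m1 / v"
    and b2: "\<And>v. v > 0 \<Longrightarrow> norm (f2 v) \<le> m2 / v\<^sup>2"
  shows "norm (taylor_rem f f1 t s) \<le> (3 * m0 + 3 * m1 + m2 / 2) * ((s - t) / t)\<^sup>2"
proof -
  have m0: "m0 \<ge> 0" using order_trans[OF norm_ge_zero b0[of 1]] by simp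
  have m1: "m1 \<ge> 0" using order_trans[OF norm_ge_zero b1[of 1]] by simp
  have m2: "m2 \<ge> 0" using order_trans[OF norm_ge_zero b2[of 1]] by simp
  have inc2: "norm (f1 b - f1 a) \<le> m2 / a - m2 / b" if "0 < a" "a \<le> b" for a b
  proof -
    have "norm (f1 b - f1 a) \<le> - (m2 / b) - (- (m2 / a))"
      using b2 that
      by (intro increment_le[OF that f1, where p' = "\<lambda>v. m2 / v\<^sup>2"])
         (auto intro!: derivative_eq_intros simp: power2_eq_square)
    then show ?thesis by simp
  qed
  consider "t \<le> s" | "s < t" "t / 5 \<le> s" | "s < t / 5" using s t by linarith
  then show ?thesis
  proof cases
    case 1
    have "norm (f1 v - f1 t) \<le> m2 / t\<^sup>2 * (v - t)" if "t < v" for v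
    proof -
      have "norm (f1 v - f1 t) \<le> m2 / t - m2 / v" using t that by (intro inc2) auto
      also have "\<dots> = m2 / (t * v) * (v - t)" using t that by (simp add: field_simps)
      also have "\<dots> \<le> m2 / t\<^sup>2 * (v - t)"
        using t that m2 by (intro mult_right_mono divide_left_mono) (auto simp: power2_eq_square)
      finally show ?thesis .
    qed
    then have "norm (taylor_rem f f1 t s) \<le> m2 / t\<^sup>2 / 2 * (s - t)\<^sup>2 - m2 / t\<^sup>2 / 2 * (t - t)\<^sup>2"
      by (intro taylor_rem_right[OF 1, where p' = "\<lambda>v. m2 / t\<^sup>2 * (v - t)"])
         (use t in \<open>auto intro!: derivative_eq_intros simp: field_simps power2_eq_square power4_eq_xxxx\<close>)
    also have "\<dots> = m2 / 2 * ((s - t) / t)\<^sup>2" by (simp add: power_divide)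
    also have "\<dots> \<le> (3 * m0 + 3 * m1 + m2 / 2) * ((s - t) / t)\<^sup>2"
      using m0 m1 by (intro mult_right_mono) auto
    finally show ?thesis .
  next
    case 2
    define c where "c = (6 * m1 + m2) / t\<^sup>2"
    have "norm (f1 v - f1 t) \<le> c * (t - v)" if v: "s < v" "v < t" for v
    proof -
      define X where "X = norm (f1 v - f1 t)"
      have v0: "v > 0" "t \<le> 5 * v" using v s 2 by auto
      have "X \<le> m2 / v - m2 / t"
        unfolding X_def using inc2[of v t] v v0 by (simp add: norm_minus_commute)
      then have "v * X \<le> v * (m2 / v - m2 / t)" using v0 by (intro mult_left_mono) auto
      also have "\<dots> = m2 * (t - v) / t" using v0 t by (simp add: field_simps)
      finally have 1: "v * X \<le> m2 * (t - v) / t" .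
      have "X \<le> norm (f1 v) + norm (f1 t)" unfolding X_def by (rule norm_triangle_ineq4)
      also have "\<dots> \<le> m1 / v + m1 / t" using b1 v0 t by (intro add_mono) auto
      also have "\<dots> \<le> 5 * m1 / t + m1 / t"
        using v0 t m1 by (auto simp: field_simps mult_left_mono)
      finally have "X \<le> 6 * m1 / t" by (simp add: add_divide_distrib[symmetric])
      \<comment> \<open>Split \<open>t X = v X + (t - v) X\<close>: the bound on \<open>f2\<close> for the first part, on \<open>f1\<close> for the second.\<close>
      then have "(t - v) * X \<le> (t - v) * (6 * m1 / t)" using v by (intro mult_left_mono) auto
      with 1 have "v * X + (t - v) * X \<le> m2 * (t - v) / t + (t - v) * (6 * m1 / t)" by (rule add_mono)
      then have "t * X \<le> t * (c * (t - v))"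
        using t by (simp add: c_def power2_eq_square field_simps)
      then show ?thesis using t by (simp add: X_def)
    qed
    then have "norm (taylor_rem f f1 t s) \<le> - (c / 2 * (t - t)\<^sup>2) - (- (c / 2 * (t - s)\<^sup>2))"
      using s 2
      by (intro taylor_rem_left[where p' = "\<lambda>v. c * (t - v)"])
         (auto intro!: derivative_eq_intros simp: field_simps)
    also have "\<dots> = (3 * m1 + m2 / 2) * ((s - t) / t)\<^sup>2"
      by (simp add: c_def power_divide power2_commute[of s] add_divide_distrib algebra_simps)
    also have "\<dots> \<le> (3 * m0 + 3 * m1 + m2 / 2) * ((s - t) / t)\<^sup>2"
      using m0 by (intro mult_right_mono) auto
    finally show ?thesis .
  next
    case 3
    define e where "e = (t - s) / t"
    have e: "4 / 5 \<le> e" "e \<le> 1" using 3 s t by (auto simp: e_def field_simps)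
    define a where "a = norm (f s - f t)"
    have "norm (taylor_rem f f1 t s) \<le> a + norm ((s - t) *\<^sub>R f1 t)"
      unfolding taylor_rem_def a_def by (rule norm_triangle_ineq4)
    also have "norm ((s - t) *\<^sub>R f1 t) = (t - s) * norm (f1 t)" using 3 s by simp
    also have "\<dots> \<le> (t - s) * (m1 / t)" using 3 s b1[OF t] by (intro mult_left_mono) auto
    finally have 4: "norm (taylor_rem f f1 t s) \<le> a + e * m1" by (simp add: e_def mult.commute)
    have a2: "a \<le> 2 * m0"
      unfolding a_def using norm_triangle_ineq4[of "f s" "f t"] b0[OF s] b0[OF t] by linarith
    have "a + e * m1 \<le> (3 * m0 + 3 * m1) * e\<^sup>2"
    proof (cases "s \<le> t / 6")
      case True
      then have e': "5 / 6 \<le> e" using t by (simp add: e_def field_simps)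
      then have "(5 / 6)\<^sup>2 \<le> e\<^sup>2" by (intro power_mono) auto
      then have "m0 * 2 \<le> m0 * (3 * e\<^sup>2)" by (intro mult_left_mono m0) (simp add: power2_eq_square)
      moreover have "e * 1 \<le> e * (3 * e)" using e' by (intro mult_left_mono) auto
      then have "m1 * e \<le> m1 * (3 * e\<^sup>2)" by (intro mult_left_mono m1) (simp add: power2_eq_square)
      ultimately show ?thesis using a2 by (simp add: algebra_simps)
    next
      case False
      have "a \<le> m1 * ln t - m1 * ln s"
        unfolding a_def norm_minus_commute[of "f s"] using b1 s 3 t
        by (intro increment_le[OF s _ f, where p' = "\<lambda>v. m1 / v"]) (auto intro!: derivative_eq_intros)
      also have "\<dots> = m1 * ln (t / s)" using s t by (simp add: ln_div algebra_simps)
      also have "\<dots> \<le> m1 * (t / s - 1)" using s t m1 by (intro mult_left_mono ln_le_minus_one) auto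
      also have "\<dots> \<le> m1 * 5" using False s t by (intro mult_left_mono m1) (simp add: field_simps)
      finally have a5: "a \<le> m1 * 5" .
      have e': "e \<le> 5 / 6" using False t by (simp add: e_def field_simps)
      have "(4 / 5)\<^sup>2 \<le> e\<^sup>2" using e by (intro power_mono) auto
      then have e2: "16 / 25 \<le> e\<^sup>2" by (simp add: power2_eq_square)
      have "m0 * (48 / 25) \<le> m0 * (3 * e\<^sup>2)" "m1 * (48 / 25) \<le> m1 * (3 * e\<^sup>2)" "m1 * e \<le> m1 * (5 / 6)"
        using e2 e' by (intro mult_left_mono m0 m1; simp)+
      \<comment> \<open>Neither \<open>2 m0\<close> nor \<open>5 m1\<close> alone bounds \<open>a\<close> well enough here, but \<open>a = 19/20 a + 1/20 a\<close>
        can use both.\<close>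
      then show ?thesis using a2 a5 m0 m1 by (simp add: algebra_simps)
    qed
    also have "\<dots> \<le> (3 * m0 + 3 * m1 + m2 / 2) * e\<^sup>2"
      using m2 by (intro mult_right_mono) auto
    finally show ?thesis using 4
      by (simp add: e_def power_divide power2_commute[of s])
  qed
qed

end

section \<open>Inversion of the Abel kernel\<close>

text \<open>The power function truncated to the positive half-line, so that convolutions can be written as
  integrals over the whole line.\<close>

definition kpow :: "real \<Rightarrow> real \<Rightarrow> real" where
  "kpow a t = (if t > 0 then t powr a else 0)"

lemma kpow_measurable [measurable]: "kpow a \<in> borel_measurable borel"
  unfolding kpow_def[abs_def] by measurable

lemma kpow_nonneg [simp]: "kpow a t \<ge> 0"
  by (simp add: kpow_def)

lemma kpow_scale: "c > 0 \<Longrightarrow> kpow a (c * t) = c powr a * kpow a t"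
  by (auto simp: kpow_def powr_mult zero_less_mult_iff)

lemma has_integral_nonneg_imp_bochner:
  fixes f :: "real \<Rightarrow> real"
  assumes "f \<in> borel_measurable borel" "\<And>x. 0 \<le> f x" "(f has_integral I) UNIV"
  shows "has_bochner_integral lborel f I"
proof (rule has_bochner_integral_nn_integral)
  show "0 \<le> I" using assms(2,3) by (rule has_integral_nonneg[rotated])
  show "(\<integral>\<^sup>+x. ennreal (f x) \<partial>lborel) = ennreal I" by (rule nn_integral_has_integral_lborel[OF assms])
qed (use assms in auto)

lemma gamma_integral_scaled:
  assumes a: "a > 0" and \<sigma>: "\<sigma> > 0"
  shows "has_bochner_integral lborel (\<lambda>s. kpow (a - 1) s * exp (- (s * \<sigma>))) (Gamma a * \<sigma> powr (- a))"
proof -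
  have "((\<lambda>t. if t \<in> {0..} then t powr (a - 1) / exp t else 0) has_integral Gamma a) UNIV"
    using Gamma_integral_real[OF a] by (simp only: has_integral_restrict_UNIV)
  moreover have "(\<lambda>t. if t \<in> {0..} then t powr (a - 1) / exp t else 0) = (\<lambda>t. kpow (a - 1) t * exp (- t))"
    by (auto simp: kpow_def fun_eq_iff exp_minus divide_inverse)
  ultimately have "((\<lambda>t. kpow (a - 1) t * exp (- t)) has_integral Gamma a) UNIV" by simp
  then have "has_bochner_integral lborel (\<lambda>t. kpow (a - 1) t * exp (- t)) (Gamma a)"
    by (intro has_integral_nonneg_imp_bochner) auto
  then have "has_bochner_integral lborel (\<lambda>s. kpow (a - 1) (\<sigma> * s) * exp (- (\<sigma> * s))) (Gamma a / \<sigma>)"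
    using lborel_has_bochner_integral_real_affine_iff[of \<sigma> "\<lambda>t. kpow (a - 1) t * exp (- t)" "Gamma a" 0] \<sigma>
    by (simp add: divide_inverse mult.commute)
  then have "has_bochner_integral lborel (\<lambda>s. \<sigma> powr (1 - a) * (kpow (a - 1) (\<sigma> * s) * exp (- (\<sigma> * s))))
      (\<sigma> powr (1 - a) * (Gamma a / \<sigma>))"
    by (rule has_bochner_integral_mult_right) 
  moreover have "\<sigma> powr (1 - a) * (Gamma a / \<sigma>) = Gamma a * \<sigma> powr (- a)"
    using \<sigma> by (simp add: powr_diff powr_minus divide_inverse)
  moreover have "\<sigma> powr (1 - a) * (kpow (a - 1) (\<sigma> * s) * exp (- (\<sigma> * s))) = kpow (a - 1) s * exp (- (s * \<sigma>))" for s
    using \<sigma> by (simp add: kpow_scale mult.assoc[symmetric] powr_add[symmetric] mult.commute[of s])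
  ultimately show ?thesis by simp
qed

lemma beta_integral_scaled:
  assumes a: "0 < a" "a < 1" and w: "w > 0"
  shows "has_bochner_integral lborel (\<lambda>t. kpow (a - 1) t * kpow (- a) (w - t)) (Gamma a * Gamma (1 - a))"
proof -
  have "((\<lambda>t. if t \<in> {0..1} then t powr (a - 1) * (1 - t) powr ((1 - a) - 1) else 0)
      has_integral Beta a (1 - a)) UNIV"
    using has_integral_Beta_real[of a "1 - a"] a by (simp only: has_integral_restrict_UNIV)
  moreover have "(\<lambda>t. if t \<in> {0..1} then t powr (a - 1) * (1 - t) powr ((1 - a) - 1) else 0)
      = (\<lambda>t. kpow (a - 1) t * kpow (- a) (1 - t))"
    by (auto simp: kpow_def fun_eq_iff)
  ultimately have "((\<lambda>t. kpow (a - 1) t * kpow (- a) (1 - t)) has_integral Beta a (1 - a)) UNIV" by simp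
  then have "has_bochner_integral lborel (\<lambda>t. kpow (a - 1) t * kpow (- a) (1 - t)) (Beta a (1 - a))"
    by (intro has_integral_nonneg_imp_bochner) auto
  then have "has_bochner_integral lborel (\<lambda>t. kpow (a - 1) (inverse w * t) * kpow (- a) (1 - inverse w * t)) (Beta a (1 - a) * w)"
    using lborel_has_bochner_integral_real_affine_iff[of "inverse w"
        "\<lambda>t. kpow (a - 1) t * kpow (- a) (1 - t)" "Beta a (1 - a)" 0] w
    by (simp add: mult.commute)
  moreover have "kpow (a - 1) (inverse w * t) * kpow (- a) (1 - inverse w * t)
      = kpow (a - 1) t * kpow (- a) (w - t) * w" for t
  proof -
    have "1 - inverse w * t = inverse w * (w - t)" using w by (simp add: field_simps)
    then have "kpow (a - 1) (inverse w * t) * kpow (- a) (1 - inverse w * t)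
        = (inverse w powr (a - 1) * inverse w powr (- a)) * (kpow (a - 1) t * kpow (- a) (w - t))"
      by (simp only: kpow_scale[OF positive_imp_inverse_positive[OF w]]) (simp only: mult_ac)
    also have "inverse w powr (a - 1) * inverse w powr (- a) = w"
      using w by (simp only: powr_add[symmetric]) (simp add: powr_minus)
    finally show ?thesis by (simp add: mult_ac)
  qed
  ultimately have "has_bochner_integral lborel (\<lambda>t. kpow (a - 1) t * kpow (- a) (w - t) * w) (Beta a (1 - a) * w)"
    by simp
  from has_bochner_integral_divide_zero[OF this, of w] have
    "has_bochner_integral lborel (\<lambda>t. kpow (a - 1) t * kpow (- a) (w - t)) (Beta a (1 - a))"
    using w by simp
  then show ?thesis by (simp add: Beta_def)
qed

text \<open>Integrating \<open>s\<^bsup>a-1\<^esup>\<close> against the Laplace transform of \<open>p(\<tau> + \<cdot>)\<close> gives \<open>q(\<tau>) = \<Gamma>(a) \<integral>\<sigma>\<^bsup>-a\<^esup> p(\<tau> + \<sigma>) d\<sigma>\<close>. A second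
  integration against \<open>\<tau>\<^bsup>a-1\<^esup>\<close> produces the Beta integral \<open>\<Gamma>(a) \<Gamma>(1 - a)\<close> in front of \<open>\<integral>p\<close>. The second application of
  Fubini is carried out first: it shows that the inner integrals converge for almost every \<open>\<tau>\<close>, and the first
  one is applied at such \<open>\<tau>\<close>.\<close>

theorem abel_inversion_bound:
  fixes p q b :: "real \<Rightarrow> real"
  assumes a: "0 < a" "a < 1" and p: "set_integrable lborel {0<..} p"
    and q: "\<And>\<tau>. \<tau> > 0 \<Longrightarrow>
      ((\<lambda>s. s powr (a - 1) * (LBINT \<sigma>:{0<..}. exp (- (s * \<sigma>)) * p (\<tau> + \<sigma>))) has_integral q \<tau>) {0<..}"
    and qb: "\<And>\<tau>. \<tau> > 0 \<Longrightarrow> \<bar>q \<tau>\<bar> \<le> b \<tau>"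
    and b: "has_bochner_integral lborel (\<lambda>\<tau>. kpow (a - 1) \<tau> * b \<tau>) J"
  shows "Gamma a * (Gamma a * Gamma (1 - a)) * \<bar>LBINT w:{0<..}. p w\<bar> \<le> J"
proof -
  define P where "P w = indicator {0<..} w * p w" for w :: real
  have P: "integrable lborel P"
    using p unfolding set_integrable_def P_def[abs_def] by simp
  then have [measurable]: "P \<in> borel_measurable borel" by (simp add: borel_measurable_integrable)
  define B where "B = Gamma a * Gamma (1 - a)"
  have G: "Gamma a > 0" "Gamma (1 - a) > 0" using a by (auto intro!: Gamma_real_pos)
  define F where "F w \<tau> = kpow (a - 1) \<tau> * kpow (- a) (w - \<tau>) * P w" for w \<tau>
  have kk: "has_bochner_integral lborel (\<lambda>\<tau>. kpow (a - 1) \<tau> * kpow (- a) (w - \<tau>)) (if w > 0 then B else 0)" for w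
  proof (cases "w > 0")
    case False
    then have "(\<lambda>\<tau>. kpow (a - 1) \<tau> * kpow (- a) (w - \<tau>)) = (\<lambda>\<tau>. 0)"
      by (auto simp: kpow_def fun_eq_iff)
    then show ?thesis using False by (simp add: has_bochner_integral_zero)
  qed (use beta_integral_scaled[OF a] in \<open>simp add: B_def\<close>)
  have Pw: "(if w > 0 then B else 0) * P w = B * P w" for w by (simp add: P_def)
  have Fw: "has_bochner_integral lborel (F w) (B * P w)" for w
    using has_bochner_integral_mult_left[OF kk[of w], where c = "P w"]
    unfolding F_def[abs_def] Pw by simp
  have Fnorm: "has_bochner_integral lborel (\<lambda>\<tau>. \<bar>F w \<tau>\<bar>) (B * \<bar>P w\<bar>)" for w
  proof -
    have "has_bochner_integral lborel (\<lambda>\<tau>. kpow (a - 1) \<tau> * kpow (- a) (w - \<tau>) * \<bar>P w\<bar>)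
        ((if w > 0 then B else 0) * \<bar>P w\<bar>)"
      by (intro has_bochner_integral_mult_left kk)
    moreover have "(if w > 0 then B else 0) * \<bar>P w\<bar> = B * \<bar>P w\<bar>" by (simp add: P_def)
    ultimately show ?thesis by (simp add: F_def abs_mult)
  qed
  have Fint: "integrable (lborel \<Otimes>\<^sub>M lborel) (\<lambda>(w, \<tau>). F w \<tau>)"
  proof (rule lborel_pair.Fubini_integrable)
    show "(\<lambda>(w, \<tau>). F w \<tau>) \<in> borel_measurable (lborel \<Otimes>\<^sub>M lborel)"
      unfolding F_def by measurable
    show "integrable lborel (\<lambda>w. \<integral>\<tau>. norm (case (w, \<tau>) of (w, \<tau>) \<Rightarrow> F w \<tau>) \<partial>lborel)"
      using P by (simp add: has_bochner_integral_integral_eq[OF Fnorm])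
    show "AE w in lborel. integrable lborel (\<lambda>\<tau>. case (w, \<tau>) of (w, \<tau>) \<Rightarrow> F w \<tau>)"
      using Fw by (auto simp: has_bochner_integral_iff)
  qed
  have "(\<integral>\<tau>. (\<integral>w. F w \<tau> \<partial>lborel) \<partial>lborel) = (\<integral>w. (\<integral>\<tau>. F w \<tau> \<partial>lborel) \<partial>lborel)"
    by (rule lborel_pair.Fubini_integral[OF Fint])
  also have "\<dots> = B * (\<integral>w. P w \<partial>lborel)"
    by (simp add: has_bochner_integral_integral_eq[OF Fw])
  finally have eq1: "(\<integral>\<tau>. (\<integral>w. F w \<tau> \<partial>lborel) \<partial>lborel) = B * (\<integral>w. P w \<partial>lborel)" .
  have bound: "AE \<tau> in lborel. norm (Gamma a * (\<integral>w. F w \<tau> \<partial>lborel)) \<le> kpow (a - 1) \<tau> * b \<tau>"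
    using lborel_pair.AE_integrable_snd[OF Fint]
  proof eventually_elim
    case (elim \<tau>)
    show ?case
    proof (cases "\<tau> > 0")
      case False
      then show ?thesis by (simp add: F_def kpow_def)
    next
      case True
      have k: "kpow (a - 1) \<tau> > 0" using True by (simp add: kpow_def)
      have "integrable lborel (\<lambda>w. kpow (- a) (w - \<tau>) * P w)"
        using integrable_mult_right[OF elim, of "inverse (kpow (a - 1) \<tau>)"] k
        by (simp add: F_def mult.assoc[symmetric])
      then have "has_bochner_integral lborel (\<lambda>w. kpow (- a) (w - \<tau>) * P w) (\<integral>w. kpow (- a) (w - \<tau>) * P w \<partial>lborel)"
        by (rule has_bochner_integral_integrable)
      then have R: "has_bochner_integral lborel (\<lambda>\<sigma>. kpow (- a) \<sigma> * P (\<tau> + \<sigma>)) (\<integral>w. kpow (- a) (w - \<tau>) * P w \<partial>lborel)"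
        using lborel_has_bochner_integral_real_affine_iff[of 1 "\<lambda>w. kpow (- a) (w - \<tau>) * P w" _ \<tau>] by simp
      define r where "r = (\<integral>w. kpow (- a) (w - \<tau>) * P w \<partial>lborel)"
      define H where "H \<sigma> s = kpow (a - 1) s * exp (- (s * \<sigma>)) * (indicator {0<..} \<sigma> * P (\<tau> + \<sigma>))" for \<sigma> s :: real
      have H\<sigma>: "has_bochner_integral lborel (H \<sigma>) (Gamma a * (kpow (- a) \<sigma> * P (\<tau> + \<sigma>)))" for \<sigma>
      proof (cases "\<sigma> > 0")
        case True
        from has_bochner_integral_mult_left[OF gamma_integral_scaled[OF a(1) True], of "P (\<tau> + \<sigma>)"] True
        show ?thesis by (simp add: H_def[abs_def] kpow_def mult.assoc)
      qed (simp add: H_def[abs_def] kpow_def has_bochner_integral_zero)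
      have Hn: "has_bochner_integral lborel (\<lambda>s. \<bar>H \<sigma> s\<bar>) (Gamma a * (kpow (- a) \<sigma> * \<bar>P (\<tau> + \<sigma>)\<bar>))" for \<sigma>
      proof (cases "\<sigma> > 0")
        case True
        from has_bochner_integral_mult_left[OF gamma_integral_scaled[OF a(1) True], of "\<bar>P (\<tau> + \<sigma>)\<bar>"] True
        show ?thesis by (simp add: H_def[abs_def] kpow_def mult.assoc abs_mult)
      qed (simp add: H_def[abs_def] kpow_def has_bochner_integral_zero)
      have Hint: "integrable (lborel \<Otimes>\<^sub>M lborel) (\<lambda>(\<sigma>, s). H \<sigma> s)"
      proof (rule lborel_pair.Fubini_integrable)
        show "(\<lambda>(\<sigma>, s). H \<sigma> s) \<in> borel_measurable (lborel \<Otimes>\<^sub>M lborel)"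
          unfolding H_def by measurable
        have "integrable lborel (\<lambda>\<sigma>. kpow (- a) \<sigma> * \<bar>P (\<tau> + \<sigma>)\<bar>)"
          using integrable_abs[of lborel "\<lambda>\<sigma>. kpow (- a) \<sigma> * P (\<tau> + \<sigma>)"] R
          by (simp add: has_bochner_integral_iff abs_mult)
        then show "integrable lborel (\<lambda>\<sigma>. \<integral>s. norm (case (\<sigma>, s) of (\<sigma>, s) \<Rightarrow> H \<sigma> s) \<partial>lborel)"
          by (simp add: has_bochner_integral_integral_eq[OF Hn])
        show "AE \<sigma> in lborel. integrable lborel (\<lambda>s. case (\<sigma>, s) of (\<sigma>, s) \<Rightarrow> H \<sigma> s)"
          using H\<sigma> by (auto simp: has_bochner_integral_iff)
      qed
      have "(\<integral>s. (\<integral>\<sigma>. H \<sigma> s \<partial>lborel) \<partial>lborel) = (\<integral>\<sigma>. (\<integral>s. H \<sigma> s \<partial>lborel) \<partial>lborel)"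
        by (rule lborel_pair.Fubini_integral[OF Hint])
      also have "\<dots> = Gamma a * r"
        using H\<sigma> R by (simp add: has_bochner_integral_iff r_def)
      finally have eq2: "(\<integral>s. (\<integral>\<sigma>. H \<sigma> s \<partial>lborel) \<partial>lborel) = Gamma a * r" .
      have Hs: "(\<integral>\<sigma>. H \<sigma> s \<partial>lborel) = (if s \<in> {0<..} then s powr (a - 1) * (LBINT \<sigma>:{0<..}. exp (- (s * \<sigma>)) * p (\<tau> + \<sigma>)) else 0)" for s
      proof -
        have "H \<sigma> s = kpow (a - 1) s * (indicator {0<..} \<sigma> *\<^sub>R (exp (- (s * \<sigma>)) * p (\<tau> + \<sigma>)))" for \<sigma>
          using True by (simp add: H_def P_def indicator_def)
        then show ?thesis by (simp add: set_lebesgue_integral_def kpow_def)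
      qed
      have "((\<lambda>s. \<integral>\<sigma>. H \<sigma> s \<partial>lborel) has_integral (Gamma a * r)) UNIV"
        using has_integral_integral_lborel[OF lborel_pair.integrable_snd[OF Hint]] by (simp add: eq2)
      then have "q \<tau> = Gamma a * r"
        unfolding Hs has_integral_restrict_UNIV by (rule has_integral_unique[OF q[OF True]])
      moreover have "(\<integral>w. F w \<tau> \<partial>lborel) = kpow (a - 1) \<tau> * r"
        unfolding r_def F_def by (simp add: mult.assoc)
      ultimately have "norm (Gamma a * (\<integral>w. F w \<tau> \<partial>lborel)) = kpow (a - 1) \<tau> * \<bar>q \<tau>\<bar>"
        using G by (simp add: abs_mult)
      also have "\<dots> \<le> kpow (a - 1) \<tau> * b \<tau>" by (intro mult_left_mono qb True) simp
      finally show ?thesis .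
    qed
  qed
  have "Gamma a * B * \<bar>\<integral>w. P w \<partial>lborel\<bar> = norm (\<integral>\<tau>. Gamma a * (\<integral>w. F w \<tau> \<partial>lborel) \<partial>lborel)"
    using G eq1 by (simp add: abs_mult B_def)
  also have "\<dots> \<le> (\<integral>\<tau>. norm (Gamma a * (\<integral>w. F w \<tau> \<partial>lborel)) \<partial>lborel)"
    by (rule integral_norm_bound)
  also have "\<dots> \<le> (\<integral>\<tau>. kpow (a - 1) \<tau> * b \<tau> \<partial>lborel)"
  proof (rule integral_mono_AE[OF _ _ bound])
    show "integrable lborel (\<lambda>\<tau>. norm (Gamma a * (\<integral>w. F w \<tau> \<partial>lborel)))"
      using lborel_pair.integrable_snd[OF Fint] by simp
    show "integrable lborel (\<lambda>\<tau>. kpow (a - 1) \<tau> * b \<tau>)" using b by (simp add: has_bochner_integral_iff)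
  qed
  also have "\<dots> = J" using b by (simp add: has_bochner_integral_iff)
  also have "(\<integral>w. P w \<partial>lborel) = (LBINT w:{0<..}. p w)" by (simp add: P_def set_lebesgue_integral_def)
  finally show ?thesis by (simp add: B_def)
qed

lemma FTC_halfline:
  fixes F f :: "real \<Rightarrow> real"
  assumes F: "\<And>x. x > 0 \<Longrightarrow> (F has_real_derivative f x) (at x)"
    and f: "\<And>x. x > 0 \<Longrightarrow> isCont f x" and int: "set_integrable lborel {0<..} f"
    and lim: "(F \<longlongrightarrow> A) (at_right 0)" "(F \<longlongrightarrow> B) at_top"
  shows "(LBINT x:{0<..}. f x) = B - A"
proof -
  have e: "einterval 0 \<infinity> = {0<..}" by (auto simp: einterval_def)
  have "(LBINT x=0..\<infinity>. f x) = B - A"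
  proof (rule interval_integral_FTC_integrable)
    show "(F has_vector_derivative f x) (at x)" if "0 < ereal x" for x
      using F that by (simp add: has_real_derivative_iff_has_vector_derivative)
    show "isCont f x" if "0 < ereal x" for x using f that by simp
    show "((F \<circ> real_of_ereal) \<longlongrightarrow> A) (at_right 0)"
      using lim(1) by (simp add: zero_ereal_def ereal_tendsto_simps)
    show "((F \<circ> real_of_ereal) \<longlongrightarrow> B) (at_left \<infinity>)"
      using lim(2) by (simp add: ereal_tendsto_simps)
  qed (use int in \<open>simp_all add: e\<close>)
  then show ?thesis by (simp add: interval_lebesgue_integral_def e)
qed

text \<open>A majorant for functions whose decay at infinity differs from their growth near 0.\<close>

definition two_power :: "real \<Rightarrow> real \<Rightarrow> real \<Rightarrow> real \<Rightarrow> real \<Rightarrow> real \<Rightarrow> real" where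
  "two_power a e t c d \<tau> = (if 0 < \<tau> \<and> \<tau> \<le> t then c * \<tau> powr (a - 1)
     else if t < \<tau> then d * \<tau> powr (- e - 1) else 0)"

lemma two_power_integral:
  fixes a e t c d :: real
  assumes "a > 0" "e > 0" "t > 0" "c \<ge> 0" "d \<ge> 0"
  shows "has_bochner_integral lborel (two_power a e t c d) (c * (t powr a / a) + d * (t powr (- e) / e))"
proof -
  have "((\<lambda>\<tau>. \<tau> powr (a - 1)) has_integral (t powr a / a)) {0..t}"
    using has_integral_powr_from_0[of "a - 1" t] assms by simp
  then have "((\<lambda>\<tau>. if \<tau> \<in> {0..t} then \<tau> powr (a - 1) else 0) has_integral (t powr a / a)) UNIV"
    by (simp only: has_integral_restrict_UNIV)
  then have 1: "has_bochner_integral lborel (\<lambda>\<tau>. if \<tau> \<in> {0..t} then \<tau> powr (a - 1) else 0) (t powr a / a)"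
    by (intro has_integral_nonneg_imp_bochner) auto
  have "((\<lambda>\<tau>. \<tau> powr (- e - 1)) has_integral (t powr (- e) / e)) {t..}"
    using has_integral_powr_to_inf[of "- e - 1" t] assms by simp
  then have "((\<lambda>\<tau>. if \<tau> \<in> {t..} then \<tau> powr (- e - 1) else 0) has_integral (t powr (- e) / e)) UNIV"
    by (simp only: has_integral_restrict_UNIV)
  then have 2: "has_bochner_integral lborel (\<lambda>\<tau>. if \<tau> \<in> {t..} then \<tau> powr (- e - 1) else 0) (t powr (- e) / e)"
    by (intro has_integral_nonneg_imp_bochner) auto
  define f where "f \<tau> = c * (if \<tau> \<in> {0..t} then \<tau> powr (a - 1) else 0)
      + d * (if \<tau> \<in> {t..} then \<tau> powr (- e - 1) else 0)" for \<tau>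
  let ?g = "two_power a e t c d"
  have 3: "has_bochner_integral lborel f (c * (t powr a / a) + d * (t powr (- e) / e))"
    unfolding f_def[abs_def] by (intro has_bochner_integral_add has_bochner_integral_mult_right 1 2)
  have eq: "AE \<tau> in lborel. f \<tau> = ?g \<tau>"
    using AE_lborel_singleton[of t] by eventually_elim (use assms in \<open>auto simp: f_def two_power_def\<close>)
  have "?g \<in> borel_measurable lborel" unfolding two_power_def[abs_def] by measurable
  with 3 eq show ?thesis
    using has_bochner_integral_cong_AE[of f lborel ?g] borel_measurable_has_bochner_integral[OF 3] by blast
qed

lemma Gamma_reflection_real:
  fixes a :: real
  shows "Gamma a * Gamma (1 - a) = pi / sin (pi * a)"
proof -
  have "complex_of_real (Gamma a * Gamma (1 - a)) = Gamma (complex_of_real a) * Gamma (complex_of_real (1 - a))"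
    by (simp only: of_real_mult Gamma_complex_of_real)
  also have "\<dots> = of_real pi / sin (of_real pi * of_real a)"
    using Gamma_reflection_complex[of "complex_of_real a"] by simp
  also have "\<dots> = complex_of_real (pi / sin (pi * a))"
    by (simp only: of_real_divide of_real_mult[symmetric] sin_of_real)
  finally show ?thesis by (simp only: of_real_eq_iff)
qed

text \<open>Log-convexity on \<open>1 + a < 2 < 3\<close> yields \<open>\<Gamma>(1 + a) \<ge> 2\<^bsup>a-1\<^esup>\<close>.\<close>

lemma Gamma_ge_half:
  fixes a :: real
  assumes a: "0 < a" "a < 1"
  shows "1 / 2 \<le> Gamma (1 + a)"
proof -
  define l where "l = 1 / (2 - a)"
  have l: "0 \<le> l" "l \<le> 1" "l > 0" using a by (auto simp: l_def)
  have "l * (2 - a) = 1" using a by (simp add: l_def)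
  then have comb: "(1 - l) * 3 + l * (1 + a) = 2" by (simp add: algebra_simps)
  have "(ln \<circ> Gamma) ((1 - l) *\<^sub>R 3 + l *\<^sub>R (1 + a)) \<le> (1 - l) * (ln \<circ> Gamma) 3 + l * (ln \<circ> Gamma) (1 + a)"
    using a l by (intro convex_onD[OF log_convex_Gamma_real]) auto
  moreover have "Gamma (2 :: real) = 1" "Gamma (3 :: real) = 2"
    using Gamma_fact[of 1, where 'a = real] Gamma_fact[of 2, where 'a = real] by simp_all
  ultimately have "0 \<le> (1 - l) * ln 2 + l * ln (Gamma (1 + a))"
    unfolding real_scaleR_def comb by simp
  also have "(1 - l) * ln 2 \<le> l * ln (2 :: real)"
    using a by (intro mult_right_mono) (auto simp: l_def field_simps)
  finally have "l * 0 \<le> l * (ln 2 + ln (Gamma (1 + a)))" by (simp add: algebra_simps)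
  then have "0 \<le> ln 2 + ln (Gamma (1 + a))" using l(3) by (simp only: mult_le_cancel_left_pos)
  moreover have G: "Gamma (1 + a) > 0" using a by (intro Gamma_real_pos) auto
  ultimately have "0 \<le> ln (2 * Gamma (1 + a))" by (simp add: ln_mult)
  then show ?thesis using G by (simp add: ln_ge_zero_iff)
qed

section \<open>Resolvents and the Balakrishnan operator\<close>

context bounded_holomorphic_semigroup
begin

lemma A_diff: "(x, y) \<in> A \<Longrightarrow> (x', y') \<in> A \<Longrightarrow> (x - x', y - y') \<in> A"
  using A_add[OF _ A_scale[of x' y' "-1"]] by simp

lemma T_deriv_dom: "(x, y) \<in> A \<Longrightarrow> t > 0 \<Longrightarrow> ((\<lambda>t. T t x) has_vector_derivative - T t y) (at t)"
  using T_deriv[of t x] by (simp add: AT_dom)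

lemma T_continuous_within: "a \<ge> 0 \<Longrightarrow> continuous_on {a..b} (\<lambda>t. T t x)"
  by (rule continuous_on_subset[OF T_continuous]) auto

text \<open>For \<open>(s + A) v = z\<close> the function \<open>e\<^bsup>-s\<sigma>\<^esup> T(\<sigma>) v\<close> has derivative \<open>- e\<^bsup>-s\<sigma>\<^esup> T(\<sigma>) z\<close> and tends to 0, so \<open>v\<close> is bounded by the
  integral of the latter. Uniqueness of \<open>v\<close> is the case \<open>z = 0\<close>.\<close>

lemma resolvent_norm:
  assumes s: "s > 0" and v: "(v, z - s *\<^sub>R v) \<in> A"
  shows "norm v \<le> M 0 / s * norm z"
proof -
  define C where "C = M 0 * norm z"
  have C: "C \<ge> 0" using M0_nonneg by (simp add: C_def)
  have le: "norm v \<le> exp (- (s * N)) * (M 0 * norm v) + C / s" if N: "N > 0" for N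
  proof -
    have "norm (exp (- (s * N)) *\<^sub>R T N v - exp (- (s * 0)) *\<^sub>R T 0 v)
        \<le> - (C / s * exp (- (s * N))) - (- (C / s * exp (- (s * 0))))"
    proof (rule differentiable_bound_general[OF N])
      show "continuous_on {0..N} (\<lambda>\<sigma>. exp (- (s * \<sigma>)) *\<^sub>R T \<sigma> v)"
        by (intro continuous_intros T_continuous_within) auto
      show "continuous_on {0..N} (\<lambda>\<sigma>. - (C / s * exp (- (s * \<sigma>))))"
        by (intro continuous_intros)
    next
      fix \<sigma> :: real assume \<sigma>: "0 < \<sigma>"
      have e: "((\<lambda>\<sigma>. exp (- (s * \<sigma>))) has_real_derivative - s * exp (- (s * \<sigma>))) (at \<sigma>)"
        by (auto intro!: derivative_eq_intros)
      have "((\<lambda>\<sigma>. exp (- (s * \<sigma>)) *\<^sub>R T \<sigma> v) has_vector_derivative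
          (exp (- (s * \<sigma>)) *\<^sub>R (- T \<sigma> (z - s *\<^sub>R v)) + (- s * exp (- (s * \<sigma>))) *\<^sub>R T \<sigma> v)) (at \<sigma>)"
        by (rule has_vector_derivative_scaleR[OF e T_deriv_dom[OF v \<sigma>]])
      moreover have "exp (- (s * \<sigma>)) *\<^sub>R (- T \<sigma> (z - s *\<^sub>R v)) + (- s * exp (- (s * \<sigma>))) *\<^sub>R T \<sigma> v
          = - (exp (- (s * \<sigma>)) *\<^sub>R T \<sigma> z)"
        using \<sigma> by (simp add: T_minus T_scale scaleR_diff_right mult.commute)
      ultimately show "((\<lambda>\<sigma>. exp (- (s * \<sigma>)) *\<^sub>R T \<sigma> v) has_vector_derivative - (exp (- (s * \<sigma>)) *\<^sub>R T \<sigma> z)) (at \<sigma>)"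
        by simp
      show "((\<lambda>\<sigma>. - (C / s * exp (- (s * \<sigma>)))) has_vector_derivative C * exp (- (s * \<sigma>))) (at \<sigma>)"
        using s unfolding has_real_derivative_iff_has_vector_derivative[symmetric]
        by (auto intro!: derivative_eq_intros)
      show "norm (- (exp (- (s * \<sigma>)) *\<^sub>R T \<sigma> z)) \<le> C * exp (- (s * \<sigma>))"
        using T_le_pos[OF \<sigma>, of z] by (simp add: C_def mult.commute)
    qed
    also have "\<dots> \<le> C / s" using C s by simp
    finally have "norm (exp (- (s * N)) *\<^sub>R T N v - v) \<le> C / s" by simp
    moreover have "norm v \<le> norm (exp (- (s * N)) *\<^sub>R T N v) + norm (exp (- (s * N)) *\<^sub>R T N v - v)"
      using norm_triangle_ineq4[of "exp (- (s * N)) *\<^sub>R T N v" "exp (- (s * N)) *\<^sub>R T N v - v"] by simp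
    moreover have "norm (exp (- (s * N)) *\<^sub>R T N v) \<le> exp (- (s * N)) * (M 0 * norm v)"
      using T_le_pos[OF N, of v] by simp
    ultimately show ?thesis by linarith
  qed
  have ev: "\<forall>\<^sub>F N in at_top. norm v \<le> exp (- (s * N)) * (M 0 * norm v) + C / s"
    by (rule eventually_mono[OF eventually_gt_at_top[of 0]]) (rule le)
  have "((\<lambda>N. exp (- (s * N))) \<longlongrightarrow> 0) at_top" using s by real_asymp
  then have "((\<lambda>N. exp (- (s * N)) * (M 0 * norm v) + C / s) \<longlongrightarrow> 0 * (M 0 * norm v) + C / s) at_top"
    by (intro tendsto_intros)
  from tendsto_lowerbound[OF this ev] show ?thesis by (simp add: C_def)
qed

lemma resolvent_unique:
  assumes "s > 0" "(v, z - s *\<^sub>R v) \<in> A" "(v', z - s *\<^sub>R v') \<in> A"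
  shows "v = v'"
proof -
  have "(v - v', 0 - s *\<^sub>R (v - v')) \<in> A"
    using A_diff[OF assms(2,3)] by (simp add: scaleR_diff_right)
  from resolvent_norm[OF assms(1) this] show ?thesis by simp
qed

text \<open>\<open>v\<close> is the Laplace transform of the orbit of \<open>z\<close>. It is obtained as the limit of the integrals \<open>F(r)\<close> over
  \<open>[0, r]\<close>, and the semigroup law in the form \<open>T(h) v = e\<^bsup>sh\<^esup> (v - F(h))\<close> allows \<open>A v\<close> to be computed directly.\<close>

lemma resolvent_exists:
  assumes s: "s > 0"
  shows "\<exists>v. (v, z - s *\<^sub>R v) \<in> A"
proof -
  define f where "f \<sigma> = exp (- (s * \<sigma>)) *\<^sub>R T \<sigma> z" for \<sigma>
  define F where "F r = integral {0..r} f" for r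
  define C where "C = M 0 * norm z"
  have C: "C \<ge> 0" using M0_nonneg by (simp add: C_def)
  have f_cont: "continuous_on {0..b} f" for b
    unfolding f_def by (intro continuous_intros T_continuous_within) auto
  have F_within: "(F has_vector_derivative f x) (at x within {0..b})" if "0 \<le> x" "x \<le> b" for x b
    unfolding F_def[abs_def] using that by (intro integral_has_vector_derivative f_cont) auto
  have F_deriv: "(F has_vector_derivative f x) (at x)" if "0 < x" for x
    using F_within[of x "x + 1"] that by (simp add: at_within_Icc_at)
  have F_cont: "continuous_on {a..b} F" if "0 \<le> a" for a b
  proof -
    have "continuous_on {0..b} F"
      using F_within has_vector_derivative_continuous unfolding continuous_on_eq_continuous_within
      by (metis atLeastAtMost_iff)
    then show ?thesis by (rule continuous_on_subset) (use that in auto)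
  qed
  have F_diff: "norm (F b - F a) \<le> C / s * exp (- (s * a))" if ab: "0 \<le> a" "a \<le> b" for a b
  proof (cases "a = b")
    case True then show ?thesis using C s by simp
  next
    case False
    have "norm (F b - F a) \<le> - (C / s * exp (- (s * b))) - (- (C / s * exp (- (s * a))))"
    proof (rule differentiable_bound_general[OF _ F_cont[OF ab(1)]])
      show "continuous_on {a..b} (\<lambda>\<sigma>. - (C / s * exp (- (s * \<sigma>))))" by (intro continuous_intros)
      fix \<sigma> assume "a < \<sigma>"
      with ab have \<sigma>: "0 < \<sigma>" by simp
      show "(F has_vector_derivative f \<sigma>) (at \<sigma>)" by (rule F_deriv[OF \<sigma>])
      show "((\<lambda>\<sigma>. - (C / s * exp (- (s * \<sigma>)))) has_vector_derivative C * exp (- (s * \<sigma>))) (at \<sigma>)"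
        using s unfolding has_real_derivative_iff_has_vector_derivative[symmetric]
        by (auto intro!: derivative_eq_intros)
      show "norm (f \<sigma>) \<le> C * exp (- (s * \<sigma>))"
        using T_le_pos[OF \<sigma>, of z] by (simp add: f_def C_def mult.commute)
    qed (use ab False in simp)
    also have "\<dots> \<le> C / s * exp (- (s * a))" using C s by simp
    finally show ?thesis .
  qed
  have e_lim: "((\<lambda>N. C / s * exp (- (s * N))) \<longlongrightarrow> 0) at_top" using s by real_asymp
  have "Cauchy (\<lambda>n. F (real n))"
  proof (rule CauchyI')
    fix e :: real assume "e > 0"
    then have "\<forall>\<^sub>F N in at_top. C / s * exp (- (s * N)) < e" by (rule order_tendstoD(2)[OF e_lim])
    then obtain N0 where N0: "\<And>N. N \<ge> N0 \<Longrightarrow> C / s * exp (- (s * N)) < e"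
      by (auto simp: eventually_at_top_linorder)
    obtain k where k: "N0 \<le> real k" using real_arch_simple by blast
    have "dist (F (real m)) (F (real n)) < e" if "m \<ge> k" "n > m" for m n
      using le_less_trans[OF F_diff[of "real m" "real n"] N0[of "real m"]] that k
      by (simp add: dist_norm norm_minus_commute)
    then show "\<exists>M. \<forall>m\<ge>M. \<forall>n>m. dist (F (real m)) (F (real n)) < e" by blast
  qed
  then obtain v where v: "(\<lambda>n. F (real n)) \<longlonglongrightarrow> v"
    using Cauchy_convergent_iff convergent_def by blast
  have Fh: "T h (F N) = exp (s * h) *\<^sub>R (F (N + h) - F h)" if h: "h > 0" and N: "N > 0" for h N
  proof -
    interpret Th: bounded_linear "T h" using h by (intro T_linear) auto
    define G where "G N = T h (F N) - exp (s * h) *\<^sub>R F (N + h)" for N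
    have "norm (G N - G 0) \<le> (\<lambda>_. 0 :: real) N - (\<lambda>_. 0) 0"
    proof (rule differentiable_bound_general[OF N, where f' = "\<lambda>_. 0" and \<phi>' = "\<lambda>_. 0"])
      have "continuous_on {0..N} (\<lambda>N. F (N + h))"
        by (rule continuous_on_compose2[OF F_cont[of 0 "N + h"]]) (use h in \<open>auto intro!: continuous_intros\<close>)
      then show "continuous_on {0..N} G"
        unfolding G_def by (intro continuous_intros Th.continuous_on F_cont) auto
      fix x :: real assume x: "0 < x"
      have "((\<lambda>N. N + h) has_vector_derivative 1) (at x)" by (auto intro!: derivative_eq_intros)
      from vector_diff_chain_at[OF this F_deriv] x h
      have "((\<lambda>N. F (N + h)) has_vector_derivative f (x + h)) (at x)" by (simp add: o_def)
      then have "((\<lambda>N. exp (s * h) *\<^sub>R F (N + h)) has_vector_derivative exp (s * h) *\<^sub>R f (x + h)) (at x)"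
        by (rule bounded_linear.has_vector_derivative[OF bounded_linear_scaleR_right])
      moreover have "((\<lambda>N. T h (F N)) has_vector_derivative T h (f x)) (at x)"
        by (rule Th.has_vector_derivative[OF F_deriv[OF x]])
      moreover have "T h (f x) = exp (s * h) *\<^sub>R f (x + h)"
        using x h by (simp add: f_def T_scale T_T add.commute exp_add[symmetric] algebra_simps)
      ultimately show "(G has_vector_derivative 0) (at x)"
        unfolding G_def[abs_def] using has_vector_derivative_diff by fastforce
    qed (auto intro!: continuous_intros)
    then have "G N = G 0" by simp
    moreover have "F 0 = 0" by (simp add: F_def)
    ultimately show ?thesis by (simp add: G_def Th.zero scaleR_diff_right algebra_simps)
  qed
  have Fv: "norm (v - F a) \<le> C / s * exp (- (s * a))" if a: "0 \<le> a" for a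
  proof (rule tendsto_upperbound[OF tendsto_norm[OF tendsto_diff[OF v tendsto_const]]])
    obtain k where k: "a \<le> real k" using real_arch_simple by blast
    show "\<forall>\<^sub>F n in sequentially. norm (F (real n) - F a) \<le> C / s * exp (- (s * a))"
      using eventually_ge_at_top[of k]
    proof eventually_elim
      case (elim n)
      then show ?case using k by (intro F_diff a) auto
    qed
  qed simp
  have F_top: "(F \<longlongrightarrow> v) at_top"
  proof -
    have "((\<lambda>a. F a - v) \<longlongrightarrow> 0) at_top"
      by (rule Lim_null_comparison[OF _ e_lim])
         (use Fv in \<open>auto simp: norm_minus_commute intro!: eventually_mono[OF eventually_ge_at_top[of 0]]\<close>)
    then show ?thesis by (rule LIM_zero_cancel)
  qed
  have Thv: "T h v = exp (s * h) *\<^sub>R (v - F h)" if h: "h > 0" for h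
  proof (rule tendsto_unique[of "at_top :: real filter"])
    interpret Th: bounded_linear "T h" using h by (intro T_linear) auto
    show "((\<lambda>N. T h (F N)) \<longlongrightarrow> T h v) at_top" by (rule Th.tendsto[OF F_top])
    have "((\<lambda>N. F (N + h)) \<longlongrightarrow> v) at_top"
      by (rule filterlim_compose[OF F_top]) real_asymp
    then have "((\<lambda>N. exp (s * h) *\<^sub>R (F (N + h) - F h)) \<longlongrightarrow> exp (s * h) *\<^sub>R (v - F h)) at_top"
      by (intro tendsto_intros)
    then show "((\<lambda>N. T h (F N)) \<longlongrightarrow> exp (s * h) *\<^sub>R (v - F h)) at_top"
      by (rule Lim_transform_eventually)
         (use Fh[OF h] in \<open>auto intro!: eventually_mono[OF eventually_gt_at_top[of 0]]\<close>)
  qed simp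
  have F0: "((\<lambda>h. F h /\<^sub>R h) \<longlongrightarrow> z) (at_right 0)"
  proof -
    have "((\<lambda>y. (F y - F 0) /\<^sub>R (y - 0)) \<longlongrightarrow> f 0) (at 0 within {0..1})"
      using F_within[of 0 1] unfolding has_vector_derivative_iff_tendsto by simp
    then have "((\<lambda>y. F y /\<^sub>R y) \<longlongrightarrow> z) (at 0 within {0..1})" by (simp add: F_def f_def)
    moreover have "at (0::real) within {0..1} = at_right 0" by (rule at_within_Icc_at_right) simp
    ultimately show ?thesis by simp
  qed
  have "((\<lambda>h. ((exp (s * h) - 1) / h) *\<^sub>R v - exp (s * h) *\<^sub>R (F h /\<^sub>R h)) \<longlongrightarrow> s *\<^sub>R v - 1 *\<^sub>R z) (at_right 0)"
  proof (intro tendsto_intros F0)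
    show "((\<lambda>h. (exp (s * h) - 1) / h) \<longlongrightarrow> s) (at_right 0)" using s by real_asymp
    show "((\<lambda>h. exp (s * h)) \<longlongrightarrow> 1) (at_right 0)" by (auto intro!: tendsto_eq_intros)
  qed
  then have "((\<lambda>h. (T h v - v) /\<^sub>R h) \<longlongrightarrow> - (z - s *\<^sub>R v)) (at_right 0)"
  proof (rule Lim_transform_eventually[OF tendsto_eq_rhs])
    show "\<forall>\<^sub>F h in at_right 0. ((exp (s * h) - 1) / h) *\<^sub>R v - exp (s * h) *\<^sub>R (F h /\<^sub>R h) = (T h v - v) /\<^sub>R h"
      using eventually_at_right_less[of 0]
      by eventually_elim (simp add: Thv divide_inverse scaleR_diff_right scaleR_diff_left right_diff_distrib mult.commute)
  qed simp
  then show ?thesis unfolding A_iff[symmetric] by blast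
qed

abbreviation R :: "real \<Rightarrow> 'a \<Rightarrow> 'a" where "R s \<equiv> neg_resolvent A s"

lemma R_eqI: "s > 0 \<Longrightarrow> (v, z - s *\<^sub>R v) \<in> A \<Longrightarrow> R s z = v"
  unfolding neg_resolvent_def using resolvent_unique by (intro the_equality)

lemma R_in: "s > 0 \<Longrightarrow> (R s z, z - s *\<^sub>R R s z) \<in> A"
  using resolvent_exists[of s z] R_eqI[of s _ z] by auto

lemma R_norm: "s > 0 \<Longrightarrow> norm (R s z) \<le> M 0 / s * norm z"
  by (rule resolvent_norm[OF _ R_in])

lemma R_T: "s > 0 \<Longrightarrow> t \<ge> 0 \<Longrightarrow> R s (T t z) = T t (R s z)"
  using A_T[OF R_in[of s z], of t] by (intro R_eqI) (auto simp: T_minus T_scale)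

lemma R_diff: "s > 0 \<Longrightarrow> R s (y - z) = R s y - R s z"
  using A_diff[OF R_in[of s y] R_in[of s z]] by (intro R_eqI) (auto simp: scaleR_diff_right algebra_simps)

lemma R_A:
  assumes "s > 0" "(x, y) \<in> A"
  shows "R s y = x - s *\<^sub>R R s x"
proof (rule R_eqI[OF assms(1)])
  show "(x - s *\<^sub>R R s x, y - s *\<^sub>R (x - s *\<^sub>R R s x)) \<in> A"
    by (rule A_diff[OF assms(2) A_scale[OF R_in[OF assms(1)]]])
qed

text \<open>\<open>T(\<tau>) A\<^sup>\<alpha>\<close> is bounded: under the integral \<open>(s + A)\<^sup>-\<^sup>1 A T(\<tau>) x\<close> is bounded near \<open>s = 0\<close>, and it decays like
  \<open>1 / s\<close> because \<open>A T(\<tau>)\<close> is bounded. This is what makes the Balakrishnan operator closable.\<close>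

lemma balakrishnan_smoothing:
  assumes \<alpha>: "0 < \<alpha>" "\<alpha> < 1" and xy: "(x, y) \<in> A"
    and w: "((\<lambda>s. s powr (\<alpha> - 1) *\<^sub>R R s y) has_integral w) {0<..}" and \<tau>: "\<tau> > 0"
  shows "norm (T \<tau> w) \<le> (M 0 + M 0 * M 0 + M 0 * M 1 / \<tau>) * (1 / \<alpha> + 1 / (1 - \<alpha>)) * norm x"
proof -
  define J where "J = (M 0 + M 0 * M 0 + M 0 * M 1 / \<tau>) * norm x"
  have nn: "M 0 \<ge> 0" "M 0 * M 0 \<ge> 0" "M 0 * M 1 / \<tau> \<ge> 0" using M0_nonneg M1_nonneg \<tau> by auto
  then have J: "J \<ge> 0" by (simp add: J_def)
  interpret T\<tau>: bounded_linear "T \<tau>" using \<tau> by (intro T_linear) auto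
  obtain \<phi> :: "'a \<Rightarrow> real" where \<phi>: "bounded_linear \<phi>" "\<And>x. \<bar>\<phi> x\<bar> \<le> norm x" "\<phi> (T \<tau> w) = norm (T \<tau> w)"
    by (rule norming_functional[of "T \<tau> w"]) blast
  interpret \<phi>: bounded_linear \<phi> by (rule \<phi>(1))
  have ATx: "T \<tau> (R s y) = R s (AT \<tau> x)" if "s > 0" for s
    using R_T[OF that, of \<tau> y] AT_dom[OF xy, of \<tau>] \<tau> by simp
  have b1: "norm (T \<tau> (R s y)) \<le> J" if s: "s > 0" for s
  proof -
    have "T \<tau> (R s y) = T \<tau> x - s *\<^sub>R R s (T \<tau> x)" unfolding ATx[OF s] by (rule R_A[OF s AT_in[OF \<tau>]])
    then have "norm (T \<tau> (R s y)) \<le> norm (T \<tau> x) + s * norm (R s (T \<tau> x))"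
      using norm_triangle_ineq4[of "T \<tau> x" "s *\<^sub>R R s (T \<tau> x)"] s by simp
    also have "\<dots> \<le> norm (T \<tau> x) + s * (M 0 / s * norm (T \<tau> x))"
      using s by (intro add_left_mono mult_left_mono R_norm) auto
    also have "\<dots> = (1 + M 0) * norm (T \<tau> x)" using s by (simp add: algebra_simps)
    also have "\<dots> \<le> (1 + M 0) * (M 0 * norm x)" using nn by (intro mult_left_mono T_le_pos \<tau>) auto
    also have "\<dots> = (M 0 + M 0 * M 0) * norm x" by (simp add: algebra_simps)
    also have "\<dots> \<le> J" unfolding J_def using nn by (intro mult_right_mono) auto
    finally show ?thesis .
  qed
  have b2: "norm (T \<tau> (R s y)) \<le> J / s" if s: "s > 0" for s
  proof -
    have "norm (T \<tau> (R s y)) \<le> M 0 / s * norm (AT \<tau> x)" unfolding ATx[OF s] by (rule R_norm[OF s])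
    also have "\<dots> \<le> M 0 / s * (M 1 / \<tau> * norm x)" using nn s by (intro mult_left_mono AT_le \<tau>) auto
    also have "\<dots> = M 0 * M 1 / \<tau> * norm x / s" by (simp add: mult_ac)
    also have "\<dots> \<le> J / s" unfolding J_def using nn s by (intro divide_right_mono mult_right_mono) auto
    finally show ?thesis .
  qed
  define B where "B = two_power \<alpha> (1 - \<alpha>) 1 J J"
  have "has_bochner_integral lborel B (J * (1 powr \<alpha> / \<alpha>) + J * (1 powr (- (1 - \<alpha>)) / (1 - \<alpha>)))"
    unfolding B_def using \<alpha> J by (intro two_power_integral) auto
  then have "(B has_integral (J * (1 powr \<alpha> / \<alpha>) + J * (1 powr (- (1 - \<alpha>)) / (1 - \<alpha>)))) UNIV"
    using has_integral_integral_lborel[of B] by (auto simp: has_bochner_integral_iff)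
  moreover have "B = (\<lambda>s. if s \<in> {0<..} then B s else 0)" by (auto simp: B_def two_power_def fun_eq_iff)
  ultimately have B_int: "(B has_integral (J * (1 / \<alpha> + 1 / (1 - \<alpha>)))) {0<..}"
    using has_integral_restrict_UNIV[of "{0<..}" B] by (simp add: distrib_left)
  have lin: "bounded_linear (\<lambda>z. \<phi> (T \<tau> z))" by (rule bounded_linear_compose[OF \<phi>(1) T\<tau>.bounded_linear_axioms])
  have "norm (T \<tau> w) = \<phi> (T \<tau> w)" using \<phi>(3) by simp
  also have "\<dots> \<le> J * (1 / \<alpha> + 1 / (1 - \<alpha>))"
  proof (rule has_integral_le[OF has_integral_linear[OF w lin] B_int])
    fix s :: real assume "s \<in> {0<..}"
    then have s: "s > 0" by simp
    have le: "\<phi> (T \<tau> (R s y)) \<le> norm (T \<tau> (R s y))" using \<phi>(2)[of "T \<tau> (R s y)"] by linarith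
    have "s powr (\<alpha> - 1) * \<phi> (T \<tau> (R s y)) \<le> B s"
    proof (cases "s \<le> 1")
      case True
      have "s powr (\<alpha> - 1) * \<phi> (T \<tau> (R s y)) \<le> s powr (\<alpha> - 1) * J"
        by (intro mult_left_mono order_trans[OF le b1] s) auto
      then show ?thesis using True s by (simp add: B_def two_power_def mult.commute)
    next
      case False
      have "s powr (\<alpha> - 1) * \<phi> (T \<tau> (R s y)) \<le> s powr (\<alpha> - 1) * (J / s)"
        by (intro mult_left_mono order_trans[OF le b2] s) auto
      also have "s powr (\<alpha> - 1) * (J / s) = J * (s powr (\<alpha> - 1) * s powr (- 1))"
        using s by (simp add: powr_minus divide_inverse)
      also have "s powr (\<alpha> - 1) * s powr (- 1) = s powr (- (1 - \<alpha>) - 1)"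
        by (simp only: powr_add[symmetric]) simp
      finally show ?thesis using False s by (simp add: B_def two_power_def)
    qed
    then show "((\<lambda>z. \<phi> (T \<tau> z)) \<circ> (\<lambda>s. s powr (\<alpha> - 1) *\<^sub>R R s y)) s \<le> B s"
      by (simp add: T\<tau>.scaleR \<phi>.scaleR)
  qed
  finally show ?thesis by (simp add: J_def mult_ac)
qed

definition pre_balakrishnan :: "real \<Rightarrow> ('a \<times> 'a) set" where
  "pre_balakrishnan \<alpha> = {(x, (sin (pi * \<alpha>) / pi) *\<^sub>R w) |x w.
     \<exists>y. (x, y) \<in> A \<and> ((\<lambda>s. s powr (\<alpha> - 1) *\<^sub>R R s y) has_integral w) {0<..}}"

lemma balakrishnan_eq: "balakrishnan A \<alpha> = closure (pre_balakrishnan \<alpha>)"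
  by (simp add: balakrishnan_def pre_balakrishnan_def)

lemma pre_balakrishnan_diff:
  assumes "(x, y) \<in> pre_balakrishnan \<alpha>" "(x', y') \<in> pre_balakrishnan \<alpha>"
  shows "(x - x', y - y') \<in> pre_balakrishnan \<alpha>"
proof -
  obtain w z where 1: "y = (sin (pi * \<alpha>) / pi) *\<^sub>R w" "(x, z) \<in> A"
    "((\<lambda>s. s powr (\<alpha> - 1) *\<^sub>R R s z) has_integral w) {0<..}"
    using assms(1) by (auto simp: pre_balakrishnan_def)
  obtain w' z' where 2: "y' = (sin (pi * \<alpha>) / pi) *\<^sub>R w'" "(x', z') \<in> A"
    "((\<lambda>s. s powr (\<alpha> - 1) *\<^sub>R R s z') has_integral w') {0<..}"
    using assms(2) by (auto simp: pre_balakrishnan_def)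
  have "((\<lambda>s. s powr (\<alpha> - 1) *\<^sub>R R s z - s powr (\<alpha> - 1) *\<^sub>R R s z') has_integral (w - w')) {0<..}"
    by (rule has_integral_diff[OF 1(3) 2(3)])
  then have "((\<lambda>s. s powr (\<alpha> - 1) *\<^sub>R R s (z - z')) has_integral (w - w')) {0<..}"
    by (rule has_integral_eq[rotated]) (simp add: R_diff scaleR_diff_right)
  with A_diff[OF 1(2) 2(2)] show ?thesis
    unfolding pre_balakrishnan_def 1(1) 2(1) scaleR_diff_right[symmetric] by blast
qed

text \<open>Two values at the same point are limits along sequences in the domain whose difference tends to 0; since
  \<open>T(\<tau>) A\<^sup>\<alpha>\<close> is bounded, \<open>T(\<tau>)\<close> annihilates the difference of the values for every \<open>\<tau> > 0\<close>.\<close>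

lemma balakrishnan_unique:
  assumes \<alpha>: "0 < \<alpha>" "\<alpha> < 1" and "(x, y) \<in> balakrishnan A \<alpha>" "(x, y') \<in> balakrishnan A \<alpha>"
  shows "y = y'"
proof -
  obtain f where f: "\<And>n. f n \<in> pre_balakrishnan \<alpha>" "f \<longlonglongrightarrow> (x, y)"
    using assms(3) unfolding balakrishnan_eq closure_sequential by blast
  obtain g where g: "\<And>n. g n \<in> pre_balakrishnan \<alpha>" "g \<longlonglongrightarrow> (x, y')"
    using assms(4) unfolding balakrishnan_eq closure_sequential by blast
  define a where "a n = fst (f n) - fst (g n)" for n
  define b where "b n = snd (f n) - snd (g n)" for n
  have ab: "(a n, b n) \<in> pre_balakrishnan \<alpha>" for n
    unfolding a_def b_def using f(1)[of n] g(1)[of n] by (intro pre_balakrishnan_diff) auto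
  have a: "a \<longlonglongrightarrow> 0"
    unfolding a_def[abs_def] using tendsto_diff[OF tendsto_fst[OF f(2)] tendsto_fst[OF g(2)]] by simp
  have b: "b \<longlonglongrightarrow> y - y'"
    unfolding b_def[abs_def] using tendsto_diff[OF tendsto_snd[OF f(2)] tendsto_snd[OF g(2)]] by simp
  have zero: "T \<tau> (y - y') = 0" if \<tau>: "\<tau> > 0" for \<tau>
  proof -
    interpret T\<tau>: bounded_linear "T \<tau>" using \<tau> by (intro T_linear) auto
    define J where "J = \<bar>sin (pi * \<alpha>) / pi\<bar> * ((M 0 + M 0 * M 0 + M 0 * M 1 / \<tau>) * (1 / \<alpha> + 1 / (1 - \<alpha>)))"
    have le: "norm (T \<tau> (b n)) \<le> J * norm (a n)" for n
    proof -
      obtain w z where w: "b n = (sin (pi * \<alpha>) / pi) *\<^sub>R w" "(a n, z) \<in> A"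
        "((\<lambda>s. s powr (\<alpha> - 1) *\<^sub>R R s z) has_integral w) {0<..}"
        using ab[of n] by (auto simp: pre_balakrishnan_def)
      have "norm (T \<tau> (b n)) = \<bar>sin (pi * \<alpha>) / pi\<bar> * norm (T \<tau> w)" by (simp add: w(1) T\<tau>.scaleR)
      also have "\<dots> \<le> \<bar>sin (pi * \<alpha>) / pi\<bar> * ((M 0 + M 0 * M 0 + M 0 * M 1 / \<tau>) * (1 / \<alpha> + 1 / (1 - \<alpha>)) * norm (a n))"
        by (intro mult_left_mono balakrishnan_smoothing[OF \<alpha> w(2,3) \<tau>]) auto
      finally show ?thesis by (simp add: J_def mult_ac)
    qed
    have "(\<lambda>n. T \<tau> (b n)) \<longlonglongrightarrow> 0"
    proof (rule Lim_null_comparison)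
      show "\<forall>\<^sub>F n in sequentially. norm (T \<tau> (b n)) \<le> J * norm (a n)" using le by simp
      show "(\<lambda>n. J * norm (a n)) \<longlonglongrightarrow> 0" using tendsto_mult_right_zero[OF tendsto_norm_zero[OF a]] .
    qed
    then show ?thesis using T\<tau>.tendsto[OF b] by (rule LIMSEQ_unique[rotated])
  qed
  have "((\<lambda>\<tau>. T \<tau> (y - y')) \<longlongrightarrow> 0) (at_right 0)"
    by (rule tendsto_eventually) (auto simp: eventually_at_filter zero)
  from tendsto_unique[OF trivial_limit_at_right_real T_tendsto_0 this] show ?thesis by simp
qed


section \<open>Taylor remainders of the orbits\<close>

text \<open>\<open>Rem t s x\<close> is the error of the first order Taylor expansion at \<open>t\<close> of the orbit of \<open>x\<close>, evaluated at \<open>s\<close>.\<close>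

definition Rem :: "real \<Rightarrow> real \<Rightarrow> 'a \<Rightarrow> 'a" where
  "Rem t s x = T s x - T t x + (s - t) *\<^sub>R AT t x"

lemma Rem_eq: "taylor_rem (\<lambda>v. T v x) (\<lambda>v. - AT v x) t s = Rem t s x"
  by (simp add: taylor_rem_def Rem_def)

lemma Rem_linear: "t > 0 \<Longrightarrow> s \<ge> 0 \<Longrightarrow> bounded_linear (Rem t s)"
  unfolding Rem_def[abs_def]
  by (intro bounded_linear_add bounded_linear_sub bounded_linear_compose[OF bounded_linear_scaleR_right]
        T_linear AT_linear) auto

lemma AT_neg_deriv: "v > 0 \<Longrightarrow> ((\<lambda>v. - AT v x) has_vector_derivative A2T v x) (at v)"
  using has_vector_derivative_minus[OF AT_deriv[of v x]] by simp

lemma A2T_T: "u \<ge> 0 \<Longrightarrow> v > 0 \<Longrightarrow> A2T v (T u x) = A2T (u + v) x"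
  using AT_AT[of "v / 2" "u + v / 2" x] by (simp add: A2T_def AT_T add.commute add.left_commute)

lemma A2T_dom: "(x, y) \<in> A \<Longrightarrow> v > 0 \<Longrightarrow> A2T v x = AT v y"
  by (simp add: A2T_def AT_dom AT_T)

text \<open>The Taylor estimates concern \<open>s > 0\<close>, where orbits are differentiable; strong continuity adds \<open>s = 0\<close>, which
  the measure may charge.\<close>

lemma Rem_at_0:
  assumes t: "t > 0" and le: "\<And>s. s > 0 \<Longrightarrow> norm (Rem t s x) \<le> c * (s - t)\<^sup>2" and s: "s \<ge> 0"
  shows "norm (Rem t s x) \<le> c * (s - t)\<^sup>2"
proof (cases "s = 0")
  case True
  have "((\<lambda>s. Rem t s x) \<longlongrightarrow> x - T t x + (0 - t) *\<^sub>R AT t x) (at_right 0)"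
    unfolding Rem_def by (intro tendsto_intros T_tendsto_0)
  then have "((\<lambda>s. norm (Rem t s x)) \<longlongrightarrow> norm (Rem t 0 x)) (at_right 0)"
    by (intro tendsto_norm) (simp add: Rem_def)
  moreover have "((\<lambda>s. c * (s - t)\<^sup>2) \<longlongrightarrow> c * (0 - t)\<^sup>2) (at_right 0)" by (intro tendsto_intros)
  moreover have "\<forall>\<^sub>F s in at_right 0. norm (Rem t s x) \<le> c * (s - t)\<^sup>2"
    by (auto simp: eventually_at_filter le)
  ultimately show ?thesis unfolding True by (intro tendsto_le[OF trivial_limit_at_right_real])
qed (use s le in simp)

definition K :: real where "K = 3 * M 0 + 3 * M 1 + M 2 / 2"

lemma K_nonneg: "K \<ge> 0"
  using M0_nonneg M1_nonneg M2_nonneg by (simp add: K_def)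

text \<open>Orbits started at \<open>T(u) x\<close> satisfy the scale invariant bounds uniformly in \<open>u\<close>.\<close>

lemma Rem_T_le:
  assumes t: "t > 0" and s: "s > 0" and u: "u \<ge> 0"
  shows "norm (Rem t s (T u x)) \<le> K * norm x / t\<^sup>2 * (s - t)\<^sup>2"
proof -
  have pos: "u + v > 0" "v \<le> u + v" if "v > 0" for v using u that by auto
  have "norm (taylor_rem (\<lambda>v. T v (T u x)) (\<lambda>v. - AT v (T u x)) t s)
      \<le> (3 * (M 0 * norm x) + 3 * (M 1 * norm x) + (M 2 * norm x) / 2) * ((s - t) / t)\<^sup>2"
  proof (rule taylor_rem_scale_invariant[OF T_deriv AT_neg_deriv t s])
    fix v :: real assume v: "v > 0"
    show "norm (T v (T u x)) \<le> M 0 * norm x" using T_le_pos[of "v + u" x] v u by (simp add: T_T)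
    have "norm (AT v (T u x)) \<le> M 1 / (u + v) * norm x" using AT_le[OF pos(1)[OF v]] u v by (simp add: AT_T)
    also have "\<dots> \<le> M 1 / v * norm x"
      using v u M1_nonneg by (intro mult_right_mono divide_left_mono) auto
    finally show "norm (- AT v (T u x)) \<le> M 1 * norm x / v" by simp
    have "norm (A2T v (T u x)) \<le> M 2 / (u + v)\<^sup>2 * norm x" using A2T_le[OF pos(1)[OF v]] u v by (simp add: A2T_T)
    also have "\<dots> \<le> M 2 / v\<^sup>2 * norm x"
      using v u M2_nonneg by (intro mult_right_mono divide_left_mono power_mono) auto
    finally show "norm (A2T v (T u x)) \<le> M 2 * norm x / v\<^sup>2" by simp
  qed
  moreover have "3 * (M 0 * norm x) + 3 * (M 1 * norm x) + (M 2 * norm x) / 2 = K * norm x"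
    by (simp add: K_def algebra_simps)
  ultimately show ?thesis unfolding Rem_eq by (simp only: power_divide) simp
qed

lemma Rem_le:
  assumes t: "t > 0" and s: "s \<ge> 0"
  shows "norm (Rem t s x) \<le> K * norm x / t\<^sup>2 * (s - t)\<^sup>2"
proof (rule Rem_at_0[OF t _ s])
  fix s :: real assume "s > 0"
  from Rem_T_le[OF t this, of 0 x] show "norm (Rem t s x) \<le> K * norm x / t\<^sup>2 * (s - t)\<^sup>2" by simp
qed

lemma Rem_T_decay:
  assumes t: "t > 0" and s: "s > 0" and u: "u > 0"
  shows "norm (Rem t s (T u x)) \<le> M 2 / 2 * (s - t)\<^sup>2 * norm x / u\<^sup>2"
proof -
  have "norm (taylor_rem (\<lambda>v. T v (T u x)) (\<lambda>v. - AT v (T u x)) t s)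
      \<le> (M 2 / u\<^sup>2 * norm x) / 2 * (s - t)\<^sup>2"
  proof (rule taylor_rem_const[OF T_deriv AT_neg_deriv t s])
    fix v :: real assume v: "v > 0"
    have "norm (A2T v (T u x)) \<le> M 2 / (u + v)\<^sup>2 * norm x" using A2T_le[of "u + v"] u v by (simp add: A2T_T)
    also have "\<dots> \<le> M 2 / u\<^sup>2 * norm x"
      using v u M2_nonneg by (intro mult_right_mono divide_left_mono power_mono) auto
    finally show "norm (A2T v (T u x)) \<le> M 2 / u\<^sup>2 * norm x" .
  qed
  then show ?thesis unfolding Rem_eq by (simp add: mult_ac)
qed

lemma Rem_dom_le:
  assumes t: "t > 0" and s: "s \<ge> 0" and xy: "(x, y) \<in> A"
  shows "norm (Rem t s x) \<le> M 1 * norm y / t * (s - t)\<^sup>2"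
proof (rule Rem_at_0[OF t _ s])
  fix s :: real assume s: "s > 0"
  have "norm (taylor_rem (\<lambda>v. T v x) (\<lambda>v. - AT v x) t s) \<le> (M 1 * norm y) * ((s - t)\<^sup>2 / t)"
  proof (rule taylor_rem_inverse[OF T_deriv AT_neg_deriv t s])
    fix v :: real assume v: "v > 0"
    show "norm (A2T v x) \<le> M 1 * norm y / v" using AT_le[OF v, of y] by (simp add: A2T_dom[OF xy v])
  qed
  then show "norm (Rem t s x) \<le> M 1 * norm y / t * (s - t)\<^sup>2" unfolding Rem_eq by simp
qed

text \<open>Formally \<open>x = \<Gamma>(\<alpha>)\<^sup>-\<^sup>1 \<integral>\<tau>\<^bsup>\<alpha>-1\<^esup> T(\<tau>) A\<^sup>\<alpha>x d\<tau>\<close>, and this integral converges after \<open>Rem t s\<close> is applied, because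
  \<open>Rem t s (T(\<tau>) z)\<close> is bounded for \<open>\<tau> \<le> t\<close> and decays like \<open>1 / \<tau>\<^sup>2\<close> beyond. The formula is
  justified after composition with a norming functional, by inverting the Abel kernel. The two ranges of \<open>\<tau>\<close>
  contribute at most \<open>K\<close> each, and \<open>\<Gamma>(1 + \<alpha>) \<ge> 1/2\<close> doubles the sum to the constant \<open>4 K\<close>.\<close>

lemma Rem_pre_balakrishnan_le:
  assumes \<alpha>: "0 < \<alpha>" "\<alpha> < 1" and t: "t > 0" and s: "s > 0" and xz: "(x, z) \<in> pre_balakrishnan \<alpha>"
  shows "norm (Rem t s x) \<le> 4 * K * t powr \<alpha> * norm z / t\<^sup>2 * (s - t)\<^sup>2"
proof -
  obtain w y where z: "z = (sin (pi * \<alpha>) / pi) *\<^sub>R w" and xy: "(x, y) \<in> A"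
    and w: "((\<lambda>r. r powr (\<alpha> - 1) *\<^sub>R R r y) has_integral w) {0<..}"
    using xz by (auto simp: pre_balakrishnan_def)
  obtain \<phi> :: "'a \<Rightarrow> real" where \<phi>: "bounded_linear \<phi>" "\<And>x. \<bar>\<phi> x\<bar> \<le> norm x" "\<phi> (Rem t s x) = norm (Rem t s x)"
    by (rule norming_functional[of "Rem t s x"]) blast
  have s0: "s \<ge> 0" using s by simp
  define \<Psi> where "\<Psi> z = \<phi> (Rem t s z)" for z
  have lin: "bounded_linear \<Psi>"
    unfolding \<Psi>_def[abs_def] by (rule bounded_linear_compose[OF \<phi>(1) Rem_linear[OF t s0]])
  interpret \<Psi>: bounded_linear \<Psi> by (rule lin)
  have \<Psi>_le: "\<bar>\<Psi> z\<bar> \<le> norm (Rem t s z)" for z unfolding \<Psi>_def by (rule \<phi>(2))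
  define c1 where "c1 = K / t\<^sup>2 * (s - t)\<^sup>2"
  define c2 where "c2 = M 2 / 2 * (s - t)\<^sup>2"
  have c: "c1 \<ge> 0" "c2 \<ge> 0" using K_nonneg M2_nonneg by (auto simp: c1_def c2_def)
  have near: "\<bar>\<Psi> (T u a)\<bar> \<le> c1 * norm a" if "u \<ge> 0" for u a
    using order_trans[OF \<Psi>_le Rem_T_le[OF t s that]] by (simp add: c1_def mult_ac)
  have far: "\<bar>\<Psi> (T u a)\<bar> \<le> c2 * norm a / u\<^sup>2" if "u > 0" for u a
    using order_trans[OF \<Psi>_le Rem_T_decay[OF t s that]] by (simp add: c2_def mult_ac)
  have deriv: "((\<lambda>u. \<Psi> (T u a)) has_real_derivative - \<Psi> (T u b)) (at u)" if "(a, b) \<in> A" "u > 0" for a b u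
    using \<Psi>.has_vector_derivative[OF T_deriv_dom[OF that]]
    by (simp add: \<Psi>.neg has_real_derivative_iff_has_vector_derivative)
  have cont: "isCont (\<lambda>u. \<Psi> (T u a)) u" if "u > 0" for a u
    using has_vector_derivative_continuous[OF \<Psi>.has_vector_derivative[OF T_deriv[OF that]]] .
  define p where "p u = \<Psi> (T u y)" for u
  have p_meas: "set_borel_measurable lborel {0<..} p"
    unfolding set_borel_measurable_def p_def
    using borel_measurable_continuous_on_indicator[of "{0<..}" "\<lambda>u. \<Psi> (T u y)"] cont
    by (auto intro!: continuous_at_imp_continuous_on)
  have p_int: "set_integrable lborel {0<..} p"
    unfolding set_integrable_def
  proof (rule Bochner_Integration.integrable_bound)
    show "integrable lborel (two_power 1 1 1 (c1 * norm y) (c2 * norm y))"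
      using two_power_integral[of 1 1 1 "c1 * norm y" "c2 * norm y"] c
      by (auto simp only: has_bochner_integral_iff zero_less_one mult_nonneg_nonneg norm_ge_zero)
    show "(\<lambda>u. indicator {0<..} u *\<^sub>R p u) \<in> borel_measurable lborel"
      using p_meas by (simp add: set_borel_measurable_def)
    show "AE u in lborel. norm (indicator {0<..} u *\<^sub>R p u) \<le> norm (two_power 1 1 1 (c1 * norm y) (c2 * norm y) u)"
    proof (rule AE_I2)
      fix u :: real
      have "u powr (- 1 - 1) = 1 / u\<^sup>2" if "u > 0"
        using that powr_realpow[of u 2] by (simp add: powr_minus divide_inverse)
      then show "norm (indicator {0<..} u *\<^sub>R p u) \<le> norm (two_power 1 1 1 (c1 * norm y) (c2 * norm y) u)"
        using near[of u y] far[of u y] c by (auto simp: two_power_def p_def indicator_def abs_mult)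
    qed
  qed
  have lap: "(LBINT \<sigma>:{0<..}. exp (- (r * \<sigma>)) * p (\<tau> + \<sigma>)) = \<Psi> (T \<tau> (R r y))" if \<tau>: "\<tau> > 0" and r: "r > 0" for \<tau> r
  proof -
    define v where "v = R r y"
    have v: "(v, y - r *\<^sub>R v) \<in> A" unfolding v_def by (rule R_in[OF r])
    have "(LBINT \<sigma>:{0<..}. exp (- (r * \<sigma>)) * p (\<tau> + \<sigma>)) = 0 - (- \<Psi> (T \<tau> v))"
    proof (rule FTC_halfline[where F = "\<lambda>\<sigma>. - (exp (- (r * \<sigma>)) * \<Psi> (T (\<tau> + \<sigma>) v))"])
      fix \<sigma> :: real assume \<sigma>: "\<sigma> > 0"
      have pos: "\<tau> + \<sigma> > 0" using \<tau> \<sigma> by simp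
      have e: "((\<lambda>\<sigma>. exp (- (r * \<sigma>))) has_real_derivative - r * exp (- (r * \<sigma>))) (at \<sigma>)"
        by (auto intro!: derivative_eq_intros)
      have a: "((\<lambda>\<sigma>. \<tau> + \<sigma>) has_real_derivative 1) (at \<sigma>)" by (auto intro!: derivative_eq_intros)
      have d: "((\<lambda>\<sigma>. \<Psi> (T (\<tau> + \<sigma>) v)) has_real_derivative - \<Psi> (T (\<tau> + \<sigma>) (y - r *\<^sub>R v)) * 1) (at \<sigma>)"
        by (rule DERIV_chain2[OF deriv[OF v pos] a])
      have eqn: "\<Psi> (T (\<tau> + \<sigma>) (y - r *\<^sub>R v)) = p (\<tau> + \<sigma>) - r * \<Psi> (T (\<tau> + \<sigma>) v)"
        using pos by (simp add: T_minus T_scale \<Psi>.diff \<Psi>.scaleR p_def)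
      show "((\<lambda>\<sigma>. - (exp (- (r * \<sigma>)) * \<Psi> (T (\<tau> + \<sigma>) v))) has_real_derivative exp (- (r * \<sigma>)) * p (\<tau> + \<sigma>)) (at \<sigma>)"
        by (rule DERIV_cong[OF DERIV_minus[OF DERIV_mult[OF e d]]])
           (simp only: eqn, simp add: algebra_simps)
      have "isCont p (\<tau> + \<sigma>)" using cont[OF pos, of y] by (simp add: p_def[abs_def])
      moreover have "isCont (\<lambda>\<sigma>. \<tau> + \<sigma>) \<sigma>" by (intro continuous_intros)
      ultimately have "isCont (\<lambda>\<sigma>. p (\<tau> + \<sigma>)) \<sigma>"
        using isCont_o2[of \<sigma> "\<lambda>\<sigma>. \<tau> + \<sigma>" p] by blast
      then show "isCont (\<lambda>\<sigma>. exp (- (r * \<sigma>)) * p (\<tau> + \<sigma>)) \<sigma>"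
        by (intro continuous_intros)
    next
      have "integrable lborel (\<lambda>\<sigma>. kpow (1 - 1) \<sigma> * exp (- (\<sigma> * r)))"
        using gamma_integral_scaled[of 1 r] r by (simp add: has_bochner_integral_iff)
      then have dom: "integrable lborel (\<lambda>\<sigma>. c1 * norm y * (kpow (1 - 1) \<sigma> * exp (- (\<sigma> * r))))"
        by (rule integrable_mult_right)
      show "set_integrable lborel {0<..} (\<lambda>\<sigma>. exp (- (r * \<sigma>)) * p (\<tau> + \<sigma>))"
        unfolding set_integrable_def
      proof (rule Bochner_Integration.integrable_bound[OF dom])
        have "continuous_on {0<..} (\<lambda>\<sigma>. exp (- (r * \<sigma>)) * p (\<tau> + \<sigma>))"
        proof (intro continuous_intros)
          have "continuous_on {0<..} p"
            using cont by (auto simp: p_def[abs_def] intro!: continuous_at_imp_continuous_on)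
          then show "continuous_on {0<..} (\<lambda>\<sigma>. p (\<tau> + \<sigma>))"
            by (rule continuous_on_compose2) (use \<tau> in \<open>auto intro!: continuous_intros\<close>)
        qed
        from borel_measurable_continuous_on_indicator[OF _ this]
        show "(\<lambda>\<sigma>. indicator {0<..} \<sigma> *\<^sub>R (exp (- (r * \<sigma>)) * p (\<tau> + \<sigma>))) \<in> borel_measurable lborel"
          by simp
        show "AE \<sigma> in lborel. norm (indicator {0<..} \<sigma> *\<^sub>R (exp (- (r * \<sigma>)) * p (\<tau> + \<sigma>)))
            \<le> norm (c1 * norm y * (kpow (1 - 1) \<sigma> * exp (- (\<sigma> * r))))"
        proof (rule AE_I2)
          fix \<sigma> :: real
          show "norm (indicator {0<..} \<sigma> *\<^sub>R (exp (- (r * \<sigma>)) * p (\<tau> + \<sigma>)))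
              \<le> norm (c1 * norm y * (kpow (1 - 1) \<sigma> * exp (- (\<sigma> * r))))"
            using near[of "\<tau> + \<sigma>" y] c \<tau> by (cases "\<sigma> > 0") (auto simp: p_def kpow_def abs_mult mult.commute)
        qed
      qed
      have "((\<lambda>\<sigma>. \<Psi> (T (\<tau> + \<sigma>) v)) \<longlongrightarrow> \<Psi> (T \<tau> v)) (at 0)"
        using cont[OF \<tau>, of v] by (simp add: isCont_def LIM_offset_zero_iff)
      then have "((\<lambda>\<sigma>. \<Psi> (T (\<tau> + \<sigma>) v)) \<longlongrightarrow> \<Psi> (T \<tau> v)) (at_right 0)"
        by (rule tendsto_within_subset) auto
      then have "((\<lambda>\<sigma>. - (exp (- (r * \<sigma>)) * \<Psi> (T (\<tau> + \<sigma>) v))) \<longlongrightarrow> - (exp (- (r * 0)) * \<Psi> (T \<tau> v))) (at_right 0)"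
        by (intro tendsto_intros)
      then show "((\<lambda>\<sigma>. - (exp (- (r * \<sigma>)) * \<Psi> (T (\<tau> + \<sigma>) v))) \<longlongrightarrow> - \<Psi> (T \<tau> v)) (at_right 0)" by simp
      show "((\<lambda>\<sigma>. - (exp (- (r * \<sigma>)) * \<Psi> (T (\<tau> + \<sigma>) v))) \<longlongrightarrow> 0) at_top"
      proof (rule Lim_null_comparison)
        show "((\<lambda>\<sigma>. exp (- (r * \<sigma>)) * (c1 * norm v)) \<longlongrightarrow> 0) at_top"
          using r by (intro tendsto_mult_left_zero) real_asymp
        show "\<forall>\<^sub>F \<sigma> in at_top. norm (- (exp (- (r * \<sigma>)) * \<Psi> (T (\<tau> + \<sigma>) v))) \<le> exp (- (r * \<sigma>)) * (c1 * norm v)"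
          using eventually_gt_at_top[of 0]
          by eventually_elim (use near[of _ v] \<tau> in \<open>simp add: abs_mult\<close>)
      qed
    qed
    then show ?thesis by (simp add: v_def)
  qed
  have total: "(LBINT u:{0<..}. p u) = norm (Rem t s x)"
  proof -
    have "(LBINT u:{0<..}. p u) = 0 - (- \<Psi> x)"
    proof (rule FTC_halfline[where F = "\<lambda>u. - \<Psi> (T u x)"])
      show "((\<lambda>u. - \<Psi> (T u x)) has_real_derivative p u) (at u)" if "u > 0" for u
        using DERIV_minus[OF deriv[OF xy that]] by (simp add: p_def)
      show "isCont p u" if "u > 0" for u using cont[OF that, of y] by (simp add: p_def[abs_def])
      show "((\<lambda>u. - \<Psi> (T u x)) \<longlongrightarrow> - \<Psi> x) (at_right 0)"
        by (intro tendsto_minus \<Psi>.tendsto T_tendsto_0)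
      show "((\<lambda>u. - \<Psi> (T u x)) \<longlongrightarrow> 0) at_top"
      proof (rule Lim_null_comparison)
        show "((\<lambda>u. c2 * norm x / u\<^sup>2) \<longlongrightarrow> 0) at_top" by real_asymp
        show "\<forall>\<^sub>F u in at_top. norm (- \<Psi> (T u x)) \<le> c2 * norm x / u\<^sup>2"
          using eventually_gt_at_top[of 0] by eventually_elim (use far[of _ x] in simp)
      qed
    qed (rule p_int)
    then show ?thesis using \<phi>(3) by (simp add: \<Psi>_def)
  qed
  define b where "b \<tau> = (if \<tau> \<le> t then c1 * norm w else c2 * norm w / \<tau>\<^sup>2)" for \<tau>
  have "Gamma \<alpha> * (Gamma \<alpha> * Gamma (1 - \<alpha>)) * \<bar>LBINT u:{0<..}. p u\<bar>
      \<le> (c1 * norm w) * (t powr \<alpha> / \<alpha>) + (c2 * norm w) * (t powr (- (2 - \<alpha>)) / (2 - \<alpha>))"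
  proof (rule abel_inversion_bound[OF \<alpha> p_int, where q = "\<lambda>\<tau>. \<Psi> (T \<tau> w)" and b = b])
    fix \<tau> :: real assume \<tau>: "\<tau> > 0"
    have "bounded_linear (\<lambda>z. \<Psi> (T \<tau> z))"
      using \<tau> by (intro bounded_linear_compose[OF lin T_linear]) auto
    from has_integral_linear[OF w this]
    have "((\<lambda>r. \<Psi> (T \<tau> (r powr (\<alpha> - 1) *\<^sub>R R r y))) has_integral \<Psi> (T \<tau> w)) {0<..}" by (simp add: o_def)
    then show "((\<lambda>r. r powr (\<alpha> - 1) * (LBINT \<sigma>:{0<..}. exp (- (r * \<sigma>)) * p (\<tau> + \<sigma>))) has_integral \<Psi> (T \<tau> w)) {0<..}"
      by (rule has_integral_eq[rotated]) (use \<tau> in \<open>simp add: lap T_scale \<Psi>.scaleR\<close>)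
    show "\<bar>\<Psi> (T \<tau> w)\<bar> \<le> b \<tau>" using near[of \<tau> w] far[OF \<tau>, of w] \<tau> by (simp add: b_def)
  next
    have "has_bochner_integral lborel (two_power \<alpha> (2 - \<alpha>) t (c1 * norm w) (c2 * norm w))
      ((c1 * norm w) * (t powr \<alpha> / \<alpha>) + (c2 * norm w) * (t powr (- (2 - \<alpha>)) / (2 - \<alpha>)))"
      using \<alpha> t c by (intro two_power_integral) auto
    moreover have "two_power \<alpha> (2 - \<alpha>) t (c1 * norm w) (c2 * norm w) = (\<lambda>\<tau>. kpow (\<alpha> - 1) \<tau> * b \<tau>)"
    proof -
      have "\<tau> powr (- (2 - \<alpha>) - 1) = \<tau> powr (\<alpha> - 1) / \<tau>\<^sup>2" if "\<tau> > 0" for \<tau>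
      proof -
        have "\<tau> powr (- (2 - \<alpha>) - 1) = \<tau> powr ((\<alpha> - 1) - 2)" by (simp add: algebra_simps)
        then show ?thesis using that powr_realpow[of \<tau> 2] by (simp only: powr_diff) simp
      qed
      then show ?thesis using t by (auto simp: two_power_def kpow_def b_def fun_eq_iff)
    qed
    ultimately show "has_bochner_integral lborel (\<lambda>\<tau>. kpow (\<alpha> - 1) \<tau> * b \<tau>)
      ((c1 * norm w) * (t powr \<alpha> / \<alpha>) + (c2 * norm w) * (t powr (- (2 - \<alpha>)) / (2 - \<alpha>)))" by simp
  qed
  also have "t powr (- (2 - \<alpha>)) = t powr \<alpha> / t\<^sup>2"
  proof -
    have "t powr (- (2 - \<alpha>)) = t powr (\<alpha> - 2)" by simp
    then show ?thesis using t powr_realpow[of t 2] by (simp only: powr_diff) simp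
  qed
  finally have main: "Gamma \<alpha> * (pi / sin (pi * \<alpha>)) * norm (Rem t s x)
      \<le> (c1 * norm w) * (t powr \<alpha> / \<alpha>) + (c2 * norm w) * (t powr \<alpha> / t\<^sup>2 / (2 - \<alpha>))"
    by (simp add: total Gamma_reflection_real)
  define Q where "Q = t powr \<alpha> * norm w / t\<^sup>2 * (s - t)\<^sup>2"
  have Q: "Q \<ge> 0" by (simp add: Q_def)
  have rhs: "(c1 * norm w) * (t powr \<alpha> / \<alpha>) + (c2 * norm w) * (t powr \<alpha> / t\<^sup>2 / (2 - \<alpha>))
      = Q * (K / \<alpha> + M 2 / 2 / (2 - \<alpha>))"
    by (simp add: c1_def c2_def Q_def algebra_simps)
  have "sin (pi * \<alpha>) > 0" using \<alpha> by (intro sin_gt_zero) auto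
  then have c0: "sin (pi * \<alpha>) / pi > 0" by simp
  have "\<alpha> * (M 2 / 2 / (2 - \<alpha>)) \<le> 1 * K"
  proof -
    have "M 2 / 2 * (\<alpha> / (2 - \<alpha>)) \<le> M 2 / 2 * 1"
      using \<alpha> M2_nonneg by (intro mult_left_mono) auto
    also have "\<dots> \<le> K" using M0_nonneg M1_nonneg by (simp add: K_def)
    finally show ?thesis by (simp add: mult_ac)
  qed
  then have K2: "\<alpha> * (K / \<alpha> + M 2 / 2 / (2 - \<alpha>)) \<le> 2 * K" using \<alpha> by (simp add: algebra_simps)
  have "\<alpha> \<notin> \<int>\<^sub>\<le>\<^sub>0" using \<alpha>(1) by (auto elim!: nonpos_Ints_cases')
  then have Ga: "Gamma (1 + \<alpha>) = \<alpha> * Gamma \<alpha>" using Gamma_plus1[of \<alpha>] by (simp add: add.commute)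
  have "1 / 2 * norm (Rem t s x) \<le> \<alpha> * Gamma \<alpha> * norm (Rem t s x)"
    using Gamma_ge_half[OF \<alpha>] unfolding Ga by (rule mult_right_mono) simp
  also have "\<dots> = \<alpha> * (sin (pi * \<alpha>) / pi) * (Gamma \<alpha> * (pi / sin (pi * \<alpha>)) * norm (Rem t s x))"
    using \<open>sin (pi * \<alpha>) > 0\<close> by simp
  also have "\<dots> \<le> \<alpha> * (sin (pi * \<alpha>) / pi) * (Q * (K / \<alpha> + M 2 / 2 / (2 - \<alpha>)))"
    by (intro mult_left_mono[OF main[unfolded rhs]] mult_nonneg_nonneg less_imp_le[OF \<alpha>(1)] less_imp_le[OF c0])
  also have "\<dots> = (sin (pi * \<alpha>) / pi) * Q * (\<alpha> * (K / \<alpha> + M 2 / 2 / (2 - \<alpha>)))" by (simp only: mult_ac)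
  also have "\<dots> \<le> (sin (pi * \<alpha>) / pi) * Q * (2 * K)"
    by (intro mult_left_mono K2 mult_nonneg_nonneg less_imp_le[OF c0] Q)
  also have "norm z = (sin (pi * \<alpha>) / pi) * norm w" unfolding z using \<open>sin (pi * \<alpha>) > 0\<close> by simp
  then have "(sin (pi * \<alpha>) / pi) * Q * (2 * K) = 2 * K * t powr \<alpha> * norm z / t\<^sup>2 * (s - t)\<^sup>2"
    unfolding Q_def by (simp only: mult_ac times_divide_eq_right times_divide_eq_left)
  finally show ?thesis by simp
qed

text \<open>\<open>Rem t s\<close> is bounded, so the estimate passes to the closure of the graph.\<close>

lemma Rem_balakrishnan_le:
  assumes \<alpha>: "0 < \<alpha>" "\<alpha> < 1" and t: "t > 0" and s: "s \<ge> 0" and xz: "(x, z) \<in> balakrishnan A \<alpha>"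
  shows "norm (Rem t s x) \<le> 4 * K * t powr \<alpha> * norm z / t\<^sup>2 * (s - t)\<^sup>2"
proof (rule Rem_at_0[OF t _ s])
  fix s :: real assume s: "s > 0"
  define S :: "('a \<times> 'a) set" where "S = {xz. norm (Rem t s (fst xz)) \<le> 4 * K * t powr \<alpha> * norm (snd xz) / t\<^sup>2 * (s - t)\<^sup>2}"
  have cont: "continuous_on UNIV (Rem t s)" using Rem_linear[OF t] s by (intro linear_continuous_on) auto
  have "closed S"
    unfolding S_def
  proof (rule closed_Collect_le)
    show "continuous_on UNIV (\<lambda>xz :: 'a \<times> 'a. norm (Rem t s (fst xz)))"
      by (rule continuous_on_norm[OF continuous_on_compose2[OF cont continuous_on_fst[OF continuous_on_id]]]) simp
    show "continuous_on UNIV (\<lambda>xz :: 'a \<times> 'a. 4 * K * t powr \<alpha> * norm (snd xz) / t\<^sup>2 * (s - t)\<^sup>2)"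
      using t by (intro continuous_intros) auto
  qed
  moreover have "pre_balakrishnan \<alpha> \<subseteq> S"
    using Rem_pre_balakrishnan_le[OF \<alpha> t s] by (auto simp: S_def)
  ultimately have "closure (pre_balakrishnan \<alpha>) \<subseteq> S" by (rule closure_minimal[rotated])
  then show "norm (Rem t s x) \<le> 4 * K * t powr \<alpha> * norm z / t\<^sup>2 * (s - t)\<^sup>2"
    using xz by (auto simp: balakrishnan_eq S_def)
qed

lemma frac_power_fraction: "0 < \<alpha> \<Longrightarrow> \<alpha> < 1 \<Longrightarrow> frac_power A \<alpha> = balakrishnan A \<alpha>"
proof -
  assume "0 < \<alpha>" "\<alpha> < 1"
  then have "\<lfloor>\<alpha>\<rfloor> = 0" "frac \<alpha> = \<alpha>" by (auto simp: frac_eq floor_eq_iff)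
  then show ?thesis using \<open>0 < \<alpha>\<close> by (simp add: frac_power_def)
qed

lemma op_app_frac_power:
  assumes \<alpha>: "0 < \<alpha>" "\<alpha> < 1" and x: "x \<in> Domain (frac_power A \<alpha>)"
  shows "(x, op_app (frac_power A \<alpha>) x) \<in> balakrishnan A \<alpha>"
proof -
  obtain z where z: "(x, z) \<in> balakrishnan A \<alpha>" using x by (auto simp: frac_power_fraction[OF \<alpha>])
  then have "op_app (frac_power A \<alpha>) x = z"
    unfolding op_app_def frac_power_fraction[OF \<alpha>] using balakrishnan_unique[OF \<alpha>] by (intro the_equality) auto
  with z show ?thesis by simp
qed

end

section \<open>Approximation of the semigroup\<close>

context bounded_holomorphic_semigroup
begin

text \<open>A quadratic bound on the Taylor remainder integrates to a bound by the variance.\<close>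

lemma hille_phillips_error:
  assumes sets: "sets (bernstein_measure h) = sets (restrict_space borel {0..})"
    and prob: "prob_space (bernstein_measure h)"
    and mean: "has_bochner_integral (bernstein_measure h) (\<lambda>s. s) t"
    and int: "integrable (bernstein_measure h) (\<lambda>s. (s - t)\<^sup>2)"
    and var: "(LINT s|bernstein_measure h. (s - t)\<^sup>2) \<le> v"
    and rem: "\<And>s. s \<ge> 0 \<Longrightarrow> norm (Rem t s x) \<le> c * (s - t)\<^sup>2" and c: "c \<ge> 0"
  shows "norm (hille_phillips h T x - T t x) \<le> c * v"
proof -
  let ?\<nu> = "bernstein_measure h"
  interpret prob_space ?\<nu> by (rule prob)
  have space: "space ?\<nu> = {0..}" using sets_eq_imp_space_eq[OF sets] by (simp add: space_restrict_space)
  obtain y where y: "bochner_integral_eq ?\<nu> (\<lambda>s. T s x) y"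
    using bochner_integral_eq_exists[OF finite_measure_axioms sets T_continuous T_le] by blast
  have "hille_phillips h T x = y"
    unfolding hille_phillips_def using y bochner_integral_eq_unique[OF _ y] by (intro the_equality)
  moreover have "norm (y - T t x) \<le> (LINT s|?\<nu>. c * (s - t)\<^sup>2)"
  proof (rule bochner_integral_norm_le[OF y prob mean, where d = "- AT t x"])
    show "integrable ?\<nu> (\<lambda>s. c * (s - t)\<^sup>2)" by (intro integrable_mult_right int)
    show "norm (T s x - T t x - (s - t) *\<^sub>R - AT t x) \<le> c * (s - t)\<^sup>2" if "s \<in> space ?\<nu>" for s
      using rem[of s] that by (simp add: space Rem_def)
  qed
  moreover have "(LINT s|?\<nu>. c * (s - t)\<^sup>2) \<le> c * v" using var c by (simp add: mult_left_mono)
  ultimately show ?thesis by simp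
qed

end

theorem theorem1p3:
  fixes g :: "real \<Rightarrow> real \<Rightarrow> real"
    and T :: "real \<Rightarrow> 'a \<Rightarrow> 'a::complex_banach"
    and A :: "('a \<times> 'a) set"
    and M :: "real \<Rightarrow> real"
    and K :: real
  assumes "\<And>t. t > 0 \<Longrightarrow> completely_monotone (g t)"
    and "\<And>t. t > 0 \<Longrightarrow> deriv_at_zero 0 (g t) = 1"
    and "\<And>t. t > 0 \<Longrightarrow> deriv_at_zero 1 (g t) = - 1"
    and "\<And>t. t > 0 \<Longrightarrow> deriv_at_zero 2 (g t) < \<infinity>"
    and "sectorially_bounded_holomorphic_semigroup T"
    and "generator T = op_uminus A"
    and "\<And>\<beta>. \<beta> \<ge> 0 \<Longrightarrow>
           M \<beta> = (SUP t\<in>{0<..}. onorm (\<lambda>x. t powr \<beta> *\<^sub>R op_app (frac_power A \<beta>) (T t x)))"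
    and "K = 3 * M 0 + 3 * M 1 + M 2 / 2"
  shows "(\<forall>n\<ge>1. \<forall>t>0. \<forall>x\<in>Domain A.
            norm (hille_phillips (\<lambda>z. g t (t * z / real n) ^ n) T x - T t x)
              \<le> (2 * M 0 + 3 * M 1 / 2) * ((real_of_ereal (deriv_at_zero 2 (g t)) - 1) / real n)
                  * t * norm (op_app A x))
       \<and> (\<forall>n\<ge>1. \<forall>t>0.
            onorm (\<lambda>x. hille_phillips (\<lambda>z. g t (t * z / real n) ^ n) T x - T t x)
              \<le> K * ((real_of_ereal (deriv_at_zero 2 (g t)) - 1) / real n))
       \<and> (\<forall>\<alpha>. 0 < \<alpha> \<and> \<alpha> < 1 \<longrightarrow>
            (\<forall>n\<ge>1. \<forall>t>0. \<forall>x\<in>Domain (frac_power A \<alpha>).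
               norm (hille_phillips (\<lambda>z. g t (t * z / real n) ^ n) T x - T t x)
                 \<le> 4 * K * ((real_of_ereal (deriv_at_zero 2 (g t)) - 1) / real n)
                     * t powr \<alpha> * norm (op_app (frac_power A \<alpha>) x)))"
proof -
  interpret S: bounded_holomorphic_semigroup T A
    by unfold_locales (rule assms(5), rule assms(6))
  have M_eq: "M \<beta> = S.M \<beta>" if "\<beta> \<ge> 0" for \<beta> unfolding S.M_def by (rule assms(7)[OF that])
  have K_eq: "K = S.K" unfolding assms(8) S.K_def by (simp add: M_eq)
  define q where "q n t = (real_of_ereal (deriv_at_zero 2 (g t)) - 1) / real n" for n t
  define h where "h n t z = g t (t * z / real n) ^ n" for n t z
  have error: "norm (hille_phillips (h n t) T x - T t x) \<le> c * (t\<^sup>2 * q n t)"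
    if "n \<ge> 1" "t > 0" "\<And>s. s \<ge> 0 \<Longrightarrow> norm (S.Rem t s x) \<le> c * (s - t)\<^sup>2" "c \<ge> 0" for n t x c
    using scaled_power_measure[OF assms(1-4)[OF that(2)] that(1,2)] that(3,4)
    unfolding h_def[abs_def] q_def by (intro S.hille_phillips_error)
  have q: "q n t \<ge> 0" if "n \<ge> 1" "t > 0" for n t
  proof -
    have "0 \<le> (LINT s|bernstein_measure (h n t). (s - t)\<^sup>2)" by (rule integral_nonneg_AE) simp
    also have "\<dots> \<le> t\<^sup>2 * q n t"
      using scaled_power_measure(5)[OF assms(1-4)[OF that(2)] that] by (simp add: h_def[abs_def] q_def)
    finally show ?thesis using that(2) by (simp add: zero_le_mult_iff)
  qed
  have "norm (hille_phillips (h n t) T x - T t x) \<le> (2 * M 0 + 3 * M 1 / 2) * q n t * t * norm (op_app A x)"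
    if n: "n \<ge> 1" and t: "t > 0" and x: "x \<in> Domain A" for n t x
  proof -
    obtain y where xy: "(x, y) \<in> A" using x by blast
    have "norm (hille_phillips (h n t) T x - T t x) \<le> S.M 1 * norm y / t * (t\<^sup>2 * q n t)"
      using t S.M1_nonneg by (intro error n S.Rem_dom_le xy) auto
    also have "\<dots> = S.M 1 * (q n t * t * norm y)" using t by (simp add: power2_eq_square)
    also have "\<dots> \<le> (2 * S.M 0 + 3 * S.M 1 / 2) * (q n t * t * norm y)"
      using S.M0_nonneg S.M1_nonneg q[OF n t] t by (intro mult_right_mono) auto
    finally show ?thesis by (simp add: S.op_app_A[OF xy] M_eq mult_ac)
  qed
  moreover have "onorm (\<lambda>x. hille_phillips (h n t) T x - T t x) \<le> K * q n t" if n: "n \<ge> 1" and t: "t > 0" for n t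
  proof (rule onorm_bound)
    show "0 \<le> K * q n t" using S.K_nonneg q[OF n t] by (simp add: K_eq)
    fix x
    have "norm (hille_phillips (h n t) T x - T t x) \<le> S.K * norm x / t\<^sup>2 * (t\<^sup>2 * q n t)"
      using t S.K_nonneg by (intro error n S.Rem_le) auto
    then show "norm (hille_phillips (h n t) T x - T t x) \<le> K * q n t * norm x"
      using t by (simp add: K_eq mult_ac)
  qed
  moreover have "norm (hille_phillips (h n t) T x - T t x)
      \<le> 4 * K * q n t * t powr \<alpha> * norm (op_app (frac_power A \<alpha>) x)"
    if \<alpha>: "0 < \<alpha>" "\<alpha> < 1" and n: "n \<ge> 1" and t: "t > 0" and x: "x \<in> Domain (frac_power A \<alpha>)" for \<alpha> n t x
  proof -
    let ?z = "op_app (frac_power A \<alpha>) x"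
    have "norm (hille_phillips (h n t) T x - T t x) \<le> 4 * S.K * t powr \<alpha> * norm ?z / t\<^sup>2 * (t\<^sup>2 * q n t)"
      using t S.K_nonneg by (intro error n S.Rem_balakrishnan_le[OF \<alpha>] S.op_app_frac_power[OF \<alpha> x]) auto
    then show ?thesis using t by (simp add: K_eq mult_ac)
  qed
  ultimately show ?thesis unfolding h_def[abs_def] q_def by blast
qed

end
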